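(* The $M$-module $\mathcal{M}_1^1=\bigoplus_k M_{1,k}(\Gamma[\sqrt{-3}],\det)$ is generated by the $S_4$-anti-invariant Eisenstein series $E_{1,1}$ of weight $(1,1)$ and the $S_4$-invariant Eisenstein series $E_{1,4}$ of weight $(1,4)$.
   Context: Let $F=\mathbb{Q}(\sqrt{-3})\subset\mathbb{C}$, $\rho=(-1+\sqrt{-3})/2$, $O_F=\mathbb{Z}[\rho]$. Let $h(z,w)=z_1\bar w_2+z_2\bar w_1+z_3\bar w_3$, $\Gamma=\{g\in \mathrm{GL}_3(O_F): h(gz,gw)=h(z,w)\}$, $\Gamma_1=\{g\in\Gamma:\det g=1\}$, $\Gamma[\sqrt{-3}]=\{g\in\Gamma: g\equiv 1 \bmod \sqrt{-3}\}$, $\Gamma_1[\sqrt{-3}]=\Gamma_1\cap\Gamma[\sqrt{-3}]$. Let $B=\{(u,v)\in\mathbb{C}^2: 2\,\mathrm{Re}\,v+|u|^2<0\}$, where $(u,v)$ corresponds to the line $(v:1:u)$. A matrix $g=(g_{ij})$ acts by $(u,v)\mapsto\left(\frac{g_{31}v+g_{32}+g_{33}u}{j_1},\frac{g_{11}v+g_{12}+g_{13}u}{j_1}\right)$ with $j_1=j_1(g,u,v)=g_{21}v+g_{22}+g_{23}u$. With $G_{ij}$ the minor of $g_{ij}$ put $j_2(g,u,v)=\det(g)^{-1}\begin{pmatrix}G_{32}u+G_{33}&G_{32}v+G_{31}\\ G_{12}u+G_{13}&G_{12}v+G_{11}\end{pmatrix}$. For $f:B\to \mathrm{Sym}^j(\mathbb{C}^2)$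 put $(f|_{j,k}g)(b)=j_1(g,b)^{-k}\,\mathrm{Sym}^j(j_2(g,b)^{-1})f(g\cdot b)$. $M_{j,k}(\Gamma[\sqrt{-3}],\det^\ell)$ is the space of holomorphic $f:B\to\mathrm{Sym}^j(\mathbb{C}^2)$ with $f|_{j,k}g=\det(g)^\ell f$ for all $g\in\Gamma[\sqrt{-3}]$. Such $f$ has a Fourier-Jacobi expansion $f(u,v)=\sum_{n\ge0}f_n(u)w^n$, $w=e^{2\pi v/\sqrt3}$; $f$ is a cusp form ($f\in S_{j,k}$) if the constant term of $f|_{j,k}\gamma$ vanishes for every $\gamma\in\Gamma$. The four cusps of $\Gamma_1[\sqrt{-3}]$ are represented by $c_1=(1:0:0)$, $c_2=(0:1:0)$ and $c_3,c_4$ (the points $(\rho:1:\pm1)$ in some fixed order). The permutation of the cusps gives an isomorphism $\Gamma_1/\Gamma_1[\sqrt{-3}]\cong S_4$, and $S_4$ acts on $M_{j,k}(\Gamma[\sqrt{-3}],\det^\ell)$ by $\sigma(f)=f|_{j,k}g^{-1}$ for $g\in\Gamma_1$ inducing $\sigma$. Anti-invariant means transforming by the sign character. $M=\bigoplus_k M_{0,k}(\Gamma[\sqrt{-3}])$. It is known that $M=\mathbb{C}[\varphi_0,\varphi_1,\varphi_2]$ is a polynomial ring with $\varphi_i\in M_{0,3}(\Gamma[\sqrt{-3}])$ having constant term $1$ in the Fourier-Jacobi expansion and such that $x_1=\varphi_0+\varphi_1+\varphi_2$, $x_2=-3\varphi_0+\varphi_1+\varphi_2$, $x_3=\varphi_0-3\varphi_1+\varphi_2$,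 $x_4=\varphi_0+\varphi_1-3\varphi_2$ satisfy $\sigma(x_i)=\mathrm{sgn}(\sigma)x_{\sigma(i)}$. The space $S_{0,6}(\Gamma[\sqrt{-3}],\det)$ is one-dimensional, generated by a form $\zeta$ with $\zeta^3=\frac{-\rho}{\sqrt{-3}\,3^7}\varphi_0\varphi_1\varphi_2(\varphi_1-\varphi_0)(\varphi_2-\varphi_0)(\varphi_2-\varphi_1)$. For scalar-valued forms $f$ of weight $k$ and $g$ of weight $l$ put $[f,g]=\frac1l f\nabla g-\frac1k g\nabla f$, with $\nabla f=(\partial f/\partial u,\partial f/\partial v)^t$. Put $\Phi_0=-\frac{[\varphi_1,\varphi_2]}{6\pi\sqrt{-1}}$, $\Phi_1=-\frac{[\varphi_2,\varphi_0]}{6\pi\sqrt{-1}}$, $\Phi_2=-\frac{[\varphi_0,\varphi_1]}{6\pi\sqrt{-1}}$, which lie in $S_{1,7}(\Gamma[\sqrt{-3}])$. Put $\Psi_1=\frac1\zeta\left(\varphi_0(\varphi_1-\varphi_0)\Phi_0-\varphi_2(\varphi_2-\varphi_1)\Phi_2\right)\in S_{1,7}(\Gamma[\sqrt{-3}],\det^2)$ and $\Psi_2=\frac1\zeta\left(\varphi_0(\varphi_0-\varphi_1)(\varphi_0+\varphi_1-3\varphi_2)\Phi_0-\varphi_2(\varphi_1-\varphi_2)(\varphi_1+\varphi_2-3\varphi_0)\Phi_2\right)\in S_{1,10}(\Gamma[\sqrt{-3}],\det^2)$. The Eisenstein series are $E_{1,1}=\Psi_1/\zeta\in M_{1,1}(\Gamma[\sqrt{-3}],\det)$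 and $E_{1,4}=\Psi_2/\zeta\in M_{1,4}(\Gamma[\sqrt{-3}],\det)$. *)

theory Defs
  imports "HOL-Analysis.Analysis" "HOL-Algebra.Module"
begin

definition rho :: complex where
  "rho = (- 1 + \<i> * complex_of_real (sqrt 3)) / 2"

definition sqrtm3 :: complex where
  "sqrtm3 = \<i> * complex_of_real (sqrt 3)"

definition O_F :: "complex set" where
  "O_F = {of_int a + of_int b * rho | a b :: int. True}"

definition herm :: "complex^3 \<Rightarrow> complex^3 \<Rightarrow> complex" where
  "herm z w = z$1 * cnj (w$2) + z$2 * cnj (w$1) + z$3 * cnj (w$3)"

definition GL3_O_F :: "(complex^3^3) set" where
  "GL3_O_F = {g. (\<forall>i j. g$i$j \<in> O_F) \<and>
     (\<exists>g'. (\<forall>i j. g'$i$j \<in> O_F) \<and> g ** g' = mat 1 \<and> g' ** g = mat 1)}"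

definition Gam :: "(complex^3^3) set" where
  "Gam = {g \<in> GL3_O_F. \<forall>z w. herm (g *v z) (g *v w) = herm z w}"

definition Gam1 :: "(complex^3^3) set" where
  "Gam1 = {g \<in> Gam. det g = 1}"

definition Gam_cong :: "(complex^3^3) set" where
  "Gam_cong = {g \<in> Gam. \<forall>i j. \<exists>a\<in>O_F. g$i$j - (mat 1 :: complex^3^3)$i$j = sqrtm3 * a}"

definition Gam1_cong :: "(complex^3^3) set" where
  "Gam1_cong = Gam1 \<inter> Gam_cong"

type_synonym pt = "complex \<times> complex"

definition Bal :: "pt set" where
  "Bal = {(u, v). 2 * Re v + (cmod u)\<^sup>2 < 0}"

definition j1 :: "complex^3^3 \<Rightarrow> pt \<Rightarrow> complex" where
  "j1 g = (\<lambda>(u, v). g$2$1 * v + g$2$2 + g$2$3 * u)"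

definition act :: "complex^3^3 \<Rightarrow> pt \<Rightarrow> pt" where
  "act g = (\<lambda>(u, v).
     ((g$3$1 * v + g$3$2 + g$3$3 * u) / j1 g (u, v),
      (g$1$1 * v + g$1$2 + g$1$3 * u) / j1 g (u, v)))"

text \<open>The increasing enumeration of \<open>{1,2,3} - {i}\<close>, where \<open>3 = 0\<close> in type \<open>3\<close>.\<close>

definition skip :: "3 \<Rightarrow> 2 \<Rightarrow> 3" where
  "skip i a =
     (if i = 1 then (if a = 1 then 2 else 3)
      else if i = 2 then (if a = 1 then 1 else 3)
      else (if a = 1 then 1 else 2))"

text \<open>The unsigned minor. With this convention \<open>j2 g b\<close> is \<open>1 / j1 g b\<close> times the inverse
  transpose of the Jacobian matrix of the action of \<open>g\<close> at \<open>b\<close>.\<close>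

definition minor :: "complex^3^3 \<Rightarrow> 3 \<Rightarrow> 3 \<Rightarrow> complex" where
  "minor g i j = det (\<chi> a b. g $ skip i a $ skip j b :: complex^2^2)"

definition j2 :: "complex^3^3 \<Rightarrow> pt \<Rightarrow> complex^2^2" where
  "j2 g = (\<lambda>(u, v). \<chi> a b. inverse (det g) *
     (vector [vector [minor g 3 2 * u + minor g 3 3, minor g 3 2 * v + minor g 3 1],
              vector [minor g 1 2 * u + minor g 1 3, minor g 1 2 * v + minor g 1 1]]
       :: complex^2^2) $ a $ b)"

text \<open>The slash operators for \<open>j = 0\<close>, where \<open>Sym\<^sup>0\<close> is the trivial representation on
  \<open>complex\<close>, and for \<open>j = 1\<close>, where \<open>Sym\<^sup>1\<close> is the standard one on \<open>complex^2\<close>.\<close>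

definition slash0 :: "int \<Rightarrow> (pt \<Rightarrow> complex) \<Rightarrow> complex^3^3 \<Rightarrow> pt \<Rightarrow> complex" where
  "slash0 k f g b = j1 g b powi (- k) * f (act g b)"

definition slash1 :: "int \<Rightarrow> (pt \<Rightarrow> complex^2) \<Rightarrow> complex^3^3 \<Rightarrow> pt \<Rightarrow> complex^2" where
  "slash1 k f g b = j1 g b powi (- k) *s (matrix_inv (j2 g b) *v f (act g b))"

text \<open>Holomorphy in two variables: a complex linear total derivative at each point.\<close>

definition holo :: "(pt \<Rightarrow> complex) \<Rightarrow> bool" where
  "holo f \<longleftrightarrow> (\<forall>b\<in>Bal. \<exists>p q. (f has_derivative (\<lambda>(x, y). p * x + q * y)) (at b))"

definition vholo :: "(pt \<Rightarrow> complex^2) \<Rightarrow> bool" where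
  "vholo f \<longleftrightarrow> (\<forall>i. holo (\<lambda>b. f b $ i))"

text \<open>A function on the ball is encoded as a function on \<open>complex \<times> complex\<close> that is \<open>0\<close>
  off the ball, so that equality of functions is equality on the ball.\<close>

definition off_zero :: "(pt \<Rightarrow> 'v::zero) \<Rightarrow> bool" where
  "off_zero f \<longleftrightarrow> (\<forall>b. b \<notin> Bal \<longrightarrow> f b = 0)"

text \<open>\<open>M0 l k\<close> and \<open>M1 l k\<close> are the spaces of forms of weight \<open>(0, k)\<close> and \<open>(1, k)\<close> on the
  congruence subgroup with character \<open>det ^ l\<close>.\<close>

definition M0 :: "nat \<Rightarrow> int \<Rightarrow> (pt \<Rightarrow> complex) set" where
  "M0 l k = {f. off_zero f \<and> holo f \<and>
     (\<forall>g\<in>Gam_cong. \<forall>b\<in>Bal. slash0 k f g b = det g ^ l * f b)}"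

definition M1 :: "nat \<Rightarrow> int \<Rightarrow> (pt \<Rightarrow> complex^2) set" where
  "M1 l k = {f. off_zero f \<and> vholo f \<and>
     (\<forall>g\<in>Gam_cong. \<forall>b\<in>Bal. slash1 k f g b = det g ^ l *s f b)}"

text \<open>\<open>c n\<close> is the \<open>n\<close>-th Fourier-Jacobi coefficient as a function of \<open>u\<close>; it is unique since
  the values of \<open>exp (2 * pi * v / sqrt 3)\<close> for fixed \<open>u\<close> fill a punctured disc around \<open>0\<close>.\<close>

definition fourier_jacobi :: "(pt \<Rightarrow> complex) \<Rightarrow> (nat \<Rightarrow> complex \<Rightarrow> complex) \<Rightarrow> bool" where
  "fourier_jacobi f c \<longleftrightarrow> (\<forall>(u, v)\<in>Bal.
     (\<lambda>n. c n u * exp (2 * complex_of_real pi * v / complex_of_real (sqrt 3)) ^ n) sums f (u, v))"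

definition has_constant_term :: "(pt \<Rightarrow> complex) \<Rightarrow> complex \<Rightarrow> bool" where
  "has_constant_term f t \<longleftrightarrow> (\<exists>c. fourier_jacobi f c \<and> (\<forall>u. c 0 u = t))"

definition S0 :: "nat \<Rightarrow> int \<Rightarrow> (pt \<Rightarrow> complex) set" where
  "S0 l k = {f \<in> M0 l k. \<forall>g\<in>Gam. has_constant_term (slash0 k f g) 0}"

text \<open>The sign \<open>e\<close> fixes the order of the last two cusps.\<close>

definition cusp :: "complex \<Rightarrow> nat \<Rightarrow> complex^3" where
  "cusp e i =
     (if i = 1 then vector [1, 0, 0]
      else if i = 2 then vector [0, 1, 0]
      else if i = 3 then vector [rho, 1, e]
      else vector [rho, 1, - e])"

definition induces :: "complex \<Rightarrow> complex^3^3 \<Rightarrow> (nat \<Rightarrow> nat) \<Rightarrow> bool" where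
  "induces e g \<sigma> \<longleftrightarrow> (\<forall>i\<in>{1..4}. \<exists>h\<in>Gam1_cong. \<exists>t. t \<noteq> 0 \<and>
     g *v cusp e i = t *s (h *v cusp e (\<sigma> i)))"

definition S4_invariant :: "complex \<Rightarrow> int \<Rightarrow> (pt \<Rightarrow> complex^2) \<Rightarrow> bool" where
  "S4_invariant e k f \<longleftrightarrow>
     (\<forall>\<sigma> g. \<sigma> permutes {1..4} \<and> g \<in> Gam1 \<and> induces e g \<sigma> \<longrightarrow>
       (\<forall>b\<in>Bal. slash1 k f (matrix_inv g) b = f b))"

definition S4_anti_invariant :: "complex \<Rightarrow> int \<Rightarrow> (pt \<Rightarrow> complex^2) \<Rightarrow> bool" where
  "S4_anti_invariant e k f \<longleftrightarrow>
     (\<forall>\<sigma> g. \<sigma> permutes {1..4} \<and> g \<in> Gam1 \<and> induces e g \<sigma> \<longrightarrow>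
       (\<forall>b\<in>Bal. slash1 k f (matrix_inv g) b = of_int (sign \<sigma>) *s f b))"

definition direct_sum :: "(int \<Rightarrow> (pt \<Rightarrow> 'v::zero) set) \<Rightarrow> (int \<Rightarrow> pt \<Rightarrow> 'v) set" where
  "direct_sum A = {F. (\<forall>k. F k \<in> A k) \<and> finite {k. F k \<noteq> (\<lambda>_. 0)}}"

definition homog :: "int \<Rightarrow> (pt \<Rightarrow> 'v::zero) \<Rightarrow> int \<Rightarrow> pt \<Rightarrow> 'v" where
  "homog k f n = (if n = k then f else (\<lambda>_. 0))"

definition conv ::
  "('a::zero \<Rightarrow> 'b \<Rightarrow> 'c::comm_monoid_add) \<Rightarrow> (int \<Rightarrow> pt \<Rightarrow> 'a) \<Rightarrow> (int \<Rightarrow> pt \<Rightarrow> 'b)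
     \<Rightarrow> int \<Rightarrow> pt \<Rightarrow> 'c" where
  "conv m F G n b = (\<Sum>k | F k \<noteq> (\<lambda>_. 0). m (F k b) (G (n - k) b))"

definition const_form :: "complex \<Rightarrow> int \<Rightarrow> pt \<Rightarrow> complex" where
  "const_form a = homog 0 (\<lambda>b. if b \<in> Bal then a else 0)"

definition MRing :: "(int \<Rightarrow> pt \<Rightarrow> complex) ring" where
  "MRing = \<lparr> carrier = direct_sum (M0 0),
             mult = conv (*),
             one = const_form 1,
             zero = (\<lambda>_ _. 0),
             add = (\<lambda>F G k b. F k b + G k b) \<rparr>"

text \<open>HOL-Algebra modules carry irrelevant multiplicative ring fields.\<close>

definition M1Mod :: "nat \<Rightarrow> (int \<Rightarrow> pt \<Rightarrow> complex, int \<Rightarrow> pt \<Rightarrow> complex^2) module" where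
  "M1Mod l = \<lparr> carrier = direct_sum (M1 l),
               mult = undefined,
               one = undefined,
               zero = (\<lambda>_ _. 0),
               add = (\<lambda>F G k b. F k b + G k b),
               smult = conv (*s) \<rparr>"

text \<open>\<open>R\<close> is the polynomial ring in \<open>x\<close>, \<open>y\<close>, \<open>z\<close> over the complex numbers, which are
  embedded in \<open>R\<close> by \<open>em\<close>: evaluation is a bijection from the finitely supported families of
  coefficients to \<open>R\<close>.\<close>

definition is_polynomial_ring ::
  "('r, 's) ring_scheme \<Rightarrow> (complex \<Rightarrow> 'r) \<Rightarrow> 'r \<Rightarrow> 'r \<Rightarrow> 'r \<Rightarrow> bool" where
  "is_polynomial_ring R em x y z \<longleftrightarrow>
     cring R \<and> x \<in> carrier R \<and> y \<in> carrier R \<and> z \<in> carrier R \<and>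
     bij_betw
       (\<lambda>c :: nat \<times> nat \<times> nat \<Rightarrow> complex.
          finsum R (\<lambda>(p, q, r). em (c (p, q, r)) \<otimes>\<^bsub>R\<^esub>
                      (x [^]\<^bsub>R\<^esub> p \<otimes>\<^bsub>R\<^esub> y [^]\<^bsub>R\<^esub> q \<otimes>\<^bsub>R\<^esub> z [^]\<^bsub>R\<^esub> r))
            {a. c a \<noteq> 0})
       {c. finite {a. c a \<noteq> 0}} (carrier R)"

definition generated_by ::
  "('r, 's) ring_scheme \<Rightarrow> ('r, 'm, 't) module_scheme \<Rightarrow> 'm set \<Rightarrow> bool" where
  "generated_by R N S \<longleftrightarrow>
     module R N \<and> S \<subseteq> carrier N \<and>
     (\<forall>H. submodule H R N \<and> S \<subseteq> H \<longrightarrow> H = carrier N)"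

definition grad :: "(pt \<Rightarrow> complex) \<Rightarrow> pt \<Rightarrow> complex^2" where
  "grad f = (\<lambda>(u, v). vector [deriv (\<lambda>x. f (x, v)) u, deriv (\<lambda>y. f (u, y)) v])"

text \<open>\<open>bracket k l f g\<close> is \<open>[f, g]\<close> for \<open>f\<close> of weight \<open>k\<close> and \<open>g\<close> of weight \<open>l\<close>.\<close>

definition bracket ::
  "int \<Rightarrow> int \<Rightarrow> (pt \<Rightarrow> complex) \<Rightarrow> (pt \<Rightarrow> complex) \<Rightarrow> pt \<Rightarrow> complex^2" where
  "bracket k l f g b = (f b / of_int l) *s grad g b - (g b / of_int k) *s grad f b"

definition Phi :: "(pt \<Rightarrow> complex) \<Rightarrow> (pt \<Rightarrow> complex) \<Rightarrow> pt \<Rightarrow> complex^2" where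
  "Phi f g b = - (1 / (6 * complex_of_real pi * \<i>)) *s bracket 3 3 f g b"

text \<open>\<open>q = N / z\<close> as a holomorphic function on the ball. The pointwise quotient is not the right
  notion, as it would be \<open>0\<close> at the zeros of \<open>z\<close>. If \<open>z\<close> is holomorphic and not identically
  zero, then \<open>q\<close> is unique.\<close>

definition is_quotient :: "(pt \<Rightarrow> complex^2) \<Rightarrow> (pt \<Rightarrow> complex^2) \<Rightarrow> (pt \<Rightarrow> complex) \<Rightarrow> bool" where
  "is_quotient q N z \<longleftrightarrow> off_zero q \<and> vholo q \<and> (\<forall>b\<in>Bal. z b *s q b = N b)"

end

theory Submission
  imports Defs "HOL-Complex_Analysis.Conformal_Mappings" "HOL-Combinatorics.Permutations"
    "HOL-Computational_Algebra.Polynomial_Factorial"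
begin

text \<open>
  The wedge product of two forms of weights \<open>(1, k)\<close> and \<open>(1, l)\<close> with character \<open>det\<close> is a scalar
  form of weight \<open>k + l + 1\<close> with character \<open>det\<^sup>4 = det\<close>. Every scalar form \<open>h\<close> with character \<open>det\<close>
  is divisible by \<open>\<zeta>\<close>: \<open>h \<zeta>\<^sup>2\<close> and \<open>h\<^sup>3\<close> have trivial character, hence are polynomials \<open>A\<close> and \<open>B\<close> in the
  \<open>\<phi>\<^sub>i\<close>, and \<open>\<zeta>\<^sup>3\<close> is a square-free polynomial \<open>P\<close>, so that \<open>A\<^sup>3 = B P\<^sup>2\<close> forces \<open>P\<close> to divide \<open>A\<close>.
  In particular the wedge product of \<open>E\<^bsub>1,1\<^esub>\<close> and \<open>E\<^bsub>1,4\<^esub>\<close> is \<open>c \<zeta>\<close> with a constant \<open>c\<close>, and if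
  \<open>c \<noteq> 0\<close>, then Cramer's rule expresses every form in terms of \<open>E\<^bsub>1,1\<^esub>\<close> and \<open>E\<^bsub>1,4\<^esub>\<close>.

  The constant \<open>c\<close> is not \<open>0\<close> because the Jacobian determinant of \<open>\<phi>\<^sub>0, \<phi>\<^sub>1, \<phi>\<^sub>2\<close> does not vanish
  identically. This is seen on the fixed curve \<open>u = 0\<close> of the reflection \<open>diag(1, 1, \<rho>)\<close>. There
  \<open>\<zeta>\<close> vanishes, and the element of the group that interchanges the first two cusps shows that the
  factor of \<open>\<zeta>\<^sup>3\<close> that vanishes is \<open>\<phi>\<^sub>2 - \<phi>\<^sub>1\<close> and that \<open>\<phi>\<^sub>1 / \<phi>\<^sub>0\<close> is not constant.

  An element of \<open>\<Gamma>\<^sub>1\<close> multiplies \<open>\<zeta>\<close> by the sign times a cube root of unity. The latter is trivial, since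
  a permutation of four letters or its product with a fixed transposition has order dividing \<open>4\<close>.
\<close>

text \<open>The quotients by \<open>\<zeta>\<close> are given only through equations
  \<open>\<zeta> * q = N\<close>. Statements about an Eisenstein series \<open>E\<close> are
  therefore proved for its numerator \<open>N = \<zeta>^2 * E\<close> and carried across the zeros
  of \<open>\<zeta>\<close> by the identity theorem. In this way an element that multiplies
  \<open>\<zeta>\<close> by \<open>s\<close> affects \<open>E\<close> through \<open>s^2\<close>
  alone, and \<open>s^2 = 1\<close> is what the last paragraph above has to deliver. The polynomial
  ring hypothesis is about graded families of functions, but the divisibility argument needs that a
  polynomial vanishes as soon as its values at all points of the ball do; \<open>graded_zero\<close>
  closes this gap. A permutation is attached to a matrix only up to the congruence subgroup and up
  to scalars. To conclude that a power of a matrix lies in the congruence subgroup, everything is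
  reduced modulo \<open>sqrtm3\<close>, where the cusps become four points in general position in a
  projective plane over the field with three elements.\<close>

lemma open_Bal: "open Bal"
proof -
  have "Bal = {b. 2 * Re (snd b) + (cmod (fst b))^2 < 0}"
    by (auto simp: Bal_def)
  moreover have "open {b :: pt. 2 * Re (snd b) + (cmod (fst b))^2 < 0}"
    by (intro open_Collect_less continuous_intros)
  ultimately show ?thesis by simp
qed

lemma convex_Bal: "convex Bal"
proof (rule convexI)
  fix b c :: pt and s t :: real
  assume bc: "b \<in> Bal" "c \<in> Bal" and st: "0 \<le> s" "0 \<le> t" "s + t = 1"
  obtain u v u' v' where b: "b = (u, v)" and c: "c = (u', v')" by fastforce
  have B: "2 * Re v + (cmod u)^2 < 0" "2 * Re v' + (cmod u')^2 < 0"
    using bc by (auto simp: Bal_def b c)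
  have s: "s = 1 - t" using st by simp
  have "(cmod (s *\<^sub>R u + t *\<^sub>R u'))^2 \<le> (s * cmod u + t * cmod u')^2"
    using norm_triangle_ineq[of "s *\<^sub>R u" "t *\<^sub>R u'"] st by (simp add: power_mono)
  also have "\<dots> \<le> s * (cmod u)^2 + t * (cmod u')^2"
    using convex_onD[OF convex_power2, of t "cmod u" "cmod u'"] st by (simp add: s)
  finally have 1: "(cmod (s *\<^sub>R u + t *\<^sub>R u'))^2 \<le> s * (cmod u)^2 + t * (cmod u')^2" .
  have "s * (2 * Re v + (cmod u)^2) + t * (2 * Re v' + (cmod u')^2) < 0"
  proof (cases "s = 0")
    case False
    then have "s * (2 * Re v + (cmod u)^2) < 0" using st B by (simp add: mult_pos_neg)
    moreover have "t * (2 * Re v' + (cmod u')^2) \<le> 0"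
      using st B by (simp add: mult_nonneg_nonpos)
    ultimately show ?thesis by linarith
  qed (use st B in simp)
  with 1 show "s *\<^sub>R b + t *\<^sub>R c \<in> Bal"
    by (simp add: Bal_def b c algebra_simps)
qed

text \<open>A point of the ball is a negative line, scaled to have second coordinate 1. Both
  \<open>j1_nonzero\<close> and \<open>act_Bal\<close> follow from the invariance of
  \<open>herm\<close> through this description.\<close>

lemma Bal_herm: "(u, v) \<in> Bal \<longleftrightarrow> Re (herm (vector [v, 1, u]) (vector [v, 1, u])) < 0"
  by (simp add: Bal_def herm_def cmod_power2) (simp add: power2_eq_square)

lemma herm_scale: "herm (c *s z) (c *s z) = of_real ((cmod c)^2) * herm z z"
proof -
  have "of_real ((cmod c)^2) = c * cnj c" by (rule complex_norm_square)
  then show ?thesis by (simp only: herm_def vector_smult_component complex_cnj_mult)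
    (simp add: algebra_simps)
qed

lemma act_homogeneous:
  assumes "j1 g (u, v) \<noteq> 0"
  shows "g *v vector [v, 1, u] =
    j1 g (u, v) *s vector [snd (act g (u, v)), 1, fst (act g (u, v))]"
proof -
  let ?j = "j1 g (u, v)"
  have "fst (act g (u, v)) * ?j = g$3$1 * v + g$3$2 + g$3$3 * u"
    "snd (act g (u, v)) * ?j = g$1$1 * v + g$1$2 + g$1$3 * u"
    using assms by (simp_all add: act_def)
  then show ?thesis
    by (simp add: vec_eq_iff forall_3 matrix_vector_mult_def sum_3 mult.commute)
       (simp add: j1_def)
qed

lemma Gam_herm: "g \<in> Gam \<Longrightarrow> herm (g *v z) (g *v w) = herm z w"
  by (simp add: Gam_def)

text \<open>A vector with second coordinate 0 has norm \<open>|z3|^2 >= 0\<close>, so it cannot be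
  the image of a negative vector.\<close>

lemma j1_nonzero:
  assumes g: "g \<in> Gam" and b: "b \<in> Bal"
  shows "j1 g b \<noteq> 0"
proof
  assume 0: "j1 g b = 0"
  obtain u v where uv: "b = (u, v)" by fastforce
  let ?z = "vector [v, 1, u] :: complex^3"
  have "(g *v ?z) $ 2 = 0"
    using 0 by (simp add: uv j1_def matrix_vector_mult_def sum_3)
  then have "Re (herm (g *v ?z) (g *v ?z)) \<ge> 0"
    by (simp add: herm_def)
  then show False using b g by (simp add: uv Bal_herm Gam_herm)
qed

lemma act_Bal:
  assumes g: "g \<in> Gam" and b: "b \<in> Bal"
  shows "act g b \<in> Bal"
proof -
  obtain u v where uv: "b = (u, v)" by fastforce
  let ?z = "vector [v, 1, u] :: complex^3"
  let ?w = "vector [snd (act g (u, v)), 1, fst (act g (u, v))] :: complex^3"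
  have j: "j1 g (u, v) \<noteq> 0" using j1_nonzero[OF g b] uv by simp
  have "herm ?z ?z = of_real ((cmod (j1 g (u, v)))^2) * herm ?w ?w"
    using Gam_herm[OF g, of ?z ?z] act_homogeneous[OF j] by (simp add: herm_scale)
  then have "Re (herm ?z ?z) = (cmod (j1 g (u, v)))^2 * Re (herm ?w ?w)"
    by (simp del: of_real_power)
  moreover have "Re (herm ?z ?z) < 0" using b uv by (simp add: Bal_herm)
  ultimately have "Re (herm ?w ?w) < 0"
    by (metis mult_less_0_iff not_less zero_le_power2)
  then show ?thesis using Bal_herm[of "fst (act g b)" "snd (act g b)"] uv by simp
qed

lemma homogeneous_inj:
  fixes v v' u u' c d :: complex
  assumes "c *s (vector [v, 1, u] :: complex^3) = d *s vector [v', 1, u']" "c \<noteq> 0"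
  shows "c = d \<and> v = v' \<and> u = u'"
  using assms by (auto simp: vec_eq_iff forall_3)

text \<open>Both laws come from one computation: the image of \<open>(v, 1, u)\<close> under the
  product is a scaled normalised vector in two ways, and \<open>homogeneous_inj\<close> compares
  scale and vector.\<close>

lemma Gam_mult_aux:
  assumes g: "g \<in> Gam" and h: "h \<in> Gam" and b: "b \<in> Bal"
  shows "j1 (g ** h) b = j1 g (act h b) * j1 h b \<and> act (g ** h) b = act g (act h b)"
proof -
  obtain u v where uv: "b = (u, v)" by fastforce
  obtain u' v' where uv': "act h b = (u', v')" by fastforce
  have jh: "j1 h (u, v) \<noteq> 0" using j1_nonzero[OF h b] uv by simp
  have jg: "j1 g (u', v') \<noteq> 0" using j1_nonzero[OF g act_Bal[OF h b]] uv' by simp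
  have eq: "(g ** h) *v vector [v, 1, u] = (j1 g (u', v') * j1 h (u, v)) *s
      vector [snd (act g (u', v')), 1, fst (act g (u', v'))]"
    using act_homogeneous[OF jh] act_homogeneous[OF jg] uv uv'
    by (simp add: matrix_vector_mul_assoc[symmetric] matrix_vector_mult_scaleR
        vector_scalar_commute vector_smult_assoc mult.commute)
  have "j1 (g ** h) (u, v) = ((g ** h) *v vector [v, 1, u]) $ 2"
    by (simp add: j1_def matrix_vector_mult_def sum_3)
  then have j: "j1 (g ** h) (u, v) = j1 g (u', v') * j1 h (u, v)" by (simp add: eq)
  then have "j1 (g ** h) (u, v) \<noteq> 0" using jh jg by simp
  from act_homogeneous[OF this] eq homogeneous_inj[OF _ this] j
  show ?thesis by (metis prod.collapse uv uv')
qed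

lemmas j1_cocycle = Gam_mult_aux[THEN conjunct1]
lemmas act_mult = Gam_mult_aux[THEN conjunct2]

lemma j1_one [simp]: "j1 (mat 1) b = 1"
  by (cases b) (simp add: j1_def mat_def)

lemma act_one [simp]: "act (mat 1) b = b"
  by (cases b) (simp add: act_def j1_def mat_def)

section \<open>Arithmetic of the Eisenstein integers modulo \<open>sqrtm3\<close>\<close>

lemma O_F_of_int: "of_int a \<in> O_F"
  by (force simp: O_F_def intro: exI[of _ a] exI[of _ 0])

lemma O_F_0 [simp]: "0 \<in> O_F" and O_F_1 [simp]: "1 \<in> O_F"
  using O_F_of_int[of 0] O_F_of_int[of 1] by simp_all

lemma rho_sq: "rho ^ 2 = - 1 - rho"
  by (simp add: rho_def power2_eq_square field_simps flip: of_real_mult)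

lemma rho_mult: "rho * rho = - 1 - rho"
  using rho_sq by (simp add: power2_eq_square)

lemma rho_cube: "rho ^ 3 = 1"
proof -
  have "rho ^ 3 = rho * rho ^ 2" by (simp add: power3_eq_cube power2_eq_square)
  then show ?thesis by (simp add: rho_mult rho_sq algebra_simps)
qed

lemma cnj_rho: "cnj rho = - 1 - rho"
  by (simp add: rho_def complex_eq_iff)

lemma sqrtm3_rho: "sqrtm3 = 1 + 2 * rho"
  by (simp add: rho_def sqrtm3_def field_simps)

lemma sqrtm3_nonzero [simp]: "sqrtm3 \<noteq> 0"
  by (simp add: sqrtm3_def)

lemma O_F_rho [simp]: "rho \<in> O_F"
  by (force simp: O_F_def intro: exI[of _ 0] exI[of _ 1])

lemma O_F_add [simp]:
  assumes "x \<in> O_F" "y \<in> O_F" shows "x + y \<in> O_F"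
proof -
  from assms obtain a b c d where
    "x = of_int a + of_int b * rho" "y = of_int c + of_int d * rho"
    by (auto simp: O_F_def)
  then have "x + y = of_int (a + c) + of_int (b + d) * rho" by (simp add: algebra_simps)
  then show ?thesis unfolding O_F_def by blast
qed

lemma O_F_uminus [simp]:
  assumes "x \<in> O_F" shows "- x \<in> O_F"
proof -
  from assms obtain a b where "x = of_int a + of_int b * rho" by (auto simp: O_F_def)
  then have "- x = of_int (- a) + of_int (- b) * rho" by (simp add: algebra_simps)
  then show ?thesis unfolding O_F_def by blast
qed

lemma O_F_diff [simp]: "x \<in> O_F \<Longrightarrow> y \<in> O_F \<Longrightarrow> x - y \<in> O_F"
  using O_F_add[of x "- y"] by simp

lemma O_F_mult [simp]:
  assumes "x \<in> O_F" "y \<in> O_F" shows "x * y \<in> O_F"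
proof -
  from assms obtain a b c d where
    xy: "x = of_int a + of_int b * rho" "y = of_int c + of_int d * rho"
    by (auto simp: O_F_def)
  have "x * y = of_int (a * c) + of_int (a * d + b * c) * rho + of_int (b * d) * (rho * rho)"
    unfolding xy by (simp add: algebra_simps)
  also have "\<dots> = of_int (a * c - b * d) + of_int (a * d + b * c - b * d) * rho"
    unfolding rho_mult by (simp add: algebra_simps)
  finally show ?thesis unfolding O_F_def by blast
qed

definition sq3_dvd :: "complex \<Rightarrow> bool" where
  "sq3_dvd z \<longleftrightarrow> (\<exists>a\<in>O_F. z = sqrtm3 * a)"

lemma sq3_dvd_0 [simp]: "sq3_dvd 0"
  by (auto simp: sq3_dvd_def intro: bexI[of _ 0])

lemma sq3_dvd_add: "sq3_dvd x \<Longrightarrow> sq3_dvd y \<Longrightarrow> sq3_dvd (x + y)"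
  unfolding sq3_dvd_def by (metis O_F_add distrib_left)

lemma sq3_dvd_uminus: "sq3_dvd x \<Longrightarrow> sq3_dvd (- x)"
  unfolding sq3_dvd_def by (metis O_F_uminus mult_minus_right)

lemma sq3_dvd_diff: "sq3_dvd x \<Longrightarrow> sq3_dvd y \<Longrightarrow> sq3_dvd (x - y)"
  using sq3_dvd_add[of x "- y"] sq3_dvd_uminus[of y] by simp

lemma sq3_dvd_mult: "sq3_dvd x \<Longrightarrow> y \<in> O_F \<Longrightarrow> sq3_dvd (x * y)"
  unfolding sq3_dvd_def by (metis O_F_mult mult.assoc)

lemma rho_coeff_eq:
  fixes a b c d :: int
  assumes "of_int a + of_int b * rho = of_int c + of_int d * rho"
  shows "a = c \<and> b = d"
proof -
  have "Im (of_int a + of_int b * rho) = Im (of_int c + of_int d * rho)"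
    using assms by simp
  then have "b = d" by (simp add: rho_def)
  with assms show ?thesis by simp
qed

text \<open>The residue field at \<open>sqrtm3\<close> has three elements, and \<open>rho\<close> is
  1 there; so \<open>a + b * rho\<close> reduces to \<open>a + b\<close>.\<close>

lemma sq3_dvd_iff: "sq3_dvd (of_int a + of_int b * rho) \<longleftrightarrow> 3 dvd (a + b)"
proof
  assume "sq3_dvd (of_int a + of_int b * rho)"
  then obtain c d where "of_int a + of_int b * rho = sqrtm3 * (of_int c + of_int d * rho)"
    by (auto simp: sq3_dvd_def O_F_def)
  also have "\<dots> = of_int c + of_int (2 * c + d) * rho + of_int (2 * d) * (rho * rho)"
    by (simp add: sqrtm3_rho algebra_simps)
  also have "\<dots> = of_int (c - 2 * d) + of_int (2 * c - d) * rho"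
    unfolding rho_mult by (simp add: algebra_simps)
  finally have "a = c - 2 * d \<and> b = 2 * c - d" by (rule rho_coeff_eq)
  then show "3 dvd (a + b)" by presburger
next
  assume "3 dvd (a + b)"
  then obtain k where k: "a = 3 * k - b" by (auto simp: dvd_def algebra_simps)
  \<comment> \<open>The quotient \<open>c + d * rho\<close> solves \<open>c - 2 * d = a\<close>,
    \<open>2 * c - d = b\<close>, the system found in the first direction.\<close>
  have "sqrtm3 * (of_int (b - k) + of_int (b - 2 * k) * rho)
     = of_int (b - k) + of_int (2 * (b - k) + (b - 2 * k)) * rho + of_int (2 * (b - 2 * k)) * (rho * rho)"
    by (simp add: sqrtm3_rho algebra_simps)
  also have "\<dots> = of_int a + of_int b * rho"
    unfolding rho_mult k by (simp add: algebra_simps)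
  finally show "sq3_dvd (of_int a + of_int b * rho)"
    unfolding sq3_dvd_def O_F_def by (metis (mono_tags, lifting) mem_Collect_eq)
qed

lemma O_F_residue:
  assumes "x \<in> O_F"
  obtains "sq3_dvd x" | "sq3_dvd (x - 1)" | "sq3_dvd (x + 1)"
proof -
  from assms obtain a b where x: "x = of_int a + of_int b * rho" by (auto simp: O_F_def)
  have "x - 1 = of_int (a - 1) + of_int b * rho" "x + 1 = of_int (a + 1) + of_int b * rho"
    by (simp_all add: x)
  then have "sq3_dvd x \<longleftrightarrow> 3 dvd (a + b)" "sq3_dvd (x - 1) \<longleftrightarrow> 3 dvd (a - 1 + b)"
    "sq3_dvd (x + 1) \<longleftrightarrow> 3 dvd (a + 1 + b)"
    using sq3_dvd_iff by (simp_all only: x)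
  moreover have "3 dvd (a + b) \<or> 3 dvd (a - 1 + b) \<or> 3 dvd (a + 1 + b)" by presburger
  ultimately show thesis using that by blast
qed

lemma not_sq3_dvd_1: "\<not> sq3_dvd 1"
  using sq3_dvd_iff[of 1 0] by simp

lemma not_sq3_dvd_2: "\<not> sq3_dvd 2"
  using sq3_dvd_iff[of 2 0] by simp

lemma O_F_norm: "(cmod (of_int a + of_int b * rho))^2 = of_int (a * a - a * b + b * b)"
  unfolding cmod_power2
  by (simp add: rho_def power2_eq_square field_simps)

text \<open>The norm of an element of \<open>O_F\<close> is a non-negative integer, so a unit has norm \<open>1\<close>.\<close>

lemma O_F_unit_cases:
  assumes "x \<in> O_F" "y \<in> O_F" "x * y = 1"
  shows "x \<in> {1, rho, rho^2, - 1, - rho, - (rho^2)}"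
proof -
  obtain a b where x: "x = of_int a + of_int b * rho" using assms by (auto simp: O_F_def)
  obtain c d where y: "y = of_int c + of_int d * rho" using assms by (auto simp: O_F_def)
  have "(cmod x)^2 * (cmod y)^2 = 1"
    using assms(3) by (metis norm_mult norm_one power_mult_distrib power_one)
  then have "of_int ((a * a - a * b + b * b) * (c * c - c * d + d * d)) = (of_int 1 :: real)"
    by (simp only: x y O_F_norm of_int_mult of_int_1)
  then have "(a * a - a * b + b * b) * (c * c - c * d + d * d) = 1" by (simp only: of_int_eq_iff)
  moreover have "a * a - a * b + b * b \<ge> 0"
  proof -
    have "2 * (a * a - a * b + b * b) = a * a + b * b + (a - b) * (a - b)"
      by (simp add: algebra_simps)
    also have "\<dots> \<ge> 0" by simp
    finally show ?thesis by simp
  qed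
  ultimately have n: "a * a - a * b + b * b = 1" by (auto simp: zmult_eq_1_iff)
  \<comment> \<open>Completing the square in either variable: norm 1 leaves
    \<open>3 * a^2 <= 4\<close> and \<open>3 * b^2 <= 4\<close>, so both coordinates lie in {-1, 0,
    1}.\<close>
  have a: "4 * (a * a - a * b + b * b) = (2 * b - a) * (2 * b - a) + 3 * (a * a)"
    and b: "4 * (a * a - a * b + b * b) = (2 * a - b) * (2 * a - b) + 3 * (b * b)"
    by (simp_all add: algebra_simps)
  have le: "y \<le> 4" if "4 = x * x + y" for x y :: int
    using that zero_le_square[of x] by linarith
  have "3 * (a * a) \<le> 4" using a n by (intro le[of "2 * b - a"]) presburger
  moreover have "3 * (b * b) \<le> 4" using b n by (intro le[of "2 * a - b"]) presburger
  ultimately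
  have "\<bar>a\<bar>^2 < 2^2" "\<bar>b\<bar>^2 < 2^2" by (simp_all add: power2_eq_square)
  then have "\<bar>a\<bar> < 2" "\<bar>b\<bar> < 2" by (metis power2_less_imp_less zero_le_numeral)+
  then have "a \<in> {-1, 0, 1}" "b \<in> {-1, 0, 1}" by auto
  with n show ?thesis by (auto simp: x rho_sq)
qed

lemma O_F_unit_residue:
  assumes "x \<in> O_F" "y \<in> O_F" "x * y = 1"
  shows "\<exists>s. (s = 1 \<or> s = - 1) \<and> sq3_dvd (x - s)"
proof -
  have "\<not> sq3_dvd x" using sq3_dvd_mult[of x y] assms not_sq3_dvd_1 by auto
  then show ?thesis
    using O_F_residue[OF assms(1)] by (metis diff_minus_eq_add)
qed

text \<open>Since \<open>rho\<close> is 1 modulo \<open>sqrtm3\<close>, the units congruent to 1 are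
  the cube roots of unity, and their negatives are congruent to -1. Applied to determinants, this
  makes the character \<open>det ^ l\<close> of the congruence subgroup depend on \<open>l\<close>
  modulo 3 only.\<close>

lemma O_F_unit_cube:
  assumes "x \<in> O_F" "y \<in> O_F" "x * y = 1" "sq3_dvd (x - 1)"
  shows "x ^ 3 = 1"
proof -
  have r: "(rho ^ 2) ^ 3 = 1" by (metis power_mult mult.commute rho_cube power_one)
  have "\<not> sq3_dvd (- 1 - 1)" "\<not> sq3_dvd (- rho - 1)" "\<not> sq3_dvd (- (rho^2) - 1)"
    using sq3_dvd_iff[of "-2" 0] sq3_dvd_iff[of "-1" "-1"] sq3_dvd_iff[of "0" 1]
    by (simp_all add: rho_sq algebra_simps)
  then show ?thesis
    using O_F_unit_cases[OF assms(1-3)] assms(4) rho_cube r by auto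
qed

section \<open>Holomorphic functions of two variables on the ball\<close>

definition has_grad :: "(pt \<Rightarrow> complex) \<Rightarrow> complex \<Rightarrow> complex \<Rightarrow> pt \<Rightarrow> bool" where
  "has_grad f p q b \<longleftrightarrow> (f has_derivative (\<lambda>(x, y). p * x + q * y)) (at b)"

lemma holo_iff: "holo f \<longleftrightarrow> (\<forall>b\<in>Bal. \<exists>p q. has_grad f p q b)"
  by (simp add: holo_def has_grad_def)

lemma has_grad_const: "has_grad (\<lambda>_. c) 0 0 b"
  unfolding has_grad_def by (simp add: case_prod_unfold)

lemma has_grad_fst: "has_grad fst 1 0 b"
  unfolding has_grad_def by (auto intro!: derivative_eq_intros)

lemma has_grad_snd: "has_grad snd 0 1 b"
  unfolding has_grad_def by (auto intro!: derivative_eq_intros)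

lemma has_grad_add:
  "has_grad f p q b \<Longrightarrow> has_grad h r s b \<Longrightarrow> has_grad (\<lambda>b. f b + h b) (p + r) (q + s) b"
  unfolding has_grad_def
  by (auto intro!: derivative_eq_intros simp: fun_eq_iff algebra_simps)

lemma has_grad_mult:
  "has_grad f p q b \<Longrightarrow> has_grad h r s b \<Longrightarrow>
    has_grad (\<lambda>b. f b * h b) (p * h b + f b * r) (q * h b + f b * s) b"
  unfolding has_grad_def
  by (auto intro!: derivative_eq_intros simp: fun_eq_iff algebra_simps)

lemma has_grad_cmult: "has_grad f p q b \<Longrightarrow> has_grad (\<lambda>b. c * f b) (c * p) (c * q) b"
  using has_grad_mult[OF has_grad_const[of c b], of f p q] by simp

lemma has_grad_divide:
  assumes "has_grad f p q b" "has_grad h r s b" "h b \<noteq> 0"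
  shows "has_grad (\<lambda>b. f b / h b) ((p * h b - f b * r) / (h b)^2) ((q * h b - f b * s) / (h b)^2) b"
proof -
  have "((\<lambda>b. f b / h b) has_derivative
     (\<lambda>y. ((case y of (x, y) \<Rightarrow> p * x + q * y) * h b -
        f b * (case y of (x, y) \<Rightarrow> r * x + s * y)) / (h b * h b))) (at b)"
    using assms unfolding has_grad_def by (intro has_derivative_divide')
  also have "(\<lambda>y. ((case y of (x, y) \<Rightarrow> p * x + q * y) * h b -
        f b * (case y of (x, y) \<Rightarrow> r * x + s * y)) / (h b * h b)) =
     (\<lambda>(x, y). (p * h b - f b * r) / (h b)^2 * x + (q * h b - f b * s) / (h b)^2 * y)"
    using assms(3) by (simp add: fun_eq_iff power2_eq_square add_divide_distrib diff_divide_distrib algebra_simps)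
  finally show ?thesis unfolding has_grad_def .
qed

lemma has_grad_compose:
  assumes f: "has_grad f p q (a b, c b)" and a: "has_grad a a1 a2 b" and c: "has_grad c c1 c2 b"
  shows "has_grad (\<lambda>b. f (a b, c b)) (p * a1 + q * c1) (p * a2 + q * c2) b"
proof -
  have "((\<lambda>b. (a b, c b)) has_derivative
      (\<lambda>z. (case z of (x, y) \<Rightarrow> a1 * x + a2 * y, case z of (x, y) \<Rightarrow> c1 * x + c2 * y))) (at b)"
    using a c unfolding has_grad_def by (intro has_derivative_Pair)
  from has_derivative_compose[OF this] f
  have "((\<lambda>b. f (a b, c b)) has_derivative
     (\<lambda>z. (\<lambda>(x, y). p * x + q * y)
        (case z of (x, y) \<Rightarrow> a1 * x + a2 * y, case z of (x, y) \<Rightarrow> c1 * x + c2 * y))) (at b)"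
    unfolding has_grad_def by blast
  also have "(\<lambda>z. (\<lambda>(x, y). p * x + q * y)
        (case z of (x, y) \<Rightarrow> a1 * x + a2 * y, case z of (x, y) \<Rightarrow> c1 * x + c2 * y)) =
     (\<lambda>(x, y). (p * a1 + q * c1) * x + (p * a2 + q * c2) * y)"
    by (auto simp: fun_eq_iff algebra_simps)
  finally show ?thesis unfolding has_grad_def .
qed

lemma has_grad_cong:
  assumes "has_grad f p q b" "b \<in> Bal" "\<And>c. c \<in> Bal \<Longrightarrow> f c = h c"
  shows "has_grad h p q b"
  using assms open_Bal unfolding has_grad_def
  by (blast intro: has_derivative_transform_within_open)

lemma has_grad_line:
  assumes "has_grad f p q (u + t * d, v + t * e)"
  shows "((\<lambda>t. f (u + t * d, v + t * e)) has_field_derivative (p * d + q * e)) (at t)"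
proof -
  have "((\<lambda>t. (u + t * d, v + t * e)) has_derivative (\<lambda>s. (s * d, s * e))) (at t)"
    by (auto intro!: derivative_eq_intros)
  from has_derivative_compose[OF this] assms
  have "((\<lambda>t. f (u + t * d, v + t * e)) has_derivative
     (\<lambda>s. (\<lambda>(x, y). p * x + q * y) (s * d, s * e))) (at t)"
    unfolding has_grad_def by blast
  also have "(\<lambda>s. (\<lambda>(x, y). p * x + q * y) (s * d, s * e)) = (*) (p * d + q * e)"
    by (auto simp: fun_eq_iff algebra_simps)
  finally show ?thesis unfolding has_field_derivative_def .
qed

text \<open>Partial derivatives alone obey no chain rule; through the total derivative,
  \<open>grad\<close> can be computed by the rules for \<open>has_grad\<close>.\<close>

lemma grad_eq:
  assumes "has_grad f p q b"
  shows "grad f b = vector [p, q]"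
proof -
  obtain u v where b: "b = (u, v)" by fastforce
  have "((\<lambda>x. f (0 + x * 1, v + x * 0)) has_field_derivative (p * 1 + q * 0)) (at u)"
    using assms b by (intro has_grad_line) simp
  moreover have "((\<lambda>y. f (u + y * 0, 0 + y * 1)) has_field_derivative (p * 0 + q * 1)) (at v)"
    using assms b by (intro has_grad_line) simp
  ultimately show ?thesis by (simp add: grad_def b DERIV_imp_deriv)
qed

lemma holo_has_grad: "holo f \<Longrightarrow> b \<in> Bal \<Longrightarrow> has_grad f (grad f b $ 1) (grad f b $ 2) b"
  by (metis grad_eq holo_iff vector_2)

lemma holo_const: "holo (\<lambda>_. c)"
  unfolding holo_iff using has_grad_const by blast

lemma holo_fst: "holo fst" and holo_snd: "holo snd"
  unfolding holo_iff using has_grad_fst has_grad_snd by blast+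

lemma holo_add: "holo f \<Longrightarrow> holo h \<Longrightarrow> holo (\<lambda>b. f b + h b)"
  unfolding holo_iff using has_grad_add by blast

lemma holo_mult: "holo f \<Longrightarrow> holo h \<Longrightarrow> holo (\<lambda>b. f b * h b)"
  unfolding holo_iff using has_grad_mult by blast

lemma holo_cmult: "holo f \<Longrightarrow> holo (\<lambda>b. c * f b)"
  using holo_mult[OF holo_const] by blast

lemma holo_uminus: "holo f \<Longrightarrow> holo (\<lambda>b. - f b)"
  using holo_cmult[of f "-1"] by simp

lemma holo_diff: "holo f \<Longrightarrow> holo h \<Longrightarrow> holo (\<lambda>b. f b - h b)"
  using holo_add[of f "\<lambda>b. - h b"] holo_uminus[of h] by simp

lemma holo_power: "holo f \<Longrightarrow> holo (\<lambda>b. f b ^ n)"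
  by (induction n) (simp_all add: holo_const holo_mult)

lemma holo_sum: "(\<And>i. i \<in> A \<Longrightarrow> holo (f i)) \<Longrightarrow> holo (\<lambda>b. \<Sum>i\<in>A. f i b)"
  by (induction A rule: infinite_finite_induct) (simp_all add: holo_const holo_add)

lemma holo_divide:
  "holo f \<Longrightarrow> holo h \<Longrightarrow> (\<And>b. b \<in> Bal \<Longrightarrow> h b \<noteq> 0) \<Longrightarrow> holo (\<lambda>b. f b / h b)"
  unfolding holo_iff using has_grad_divide by blast

lemma holo_cong: "holo f \<Longrightarrow> (\<And>b. b \<in> Bal \<Longrightarrow> f b = h b) \<Longrightarrow> holo h"
  unfolding holo_iff using has_grad_cong by blast

lemma holo_restrict: "holo f \<Longrightarrow> holo (\<lambda>b. if b \<in> Bal then f b else 0)"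
  by (erule holo_cong) simp

lemmas holo_intros = holo_const holo_fst holo_snd holo_add holo_mult holo_uminus holo_diff
  holo_power holo_sum

lemma holo_continuous: "holo f \<Longrightarrow> continuous_on Bal f"
  unfolding holo_iff has_grad_def continuous_on_eq_continuous_at[OF open_Bal]
  using has_derivative_continuous by blast

text \<open>Restriction to a complex line makes the one-variable identity theorem applicable; the
  slice of the ball is open and, by convexity, connected.\<close>

lemma holo_line:
  assumes "holo f"
  shows "(\<lambda>t. f (u + t * d, v + t * e)) holomorphic_on {t. (u + t * d, v + t * e) \<in> Bal}"
proof (rule holomorphic_onI)
  fix t assume "t \<in> {t. (u + t * d, v + t * e) \<in> Bal}"
  then obtain p q where "has_grad f p q (u + t * d, v + t * e)"
    using assms by (auto simp: holo_iff)
  from has_grad_line[OF this]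
  show "(\<lambda>t. f (u + t * d, v + t * e)) field_differentiable
      at t within {t. (u + t * d, v + t * e) \<in> Bal}"
    by (meson field_differentiable_at_within field_differentiable_def)
qed

lemma open_line: "open {t. (u + t * d, v + t * e) \<in> Bal}"
proof -
  have "open ((\<lambda>t. (u + t * d, v + t * e)) -` Bal)"
    by (intro continuous_open_vimage open_Bal continuous_intros)
  then show ?thesis by (simp add: vimage_def)
qed

lemma convex_line: "convex {t. (u + t * d, v + t * e) \<in> Bal}"
proof (rule convexI)
  fix x y :: complex and s r :: real
  assume xy: "x \<in> {t. (u + t * d, v + t * e) \<in> Bal}" "y \<in> {t. (u + t * d, v + t * e) \<in> Bal}"
    and sr: "0 \<le> s" "0 \<le> r" "s + r = 1"
  then have "s *\<^sub>R (u + x * d, v + x * e) + r *\<^sub>R (u + y * d, v + y * e) \<in> Bal"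
    by (intro convexD[OF convex_Bal]) auto
  also have "s *\<^sub>R (u + x * d, v + x * e) + r *\<^sub>R (u + y * d, v + y * e) =
    ((s + r) *\<^sub>R u + (s *\<^sub>R x + r *\<^sub>R y) * d, (s + r) *\<^sub>R v + (s *\<^sub>R x + r *\<^sub>R y) * e)"
    by (simp add: algebra_simps)
  finally show "s *\<^sub>R x + r *\<^sub>R y \<in> {t. (u + t * d, v + t * e) \<in> Bal}" using sr by simp
qed

lemma open_nonzero:
  fixes f :: "'a::topological_space \<Rightarrow> 'b::{t1_space,zero}"
  assumes "continuous_on S f" "open S"
  shows "open {x\<in>S. f x \<noteq> 0}"
proof -
  have "{x\<in>S. f x \<noteq> 0} = S \<inter> f -` (UNIV - {0})" by auto
  then show ?thesis
    using continuous_open_preimage[OF assms open_delete[OF open_UNIV, of 0]] by simp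
qed

text \<open>The two points are independent of each other, so the conclusion says that one of the
  functions vanishes identically. Indeed \<open>h\<close> vanishes on the open set where
  \<open>f\<close> does not, and this spreads over all of \<open>S\<close>.\<close>

lemma holomorphic_mult_eq_0:
  assumes "f holomorphic_on S" "h holomorphic_on S" "open S" "connected S"
    and 0: "\<And>z. z \<in> S \<Longrightarrow> f z * h z = 0" and ab: "a \<in> S" "b \<in> S"
  shows "f a = 0 \<or> h b = 0"
proof (rule ccontr)
  assume "\<not> ?thesis"
  then have nz: "f a \<noteq> 0" "h b \<noteq> 0" by auto
  have "open {z \<in> S. f z \<noteq> 0}"
    by (rule open_nonzero[OF holomorphic_on_imp_continuous_on[OF assms(1)] \<open>open S\<close>])
  moreover have "a \<in> {z \<in> S. f z \<noteq> 0}" using nz ab by auto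
  ultimately have "a islimpt {z \<in> S. f z \<noteq> 0}"
    using open_imp_islimpt by blast
  moreover have "h z = 0" if "z \<in> {z \<in> S. f z \<noteq> 0}" for z using 0 that by auto
  ultimately have "h b = 0"
    using analytic_continuation[OF assms(2-4), of "{z \<in> S. f z \<noteq> 0}" a b] ab by auto
  then show False using nz by simp
qed

lemma holo_mult_eq_0:
  assumes "holo f" "holo h" "\<And>b. b \<in> Bal \<Longrightarrow> f b * h b = 0" "b \<in> Bal" "c \<in> Bal"
  shows "f b = 0 \<or> h c = 0"
proof -
  let ?S = "{t. (fst b + t * (fst c - fst b), snd b + t * (snd c - snd b)) \<in> Bal}"
  have "0 \<in> ?S" "1 \<in> ?S" using assms(4,5) by auto
  with holomorphic_mult_eq_0[OF holo_line[OF assms(1)] holo_line[OF assms(2)] open_line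
      convex_connected[OF convex_line], of "fst b" "fst c - fst b" "snd b" "snd c - snd b" 0 1]
    assms(3)
  show ?thesis by simp
qed

text \<open>The tool for quotients by \<open>\<zeta>\<close>: an identity is checked after
  multiplication by a factor and then holds at the zeros of that factor as well.\<close>

lemma holo_mult_cancel:
  assumes "holo f" "holo h" "holo k" "\<And>b. b \<in> Bal \<Longrightarrow> f b * h b = f b * k b"
    "\<exists>b\<in>Bal. f b \<noteq> 0" "c \<in> Bal"
  shows "h c = k c"
proof -
  obtain b where b: "b \<in> Bal" "f b \<noteq> 0" using assms by blast
  from holo_mult_eq_0[OF assms(1) holo_diff[OF assms(2,3)] _ b(1) assms(6)] assms(4) b
  show ?thesis by (simp add: right_diff_distrib)
qed

lemma holo_j1: "holo (j1 g)"
proof -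
  have "holo (\<lambda>b. g$2$1 * snd b + g$2$2 + g$2$3 * fst b)" by (intro holo_intros)
  then show ?thesis by (simp add: j1_def case_prod_unfold)
qed

section \<open>Automorphy factors and the Jacobian of the action\<close>

lemma minor_eqs:
  "minor g 1 1 = g$2$2 * g$3$3 - g$2$3 * g$3$2"
  "minor g 1 2 = g$2$1 * g$3$3 - g$2$3 * g$3$1"
  "minor g 1 3 = g$2$1 * g$3$2 - g$2$2 * g$3$1"
  "minor g 3 1 = g$1$2 * g$2$3 - g$1$3 * g$2$2"
  "minor g 3 2 = g$1$1 * g$2$3 - g$1$3 * g$2$1"
  "minor g 3 3 = g$1$1 * g$2$2 - g$1$2 * g$2$1"
  by (simp_all add: minor_def det_2 skip_def)

lemma j2_entries:
  "j2 g (u, v) $ 1 $ 1 = (minor g 3 2 * u + minor g 3 3) / det g"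
  "j2 g (u, v) $ 1 $ 2 = (minor g 3 2 * v + minor g 3 1) / det g"
  "j2 g (u, v) $ 2 $ 1 = (minor g 1 2 * u + minor g 1 3) / det g"
  "j2 g (u, v) $ 2 $ 2 = (minor g 1 2 * v + minor g 1 1) / det g"
  by (simp_all add: j2_def divide_inverse)

text \<open>Coefficientwise this is Jacobi's identity, by which a 2 x 2 minor of the adjugate is
  \<open>det g\<close> times an entry of \<open>g\<close>. It yields \<open>det_j2\<close>, the
  factor by which a wedge product transforms.\<close>

lemma minor_det:
  "(minor g 3 2 * u + minor g 3 3) * (minor g 1 2 * v + minor g 1 1)
   - (minor g 3 2 * v + minor g 3 1) * (minor g 1 2 * u + minor g 1 3) = det g * j1 g (u, v)"
  by (simp add: minor_eqs det_3 j1_def algebra_simps)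

lemma Gam_det_nonzero:
  assumes "g \<in> Gam"
  shows "det g \<noteq> 0"
proof -
  obtain g' where "g ** g' = mat 1" using assms by (auto simp: Gam_def GL3_O_F_def)
  then have "det g * det g' = 1" by (simp add: det_mul[symmetric])
  then show ?thesis by auto
qed

lemma det_j2:
  assumes "g \<in> Gam"
  shows "det (j2 g b) = j1 g b / det g"
proof -
  obtain u v where b: "b = (u, v)" by fastforce
  have "det (j2 g b) = (det g * j1 g (u, v)) / (det g * det g)"
    unfolding minor_det[symmetric] b det_2 j2_entries by (simp add: diff_divide_distrib)
  then show ?thesis using Gam_det_nonzero[OF assms] b by simp
qed

lemma j2_invertible: "g \<in> Gam \<Longrightarrow> b \<in> Bal \<Longrightarrow> invertible (j2 g b)"
  by (simp add: invertible_det_nz det_j2 j1_nonzero Gam_det_nonzero)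

lemma invertible_matrix_inv:
  "invertible A \<Longrightarrow> A ** matrix_inv A = mat 1 \<and> matrix_inv A ** A = mat 1"
  unfolding matrix_inv_def invertible_def by (rule someI_ex)

lemma matrix_inv_eq_iff:
  fixes A :: "complex^2^2"
  assumes "invertible A"
  shows "matrix_inv A *v x = y \<longleftrightarrow> x = A *v y"
  by (metis assms invertible_matrix_inv matrix_vector_mul_assoc matrix_vector_mul_lid)

lemma slash1_eq_iff:
  assumes "g \<in> Gam" "b \<in> Bal"
  shows "slash1 k f g b = c *s y \<longleftrightarrow> f (act g b) = (j1 g b powi k * c) *s (j2 g b *v y)"
proof -
  let ?j = "j1 g b"
  have j: "?j \<noteq> 0" using j1_nonzero assms by blast
  have "slash1 k f g b = c *s y \<longleftrightarrow> matrix_inv (j2 g b) *v f (act g b) = (?j powi k * c) *s y"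
  proof
    assume "slash1 k f g b = c *s y"
    then have "?j powi k *s slash1 k f g b = (?j powi k * c) *s y" by (simp add: vector_smult_assoc)
    then show "matrix_inv (j2 g b) *v f (act g b) = (?j powi k * c) *s y"
      using j by (simp add: slash1_def vector_smult_assoc power_int_minus)
  next
    assume "matrix_inv (j2 g b) *v f (act g b) = (?j powi k * c) *s y"
    then show "slash1 k f g b = c *s y"
      using j by (simp add: slash1_def vector_smult_assoc power_int_minus mult.assoc[symmetric])
  qed
  also have "\<dots> \<longleftrightarrow> f (act g b) = (?j powi k * c) *s (j2 g b *v y)"
    using matrix_inv_eq_iff[OF j2_invertible[OF assms]] by (simp add: vector_scalar_commute)
  finally show ?thesis .
qed

lemma slash0_eq_iff:
  assumes "g \<in> Gam" "b \<in> Bal"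
  shows "slash0 k f g b = y \<longleftrightarrow> f (act g b) = j1 g b powi k * y"
  using j1_nonzero[OF assms] by (auto simp: slash0_def power_int_minus field_simps)

lemma Gam_congD: "g \<in> Gam_cong \<Longrightarrow> g \<in> Gam"
  by (simp add: Gam_cong_def)

lemma M0_iff: "f \<in> M0 l k \<longleftrightarrow> off_zero f \<and> holo f \<and>
    (\<forall>g\<in>Gam_cong. \<forall>b\<in>Bal. f (act g b) = j1 g b powi k * (det g ^ l * f b))"
  by (simp add: M0_def slash0_eq_iff Gam_congD)

lemma M1_iff: "f \<in> M1 l k \<longleftrightarrow> off_zero f \<and> vholo f \<and>
    (\<forall>g\<in>Gam_cong. \<forall>b\<in>Bal. f (act g b) = (j1 g b powi k * det g ^ l) *s (j2 g b *v f b))"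
  by (simp add: M1_def slash1_eq_iff Gam_congD)

text \<open>The vectors \<open>[a1, a2]\<close> and \<open>[c1, c2]\<close> are the columns of the
  transposed Jacobian matrix, so the last two equations say that \<open>j1 g b\<close> times
  \<open>j2 g b\<close> is its inverse.\<close>

lemma has_grad_act:
  assumes g: "g \<in> Gam" and b: "b \<in> Bal"
  obtains a1 a2 c1 c2 where "has_grad (\<lambda>b. fst (act g b)) a1 a2 b"
    "has_grad (\<lambda>b. snd (act g b)) c1 c2 b"
    "j1 g b *s (j2 g b *v vector [a1, a2]) = vector [1, 0]"
    "j1 g b *s (j2 g b *v vector [c1, c2]) = vector [0, 1]"
proof -
  obtain u v where uv: "b = (u, v)" by fastforce
  define j where "j = j1 g (u, v)"
  define n1 where "n1 = g$1$1 * v + g$1$2 + g$1$3 * u"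
  define n3 where "n3 = g$3$1 * v + g$3$2 + g$3$3 * u"
  have lin: "has_grad (\<lambda>b. x * snd b + y + z * fst b) z x b" for x y z
    using has_grad_add[OF has_grad_add[OF has_grad_cmult[OF has_grad_snd, of x] has_grad_const[of y]]
        has_grad_cmult[OF has_grad_fst, of z]] by simp
  have j0: "j \<noteq> 0" using j1_nonzero[OF assms] by (simp add: j_def uv)
  have val: "g$2$1 * snd b + g$2$2 + g$2$3 * fst b = j"
    "g$1$1 * snd b + g$1$2 + g$1$3 * fst b = n1" "g$3$1 * snd b + g$3$2 + g$3$3 * fst b = n3"
    by (simp_all add: j_def n1_def n3_def j1_def uv)
  \<comment> \<open>The numerators of the quotient rule are the entries of \<open>j2\<close> without
    the factor \<open>1 / det g\<close>, in adjugate position.\<close>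
  have num: "g$3$3 * j - n3 * g$2$3 = minor g 1 2 * v + minor g 1 1"
    "g$3$1 * j - n3 * g$2$1 = - (minor g 1 2 * u + minor g 1 3)"
    "g$1$3 * j - n1 * g$2$3 = - (minor g 3 2 * v + minor g 3 1)"
    "g$1$1 * j - n1 * g$2$1 = minor g 3 2 * u + minor g 3 3"
    by (simp_all add: j_def j1_def n1_def n3_def minor_eqs algebra_simps)
  have d0: "det g \<noteq> 0" using Gam_det_nonzero[OF g] .
  let ?a1 = "(minor g 1 2 * v + minor g 1 1) / j^2" and ?a2 = "- (minor g 1 2 * u + minor g 1 3) / j^2"
  let ?c1 = "- (minor g 3 2 * v + minor g 3 1) / j^2" and ?c2 = "(minor g 3 2 * u + minor g 3 3) / j^2"
  have "has_grad (\<lambda>b. (g$3$1 * snd b + g$3$2 + g$3$3 * fst b) / (g$2$1 * snd b + g$2$2 + g$2$3 * fst b))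
     ((g$3$3 * j - n3 * g$2$3) / j^2) ((g$3$1 * j - n3 * g$2$1) / j^2) b"
    by (rule has_grad_divide[OF lin[of "g$3$1" "g$3$2" "g$3$3"] lin[of "g$2$1" "g$2$2" "g$2$3"],
        unfolded val, OF j0])
  then have 1: "has_grad (\<lambda>b. fst (act g b)) ?a1 ?a2 b"
    unfolding num by (simp add: act_def j1_def case_prod_unfold)
  have "has_grad (\<lambda>b. (g$1$1 * snd b + g$1$2 + g$1$3 * fst b) / (g$2$1 * snd b + g$2$2 + g$2$3 * fst b))
     ((g$1$3 * j - n1 * g$2$3) / j^2) ((g$1$1 * j - n1 * g$2$1) / j^2) b"
    by (rule has_grad_divide[OF lin[of "g$1$1" "g$1$2" "g$1$3"] lin[of "g$2$1" "g$2$2" "g$2$3"],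
        unfolded val, OF j0])
  then have 2: "has_grad (\<lambda>b. snd (act g b)) ?c1 ?c2 b"
    unfolding num by (simp add: act_def j1_def case_prod_unfold)
  define p q r s where pq: "p = minor g 3 2 * u + minor g 3 3" "q = minor g 3 2 * v + minor g 3 1"
    "r = minor g 1 2 * u + minor g 1 3" "s = minor g 1 2 * v + minor g 1 1"
  have D: "p * s - q * r = det g * j" unfolding pq j_def by (rule minor_det)
  have e: "j * ((p * s - q * r) / (det g * j^2)) = 1"
    unfolding D using j0 d0 by (simp add: power2_eq_square)
  have j2: "j2 g b *v vector [x, y] = vector [(p * x + q * y) / det g, (r * x + s * y) / det g]" for x y
    by (simp add: vec_eq_iff forall_2 uv matrix_vector_mult_def sum_2 j2_entries add_divide_distrib
        flip: pq)
  have "j * ((p * (s / j^2) + q * (- r / j^2)) / det g) = j * ((p * s - q * r) / (det g * j^2))"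
    "j * ((r * (s / j^2) + s * (- r / j^2)) / det g) = 0"
    "j * ((p * (- q / j^2) + q * (p / j^2)) / det g) = 0"
    "j * ((r * (- q / j^2) + s * (p / j^2)) / det g) = j * ((p * s - q * r) / (det g * j^2))"
    by (simp_all add: add_divide_distrib diff_divide_distrib mult_ac)
  then have "j1 g b *s (j2 g b *v vector [s / j^2, - r / j^2]) = vector [1, 0]"
    and "j1 g b *s (j2 g b *v vector [- q / j^2, p / j^2]) = vector [0, 1]"
    unfolding j2 e by (simp_all only: vec_eq_iff forall_2 vector_smult_component vector_2 uv j_def simp_thms)
  then show thesis using that[OF 1 2] unfolding pq by blast
qed

lemma holo_act:
  assumes "holo f" "g \<in> Gam"
  shows "holo (\<lambda>b. f (act g b))"
  unfolding holo_iff
proof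
  fix b assume b: "b \<in> Bal"
  obtain p q where "has_grad f p q (fst (act g b), snd (act g b))"
    using assms act_Bal[OF assms(2) b] by (auto simp: holo_iff)
  moreover obtain a1 a2 c1 c2 where "has_grad (\<lambda>b. fst (act g b)) a1 a2 b"
    "has_grad (\<lambda>b. snd (act g b)) c1 c2 b"
    by (rule has_grad_act[OF assms(2) b])
  ultimately have "has_grad (\<lambda>b. f (fst (act g b), snd (act g b))) (p * a1 + q * c1) (p * a2 + q * c2) b"
    by (rule has_grad_compose)
  then show "\<exists>p q. has_grad (\<lambda>b. f (act g b)) p q b" unfolding prod.collapse by blast
qed

text \<open>The chain rule gives the gradient of the composition as the transposed Jacobian times
  \<open>grad f\<close> at the image point; \<open>has_grad_act\<close> solves this for
  \<open>grad f\<close>.\<close>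

lemma grad_act:
  assumes g: "g \<in> Gam" and b: "b \<in> Bal" and f: "holo f"
  shows "grad f (act g b) = j1 g b *s (j2 g b *v grad (\<lambda>b. f (act g b)) b)"
proof -
  obtain a1 a2 c1 c2 where a: "has_grad (\<lambda>b. fst (act g b)) a1 a2 b"
    "has_grad (\<lambda>b. snd (act g b)) c1 c2 b"
    "j1 g b *s (j2 g b *v vector [a1, a2]) = vector [1, 0]"
    "j1 g b *s (j2 g b *v vector [c1, c2]) = vector [0, 1]"
    by (rule has_grad_act[OF g b])
  obtain p q where pq: "has_grad f p q (fst (act g b), snd (act g b))"
    using f act_Bal[OF g b] by (auto simp: holo_iff)
  have "has_grad (\<lambda>b. f (act g b)) (p * a1 + q * c1) (p * a2 + q * c2) b"
    using has_grad_compose[OF pq a(1,2)] by simp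
  then have "grad (\<lambda>b. f (act g b)) b = p *s vector [a1, a2] + q *s vector [c1, c2]"
    by (simp add: grad_eq vec_eq_iff forall_2)
  then have "j1 g b *s (j2 g b *v grad (\<lambda>b. f (act g b)) b) =
     p *s (j1 g b *s (j2 g b *v vector [a1, a2])) + q *s (j1 g b *s (j2 g b *v vector [c1, c2]))"
    by (simp add: vec_eq_iff matrix_vector_mult_def sum_2 algebra_simps)
  also have "\<dots> = vector [p, q]" unfolding a(3,4) by (simp add: vec_eq_iff forall_2)
  also have "\<dots> = grad f (act g b)" using grad_eq[OF pq] by simp
  finally show ?thesis by simp
qed

text \<open>The derivatives of the automorphy factor cancel in the bracket.\<close>

lemma bracket_act:
  assumes g: "g \<in> Gam" and b: "b \<in> Bal" and f: "holo f" "holo f'" and h: "holo h" "holo h'"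
    and ff: "\<And>b. b \<in> Bal \<Longrightarrow> f (act g b) = j1 g b ^ 3 * f' b"
    and hh: "\<And>b. b \<in> Bal \<Longrightarrow> h (act g b) = j1 g b ^ 3 * h' b"
  shows "bracket 3 3 f h (act g b) = j1 g b ^ 7 *s (j2 g b *v bracket 3 3 f' h' b)"
proof -
  obtain j3 j3' where j3: "has_grad (\<lambda>b. j1 g b ^ 3) j3 j3' b"
    using holo_power[OF holo_j1, of g 3] b by (auto simp: holo_iff)
  have *: "grad (\<lambda>b. k (act g b)) b = k' b *s vector [j3, j3'] + j1 g b ^ 3 *s grad k' b"
    if k: "holo k'" "\<And>b. b \<in> Bal \<Longrightarrow> k (act g b) = j1 g b ^ 3 * k' b" for k k'
  proof -
    have "has_grad (\<lambda>b. k (act g b)) (j3 * k' b + j1 g b ^ 3 * grad k' b $ 1)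
       (j3' * k' b + j1 g b ^ 3 * grad k' b $ 2) b"
      using has_grad_cong[OF has_grad_mult[OF j3 holo_has_grad[OF k(1) b]] b] k(2) by simp
    then show ?thesis by (simp add: grad_eq vec_eq_iff forall_2 mult.commute)
  qed
  have "bracket 3 3 f h (act g b) = j1 g b *s (j2 g b *v
     ((f (act g b) / 3) *s grad (\<lambda>b. h (act g b)) b - (h (act g b) / 3) *s grad (\<lambda>b. f (act g b)) b))"
    unfolding bracket_def grad_act[OF g b f(1)] grad_act[OF g b h(1)]
    by (simp add: vec_eq_iff matrix_vector_mult_def sum_2 algebra_simps)
  also have "(f (act g b) / 3) *s grad (\<lambda>b. h (act g b)) b - (h (act g b) / 3) *s grad (\<lambda>b. f (act g b)) b
     = j1 g b ^ 6 *s bracket 3 3 f' h' b"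
    using *[OF f(2), of f] *[OF h(2), of h] ff hh unfolding ff[OF b] hh[OF b] bracket_def
    by (simp add: vec_eq_iff algebra_simps eval_nat_numeral)
  finally have "bracket 3 3 f h (act g b) = j1 g b *s (j2 g b *v (j1 g b ^ 6 *s bracket 3 3 f' h' b))" .
  then show ?thesis
    by (simp add: vector_scalar_commute vector_smult_assoc flip: power_Suc)
qed

section \<open>The group and its forms\<close>

lemma GamI:
  assumes "\<forall>i j. g$i$j \<in> O_F" "\<forall>i j. g'$i$j \<in> O_F" "g ** g' = mat 1" "g' ** g = mat 1"
    "\<And>z w. herm (g *v z) (g *v w) = herm z w"
  shows "g \<in> Gam"
  using assms by (auto simp: Gam_def GL3_O_F_def)

lemma Gam_integral: "g \<in> Gam \<Longrightarrow> g$i$j \<in> O_F"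
  by (simp add: Gam_def GL3_O_F_def)

lemma Gam_inverse:
  assumes "g \<in> Gam"
  shows "matrix_inv g \<in> Gam" "g ** matrix_inv g = mat 1" "matrix_inv g ** g = mat 1"
proof -
  obtain g' where g': "\<forall>i j. g'$i$j \<in> O_F" "g ** g' = mat 1" "g' ** g = mat 1"
    using assms by (auto simp: Gam_def GL3_O_F_def)
  then have inv: "invertible g" by (auto simp: invertible_def)
  show 1: "g ** matrix_inv g = mat 1" and 2: "matrix_inv g ** g = mat 1"
    using invertible_matrix_inv[OF inv] by auto
  have eq: "matrix_inv g = g'"
    by (metis 2 g'(2) matrix_mul_assoc matrix_mul_lid matrix_mul_rid)
  show "matrix_inv g \<in> Gam"
  proof (rule GamI)
    show "\<forall>i j. matrix_inv g $ i $ j \<in> O_F" using g' eq by simp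
    show "\<forall>i j. g $ i $ j \<in> O_F" using Gam_integral[OF assms] by simp
    show "herm (matrix_inv g *v z) (matrix_inv g *v w) = herm z w" for z w
      by (metis Gam_herm[OF assms] 1 matrix_vector_mul_assoc matrix_vector_mul_lid)
  qed (use 1 2 in auto)
qed

lemma Gam_mult:
  assumes "g \<in> Gam" "h \<in> Gam"
  shows "g ** h \<in> Gam"
proof (rule GamI)
  show "\<forall>i j. (g ** h) $ i $ j \<in> O_F"
    by (auto simp: matrix_matrix_mult_def sum_3 Gam_integral assms)
  show "\<forall>i j. (matrix_inv h ** matrix_inv g) $ i $ j \<in> O_F"
    by (auto simp: matrix_matrix_mult_def sum_3 Gam_integral Gam_inverse assms)
  show "g ** h ** (matrix_inv h ** matrix_inv g) = mat 1"
    "matrix_inv h ** matrix_inv g ** (g ** h) = mat 1"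
    using Gam_inverse[OF assms(1)] Gam_inverse[OF assms(2)]
    by (metis matrix_mul_assoc matrix_mul_rid)+
  show "herm (g ** h *v z) (g ** h *v w) = herm z w" for z w
    using assms by (simp add: Gam_herm flip: matrix_vector_mul_assoc)
qed

lemma j1_inverse:
  assumes "g \<in> Gam" "b \<in> Bal"
  shows "act (matrix_inv g) (act g b) = b" "j1 (matrix_inv g) (act g b) * j1 g b = 1"
  using act_mult[OF Gam_inverse(1)[OF assms(1)] assms] j1_cocycle[OF Gam_inverse(1)[OF assms(1)] assms]
  by (simp_all add: Gam_inverse[OF assms(1)])

lemma det_integral: "(\<And>i j. g$i$j \<in> O_F) \<Longrightarrow> det (g :: complex^3^3) \<in> O_F"
  by (simp add: det_3)

lemma Gam_cong_iff: "g \<in> Gam_cong \<longleftrightarrow> g \<in> Gam \<and> (\<forall>i j. sq3_dvd (g$i$j - (if i = j then 1 else 0)))"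
  by (simp add: Gam_cong_def sq3_dvd_def mat_def)

lemma det_cong_1:
  fixes g :: "complex^3^3"
  assumes I: "\<And>i j. g$i$j \<in> O_F" and d: "\<And>i j. sq3_dvd (g$i$j - (if i = j then 1 else 0))"
  shows "sq3_dvd (det g - 1)"
proof -
  have D: "sq3_dvd (g$1$1 - 1)" "sq3_dvd (g$2$2 - 1)" "sq3_dvd (g$3$3 - 1)"
    using d[of 1 1] d[of 2 2] d[of 3 3] by simp_all
  have N: "sq3_dvd (g$1$2)" "sq3_dvd (g$2$1)" "sq3_dvd (g$1$3)"
    "sq3_dvd (g$3$2)"
    using d[of 1 2] d[of 2 1] d[of 1 3] d[of 3 2] by simp_all
  \<comment> \<open>The product of the diagonal is telescoped down to 1, and each of the other five
    terms has an off-diagonal factor.\<close>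
  have eq: "det g - 1 = (g$1$1 - 1) * (g$2$2 * g$3$3) + (g$2$2 - 1) * g$3$3 + (g$3$3 - 1)
      + g$1$2 * (g$2$3 * g$3$1) + g$1$3 * (g$2$1 * g$3$2)
      - g$3$2 * (g$1$1 * g$2$3) - g$1$2 * (g$2$1 * g$3$3) - g$1$3 * (g$2$2 * g$3$1)"
    by (simp add: det_3 algebra_simps)
  have S: "sq3_dvd (a + b + c + d + e - p - q - r)"
    if "sq3_dvd a" "sq3_dvd b" "sq3_dvd c" "sq3_dvd d" "sq3_dvd e" "sq3_dvd p" "sq3_dvd q" "sq3_dvd r"
    for a b c d e p q r
    by (intro sq3_dvd_add sq3_dvd_diff that)
  show ?thesis unfolding eq
    by (intro S sq3_dvd_mult D N I O_F_mult)
qed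

lemma Gam_det_unit:
  assumes "g \<in> Gam"
  shows "det g \<in> O_F" "det (matrix_inv g) \<in> O_F" "det g * det (matrix_inv g) = 1"
  using assms Gam_inverse[OF assms] Gam_integral
  by (auto intro!: det_integral simp: det_mul[symmetric])

lemma Gam_cong_det_cube:
  assumes "g \<in> Gam_cong"
  shows "det g ^ 3 = 1"
proof (rule O_F_unit_cube)
  show "det g \<in> O_F" "det (matrix_inv g) \<in> O_F" "det g * det (matrix_inv g) = 1"
    using Gam_det_unit assms Gam_congD by blast+
  show "sq3_dvd (det g - 1)"
    using assms by (intro det_cong_1) (auto simp: Gam_cong_iff Gam_integral)
qed

section \<open>Wedge products and products of forms\<close>

definition wedge :: "complex^2 \<Rightarrow> complex^2 \<Rightarrow> complex" where
  "wedge x y = x$1 * y$2 - x$2 * y$1"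

lemma wedge_mult: "wedge (A *v x) (A *v y) = det A * wedge x y"
  by (simp add: wedge_def matrix_vector_mult_def sum_2 det_2 algebra_simps)

lemma wedge_scale: "wedge (c *s x) (d *s y) = c * d * wedge x y"
  by (simp add: wedge_def algebra_simps)

text \<open>Cramer's rule without division, so that it holds also at points where \<open>y\<close>
  and \<open>z\<close> are dependent.\<close>

lemma cramer:
  "wedge y z *s x = wedge x z *s y + wedge y x *s z"
  by (simp add: wedge_def vec_eq_iff forall_2 algebra_simps)

lemma M0_mult:
  assumes f: "f \<in> M0 l k" and h: "h \<in> M0 l' k'"
  shows "(\<lambda>b. f b * h b) \<in> M0 (l + l') (k + k')"
  using assms unfolding M0_iff
  by (auto simp: off_zero_def holo_mult power_add power_int_add j1_nonzero Gam_congD mult_ac)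

lemma M0_det_cube: "f \<in> M0 (l + 3) k \<longleftrightarrow> f \<in> M0 l k"
  by (simp add: M0_iff power_add Gam_cong_det_cube)

text \<open>The determinant of \<open>j2\<close> contributes \<open>j1 / det g\<close>: the weight
  rises by 1, and since \<open>det g ^ 3 = 1\<close>, the inverse determinant counts as the exponent
  2.\<close>

lemma M0_wedge:
  assumes f: "f \<in> M1 l k" and h: "h \<in> M1 l' k'"
  shows "(\<lambda>b. wedge (f b) (h b)) \<in> M0 (l + l' + 2) (k + k' + 1)"
  unfolding M0_iff
proof (intro conjI ballI)
  show "off_zero (\<lambda>b. wedge (f b) (h b))"
    using assms by (simp add: M1_iff off_zero_def wedge_def)
  show "holo (\<lambda>b. wedge (f b) (h b))"
    using assms unfolding wedge_def M1_iff vholo_def by (intro holo_intros) auto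
  fix g b assume g: "g \<in> Gam_cong" and b: "b \<in> Bal"
  let ?j = "j1 g b" and ?d = "det g"
  have j: "?j \<noteq> 0" and G: "g \<in> Gam" using j1_nonzero g b Gam_congD by blast+
  have d: "inverse ?d = ?d ^ 2"
    using Gam_cong_det_cube[OF g] by (intro inverse_unique) (simp add: eval_nat_numeral mult_ac)
  have "wedge (f (act g b)) (h (act g b)) =
      ?j powi k * ?d ^ l * (?j powi k' * ?d ^ l') * (?j * inverse ?d * wedge (f b) (h b))"
    using f h g b by (simp add: M1_iff wedge_scale wedge_mult det_j2[OF G] divide_inverse)
  also have "\<dots> = ?j powi (k + k' + 1) * (?d ^ (l + l' + 2) * wedge (f b) (h b))"
    unfolding d using j by (simp add: power_int_add power_add power2_eq_square mult_ac)
  finally show "wedge (f (act g b)) (h (act g b)) =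
      ?j powi (k + k' + 1) * (?d ^ (l + l' + 2) * wedge (f b) (h b))" .
qed

lemma M1_smult:
  assumes f: "f \<in> M0 l k" and h: "h \<in> M1 l' k'"
  shows "(\<lambda>b. f b *s h b) \<in> M1 (l + l') (k + k')"
  unfolding M1_iff
proof (intro conjI ballI)
  show "off_zero (\<lambda>b. f b *s h b)"
    using assms by (simp add: M1_iff M0_iff off_zero_def)
  show "vholo (\<lambda>b. f b *s h b)"
    using assms unfolding M1_iff M0_iff vholo_def by (auto intro!: holo_intros)
  fix g b assume g: "g \<in> Gam_cong" and b: "b \<in> Bal"
  have j: "j1 g b \<noteq> 0" using j1_nonzero g b Gam_congD by blast
  have "f (act g b) = j1 g b powi k * (det g ^ l * f b)"
    "h (act g b) = (j1 g b powi k' * det g ^ l') *s (j2 g b *v h b)"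
    using f h g b by (auto simp: M1_iff M0_iff)
  then show "f (act g b) *s h (act g b) =
      (j1 g b powi (k + k') * det g ^ (l + l')) *s (j2 g b *v (f b *s h b))"
    using j by (simp add: vector_scalar_commute vector_smult_assoc power_int_add power_add mult_ac)
qed

lemma M1_add: "f \<in> M1 l k \<Longrightarrow> h \<in> M1 l k \<Longrightarrow> (\<lambda>b. f b + h b) \<in> M1 l k"
  by (auto simp: M1_iff off_zero_def vholo_def holo_add matrix_vector_right_distrib vector_add_ldistrib)

lemma M0_const: "(\<lambda>b. if b \<in> Bal then c else 0) \<in> M0 0 0"
  by (auto simp: M0_iff off_zero_def act_Bal Gam_congD intro!: holo_restrict holo_const)

lemma M1_cmult: "h \<in> M1 l k \<Longrightarrow> (\<lambda>b. c *s h b) \<in> M1 l k"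
  by (auto simp: M1_iff off_zero_def vholo_def vector_scalar_commute vector_smult_assoc mult_ac
      intro!: holo_cmult)

lemma M0_cmult: "h \<in> M0 l k \<Longrightarrow> (\<lambda>b. c * h b) \<in> M0 l k"
  by (auto simp: M0_iff off_zero_def mult_ac intro!: holo_cmult)

lemma M0_zero: "(\<lambda>_. 0) \<in> M0 l k"
  by (auto simp: M0_iff off_zero_def holo_const)

lemma M1_zero: "(\<lambda>_. 0) \<in> M1 l k"
  by (auto simp: M1_iff off_zero_def vholo_def holo_const)

section \<open>Explicit elements of the group\<close>

definition mat3 :: "complex list list \<Rightarrow> complex^3^3" where
  "mat3 r = vector (map vector r)"

lemma mat3_nth [simp]:
  "mat3 [[a,b,c],[d,e,f],[g,h,i]] $ 1 $ 1 = a" "mat3 [[a,b,c],[d,e,f],[g,h,i]] $ 1 $ 2 = b"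
  "mat3 [[a,b,c],[d,e,f],[g,h,i]] $ 1 $ 3 = c" "mat3 [[a,b,c],[d,e,f],[g,h,i]] $ 2 $ 1 = d"
  "mat3 [[a,b,c],[d,e,f],[g,h,i]] $ 2 $ 2 = e" "mat3 [[a,b,c],[d,e,f],[g,h,i]] $ 2 $ 3 = f"
  "mat3 [[a,b,c],[d,e,f],[g,h,i]] $ 3 $ 1 = g" "mat3 [[a,b,c],[d,e,f],[g,h,i]] $ 3 $ 2 = h"
  "mat3 [[a,b,c],[d,e,f],[g,h,i]] $ 3 $ 3 = i"
  by (simp_all add: mat3_def)

lemma mat3_mult: "mat3 [[a,b,c],[d,e,f],[g,h,i]] ** mat3 [[a',b',c'],[d',e',f'],[g',h',i']] =
  mat3 [[a*a'+b*d'+c*g', a*b'+b*e'+c*h', a*c'+b*f'+c*i'],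
        [d*a'+e*d'+f*g', d*b'+e*e'+f*h', d*c'+e*f'+f*i'],
        [g*a'+h*d'+i*g', g*b'+h*e'+i*h', g*c'+h*f'+i*i']]"
  by (simp add: vec_eq_iff forall_3 matrix_matrix_mult_def sum_3)

lemma mat3_one: "(mat 1 :: complex^3^3) = mat3 [[1,0,0],[0,1,0],[0,0,1]]"
  by (simp add: vec_eq_iff forall_3 mat_def)

lemma mat3_vec: "mat3 [[a,b,c],[d,e,f],[g,h,i]] *v z =
  vector [a * z$1 + b * z$2 + c * z$3, d * z$1 + e * z$2 + f * z$3, g * z$1 + h * z$2 + i * z$3]"
  by (simp add: vec_eq_iff forall_3 matrix_vector_mult_def sum_3)

text \<open>Unipotent elements fixing the cusp \<open>(0:1:0)\<close>. At a given point their
  automorphy factors \<open>sqrtm3 * n * v + 1\<close> are pairwise different, which separates the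
  weights in \<open>graded_zero\<close>.\<close>

definition lower_mat :: "nat \<Rightarrow> complex^3^3" where
  "lower_mat n = mat3 [[1,0,0],[sqrtm3 * of_nat n,1,0],[0,0,1]]"

definition refl_mat :: "complex^3^3" where
  "refl_mat = mat3 [[1,0,0],[0,1,0],[0,0,rho]]"

definition swap_mat :: "complex^3^3" where
  "swap_mat = mat3 [[0,-1,0],[-1,0,0],[0,0,-1]]"

text \<open>For \<open>e = 1\<close> or \<open>e = - 1\<close>, a unipotent element that fixes
  \<open>(1:0:0)\<close> and sends \<open>(rho, 1, e)\<close> to
  \<open>(rho^2, 1, rho^2 * e)\<close>. The latter is proportional to the image of
  \<open>(rho, 1, e)\<close> under \<open>swap_mat\<close>; this shows that \<open>swap_mat\<close>
  fixes the last two cusps modulo the congruence subgroup.\<close>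

definition unip_mat :: "complex \<Rightarrow> complex^3^3" where
  "unip_mat e = mat3 [[1, rho^2 - 1, (1 - rho) * e],[0,1,0],[0,(rho^2 - 1) * e,1]]"

lemma O_F_of_nat [simp]: "of_nat n \<in> O_F"
  using O_F_of_int[of "int n"] by simp

lemma O_F_sqrtm3 [simp]: "sqrtm3 \<in> O_F"
  unfolding sqrtm3_rho mult_2 by (intro O_F_add O_F_1 O_F_rho)

lemma cnj_sqrtm3: "cnj sqrtm3 = - sqrtm3"
  by (simp add: sqrtm3_def)

lemma lower_mat_cong: "lower_mat n \<in> Gam_cong"
proof -
  have "lower_mat n \<in> Gam"
    by (rule GamI[where g' = "mat3 [[1,0,0],[- sqrtm3 * of_nat n,1,0],[0,0,1]]"])
       (simp_all add: forall_3 lower_mat_def mat3_mult mat3_one mat3_vec herm_def cnj_sqrtm3 algebra_simps)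
  then show ?thesis
    unfolding Gam_cong_iff forall_3 by (simp add: lower_mat_def) (auto simp: sq3_dvd_def)
qed

lemma refl_mat_cong: "refl_mat \<in> Gam_cong" and det_refl_mat: "det refl_mat = rho"
proof -
  have rc: "rho * cnj rho = 1"
    by (simp add: cnj_rho rho_mult right_diff_distrib)
  have h: "rho * x * (cnj rho * y) = x * y" for x y
  proof -
    have "rho * x * (cnj rho * y) = (rho * cnj rho) * (x * y)" by (simp only: mult_ac)
    then show ?thesis by (simp add: rc)
  qed
  have r: "rho * rho^2 = 1" "rho^2 * rho = 1" "rho^2 \<in> O_F"
    using rho_cube by (simp_all add: eval_nat_numeral mult_ac)
  have "refl_mat \<in> Gam"
    by (rule GamI[where g' = "mat3 [[1,0,0],[0,1,0],[0,0,rho^2]]"])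
       (simp_all add: forall_3 refl_mat_def mat3_mult mat3_one mat3_vec herm_def r h)
  moreover have "sq3_dvd (rho - 1)" using sq3_dvd_iff[of "-1" 1] by simp
  ultimately show "refl_mat \<in> Gam_cong"
    unfolding Gam_cong_iff forall_3 by (simp add: refl_mat_def)
  show "det refl_mat = rho" by (simp add: refl_mat_def det_3)
qed

lemma swap_mat_Gam1: "swap_mat \<in> Gam1" and swap_mat_inverse: "matrix_inv swap_mat = swap_mat"
proof -
  have sq: "swap_mat ** swap_mat = mat 1" by (simp add: swap_mat_def mat3_mult mat3_one)
  have G: "swap_mat \<in> Gam"
    by (rule GamI[where g' = swap_mat])
       (simp_all add: sq, simp_all add: forall_3 swap_mat_def mat3_vec herm_def algebra_simps)
  then show "swap_mat \<in> Gam1" by (simp add: Gam1_def det_3 swap_mat_def)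
  show "matrix_inv swap_mat = swap_mat"
    by (metis sq Gam_inverse(3)[OF G] matrix_mul_assoc matrix_mul_lid matrix_mul_rid)
qed

text \<open>Invariance of the form as a polynomial identity: the \<open>w\<close> stand for
  conjugates, and the conjugated entries are written out by \<open>cnj rho = - 1 - rho\<close>. Only
  the coefficient of \<open>z2 * w2\<close> calls for the relations between \<open>r\<close> and
  \<open>e\<close> and their squares.\<close>

lemma unip_mat_herm:
  fixes r e :: complex
  assumes "r * r = - 1 - r" "e * e = 1"
  shows "(z1 + (- 2 - r) * z2 + (1 - r) * e * z3) * w2 + z2 * (w1 + (r - 1) * w2 + (2 + r) * e * w3)
     + ((- 2 - r) * e * z2 + z3) * ((r - 1) * e * w2 + w3) = z1 * w2 + z2 * w1 + z3 * w3"
proof -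
  have "(- 2 - r) * e * ((r - 1) * e) = (2 - r - r * r) * (e * e)" by (simp add: algebra_simps)
  then have 3: "(- 2 - r) * e * ((r - 1) * e) = 3" using assms by simp
  have "(z1 + (- 2 - r) * z2 + (1 - r) * e * z3) * w2 + z2 * (w1 + (r - 1) * w2 + (2 + r) * e * w3)
     + ((- 2 - r) * e * z2 + z3) * ((r - 1) * e * w2 + w3)
     = z1 * w2 + z2 * w1 + z3 * w3 + ((- 2 - r) * e * ((r - 1) * e) - 3) * (z2 * w2)"
    by (simp add: algebra_simps)
  then show ?thesis unfolding 3 by simp
qed

lemma unip_mat_cong:
  assumes "e = 1 \<or> e = - 1"
  shows "unip_mat e \<in> Gam1_cong"
proof -
  have e: "e * e = 1" "cnj e = e" "e \<in> O_F" using assms by auto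
  have "unip_mat e \<in> Gam"
  proof (rule GamI[where g' = "mat3 [[1, rho - 1, (rho - 1) * e],[0,1,0],[0,(1 - rho^2) * e,1]]"])
    show "herm (unip_mat e *v z) (unip_mat e *v w) = herm z w" for z w
    proof -
      have R: "rho^2 - 1 = - 2 - rho" by (simp add: rho_sq)
      have C: "cnj (- 2 - rho) = rho - 1" "cnj (1 - rho) = 2 + rho" by (simp_all add: cnj_rho)
      have "herm (unip_mat e *v z) (unip_mat e *v w) =
         (z$1 + (- 2 - rho) * z$2 + (1 - rho) * e * z$3) * cnj (w$2)
         + z$2 * (cnj (w$1) + (rho - 1) * cnj (w$2) + (2 + rho) * e * cnj (w$3))
         + ((- 2 - rho) * e * z$2 + z$3) * ((rho - 1) * e * cnj (w$2) + cnj (w$3))"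
        unfolding unip_mat_def R mat3_vec herm_def
        by (simp only: vector_3 complex_cnj_add complex_cnj_mult C e(2) complex_cnj_one complex_cnj_zero
            mult_zero_left mult_1_left add_0_left add_0_right)
      also have "\<dots> = herm z w"
        unfolding herm_def by (rule unip_mat_herm[OF rho_mult e(1)])
      finally show ?thesis .
    qed
    have "rho - 1 + (rho^2 - 1) + (1 - rho) * e * ((1 - rho^2) * e) = 0"
      "(rho^2 - 1) + (rho - 1) + (rho - 1) * e * ((rho^2 - 1) * e) = 0"
      "(1 - rho^2) * e + (rho^2 - 1) * e = 0" "(rho - 1) * e + (1 - rho) * e = 0"
    proof -
      have "(1 - rho) * e * ((1 - rho^2) * e) = (2 - rho - rho * rho) * (e * e)"
        "(rho - 1) * e * ((rho^2 - 1) * e) = (2 - rho - rho * rho) * (e * e)"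
        unfolding rho_sq by (simp_all add: algebra_simps)
      then have *: "(1 - rho) * e * ((1 - rho^2) * e) = 3" "(rho - 1) * e * ((rho^2 - 1) * e) = 3"
        using e(1) rho_mult by simp_all
      show "rho - 1 + (rho^2 - 1) + (1 - rho) * e * ((1 - rho^2) * e) = 0"
        "(rho^2 - 1) + (rho - 1) + (rho - 1) * e * ((rho^2 - 1) * e) = 0"
        unfolding * unfolding rho_sq by simp_all
    qed (simp_all add: algebra_simps)
    then show "unip_mat e ** mat3 [[1, rho - 1, (rho - 1) * e],[0,1,0],[0,(1 - rho^2) * e,1]] = mat 1"
      "mat3 [[1, rho - 1, (rho - 1) * e],[0,1,0],[0,(1 - rho^2) * e,1]] ** unip_mat e = mat 1"
      unfolding unip_mat_def mat3_mult mat3_one by (simp_all add: add_ac)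
  qed (use e in \<open>auto simp: forall_3 unip_mat_def power2_eq_square\<close>)
  moreover have "sq3_dvd (rho^2 - 1)" "sq3_dvd (1 - rho)" "sq3_dvd (rho - 1)"
    using sq3_dvd_iff[of "-2" "-1"] sq3_dvd_iff[of 1 "-1"] sq3_dvd_iff[of "-1" 1]
    by (simp_all add: rho_sq)
  then have "sq3_dvd (rho^2 - 1)" "sq3_dvd ((1 - rho) * e)" "sq3_dvd ((rho^2 - 1) * e)"
    using sq3_dvd_mult e(3) by blast+
  moreover have "det (unip_mat e) = 1" by (simp add: unip_mat_def det_3)
  ultimately have "unip_mat e \<in> Gam1" "unip_mat e \<in> Gam_cong"
    unfolding Gam_cong_iff forall_3 by (simp_all add: Gam1_def unip_mat_def)
  then show ?thesis by (simp add: Gam1_cong_def)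
qed

section \<open>Divisibility of forms with character \<open>det\<close>\<close>

text \<open>Nested univariate polynomials model the ring in three variables: the innermost variable
  is \<open>x\<close>, the outermost \<open>z\<close>. In this form prime elements lift from
  coefficients to polynomials.\<close>

definition ev3 :: "complex poly poly poly \<Rightarrow> complex \<Rightarrow> complex \<Rightarrow> complex \<Rightarrow> complex" where
  "ev3 P x y z = poly (poly (poly P [:[:z:]:]) [:y:]) x"

lemma ev3_mult: "ev3 (P * Q) x y z = ev3 P x y z * ev3 Q x y z"
  by (simp add: ev3_def)

lemma ev3_diff: "ev3 (P - Q) x y z = ev3 P x y z - ev3 Q x y z"
  by (simp add: ev3_def)

lemma ev3_power: "ev3 (P ^ n) x y z = ev3 P x y z ^ n"
  by (simp add: ev3_def poly_power)

lemma ev3_sum: "ev3 (\<Sum>i\<in>A. f i) x y z = (\<Sum>i\<in>A. ev3 (f i) x y z)"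
  by (simp add: ev3_def poly_sum)

definition mono3 :: "complex \<Rightarrow> nat \<times> nat \<times> nat \<Rightarrow> complex poly poly poly" where
  "mono3 c a = (case a of (p, q, r) \<Rightarrow> monom (monom (monom c p) q) r)"

lemma ev3_mono3: "ev3 (mono3 c (p, q, r)) x y z = c * (x ^ p * y ^ q * z ^ r)"
proof -
  have "[:[:z:]:] ^ r = [:[:z ^ r:]:]" "[:y:] ^ q = [:y ^ q:]"
    by (induction r) (simp_all add: mult_pCons_left one_pCons, induction q, simp_all add: one_pCons)
  then show ?thesis by (simp add: ev3_def mono3_def poly_monom mult_ac)
qed

definition coeff3 :: "complex poly poly poly \<Rightarrow> nat \<times> nat \<times> nat \<Rightarrow> complex" where
  "coeff3 P a = (case a of (p, q, r) \<Rightarrow> coeff (coeff (coeff P r) q) p)"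

lemma finite_coeff3: "finite {a. coeff3 P a \<noteq> 0}"
proof (rule finite_subset)
  show "{a. coeff3 P a \<noteq> 0} \<subseteq> (\<lambda>(r, q, p). (p, q, r)) `
      (SIGMA r:{..degree P}. SIGMA q:{..degree (coeff P r)}. {..degree (coeff (coeff P r) q)})"
  proof
    fix a assume a: "a \<in> {a. coeff3 P a \<noteq> 0}"
    obtain p q r where pqr: "a = (p, q, r)" by (cases a) auto
    then have n: "coeff (coeff (coeff P r) q) p \<noteq> 0" using a by (simp add: coeff3_def)
    then have "r \<le> degree P" "q \<le> degree (coeff P r)" "p \<le> degree (coeff (coeff P r) q)"
      by (auto intro!: le_degree)
    then show "a \<in> (\<lambda>(r, q, p). (p, q, r)) `
      (SIGMA r:{..degree P}. SIGMA q:{..degree (coeff P r)}. {..degree (coeff (coeff P r) q)})"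
      unfolding pqr by (intro image_eqI[of _ _ "(r, q, p)"]) auto
  qed
qed (intro finite_imageI finite_SigmaI; simp)

lemma coeff3_eq: "(\<And>a. coeff3 P a = coeff3 Q a) \<Longrightarrow> P = Q"
  unfolding poly_eq_iff coeff3_def by (metis (mono_tags, lifting) prod.case)

lemma coeff3_sum: "coeff3 (\<Sum>i\<in>A. f i) a = (\<Sum>i\<in>A. coeff3 (f i) a)"
  by (cases a) (simp add: coeff3_def coeff_sum)

lemma coeff3_mono3: "coeff3 (mono3 c a) a' = (if a = a' then c else 0)"
  by (cases a; cases a') (simp add: coeff3_def mono3_def)

lemma coeff3_expand: "P = (\<Sum>a\<in>{a. coeff3 P a \<noteq> 0}. mono3 (coeff3 P a) a)"
  by (rule coeff3_eq) (simp add: coeff3_sum coeff3_mono3 finite_coeff3)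

text \<open>By the factor theorem, divisibility by this polynomial means vanishing at
  \<open>- a\<close>, and in a domain a product vanishes there only if a factor does.\<close>

lemma prime_elem_linear: "prime_elem ([:a, 1:] :: 'a::idom poly)"
proof (rule prime_elemI)
  show "\<not> [:a, 1:] dvd 1"
    using is_unit_polyE[of "[:a, 1:]"] by (metis degree_pCons_eq_if degree_pCons_0 n_not_Suc_n one_pCons pCons_eq_0_iff pCons_eq_iff zero_neq_one)
  show "[:a, 1:] dvd P \<or> [:a, 1:] dvd Q" if "[:a, 1:] dvd P * Q" for P Q
    using that poly_eq_0_iff_dvd[of _ "- a"] by (metis minus_minus mult_eq_0_iff poly_mult)
qed simp

text \<open>The linear factors of \<open>\<zeta>^3\<close>: \<open>x\<close>, \<open>y\<close>,
  \<open>z\<close>, \<open>y - x\<close>, \<open>z - x\<close>, \<open>z - y\<close>. Up to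
  constants they are the six differences of the forms \<open>x 1\<close>, ..., \<open>x 4\<close>,
  that is, the mirrors of the symmetric group on four letters. Each is monic linear in its outermost
  variable or a constant polynomial over such a one.\<close>

definition arrangement :: "complex poly poly poly list" where
  "arrangement = [[:[:[:0,1:]:]:], [:[:0,1:]:], [:0,1:],
     [:[:- [:0,1:], 1:]:], [:- [:[:0,1:]:], 1:], [:- [:0,1:], 1:]]"

lemma prime_arrangement: "P \<in> set arrangement \<Longrightarrow> prime_elem P"
  unfolding arrangement_def
  by (auto simp only: list.set insert_iff empty_iff
      intro: lift_prime_elem_poly prime_elem_linear)

lemma ev3_arrangement:
  "map (\<lambda>P. ev3 P x y z) arrangement = [x, y, z, y - x, z - x, z - y]"
  by (simp add: arrangement_def ev3_def)

lemma ev3_dvd: "P dvd Q \<Longrightarrow> ev3 P x y z = 0 \<Longrightarrow> ev3 Q x y z = 0"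
  by (auto simp: dvd_def ev3_mult)

text \<open>For each factor there is a point on its plane at which all later factors are non-zero;
  evaluation there excludes divisibility.\<close>

lemma sorted_arrangement: "sorted_wrt (\<lambda>P Q. \<not> P dvd Q) arrangement"
proof -
  have *: "\<not> P dvd Q" if "ev3 P x y z = 0" "ev3 Q x y z \<noteq> 0" for P Q x y z
    using that ev3_dvd by blast
  have ev: "ev3 (arrangement ! 0) x y z = x" "ev3 (arrangement ! Suc 0) x y z = y"
    "ev3 (arrangement ! 2) x y z = z" "ev3 (arrangement ! 3) x y z = y - x"
    "ev3 (arrangement ! 4) x y z = z - x" "ev3 (arrangement ! 5) x y z = z - y" for x y z
    by (simp_all add: arrangement_def ev3_def eval_nat_numeral)
  have "\<not> arrangement ! i dvd arrangement ! j" if "i < j" "j < 6" for i j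
  proof -
    consider "i = 0" | "i = 1" | "i = 2" | "i = 3" | "i = 4" using \<open>i < j\<close> \<open>j < 6\<close> by linarith
    then show ?thesis
    proof cases
      case 1
      then have "j \<in> {1, 2, 3, 4, 5}" using that by auto
      with 1 show ?thesis by (intro *[where x = 0 and y = 1 and z = 2]) (auto simp: ev)
    next
      case 2
      then have "j \<in> {2, 3, 4, 5}" using that by auto
      with 2 show ?thesis by (intro *[where x = 1 and y = 0 and z = 2]) (auto simp: ev)
    next
      case 3
      then have "j \<in> {3, 4, 5}" using that by auto
      with 3 show ?thesis by (intro *[where x = 1 and y = 2 and z = 0]) (auto simp: ev)
    next
      case 4
      then have "j \<in> {4, 5}" using that by auto
      with 4 show ?thesis by (intro *[where x = 1 and y = 1 and z = 2]) (auto simp: ev)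
    next
      case 5
      then have "j = 5" using that by auto
      with 5 show ?thesis by (intro *[where x = 1 and y = 2 and z = 1]) (auto simp: ev)
    qed
  qed
  then show ?thesis by (simp add: sorted_wrt_iff_nth_less) (simp add: arrangement_def)
qed

text \<open>Non-divisibility is asked of later entries only, because the induction removes the head:
  \<open>p\<close> divides \<open>prod_list ps * k\<close> but no entry of \<open>ps\<close>, hence
  \<open>k\<close>.\<close>

lemma prod_list_primes_dvd:
  fixes a :: "'a::idom"
  assumes "sorted_wrt (\<lambda>p q. \<not> p dvd q) ps" "\<And>p. p \<in> set ps \<Longrightarrow> prime_elem p" "\<And>p. p \<in> set ps \<Longrightarrow> p dvd a"
  shows "prod_list ps dvd a"
  using assms
proof (induction ps)
  case (Cons p ps)
  then obtain k where k: "a = prod_list ps * k" by (auto simp: dvd_def)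
  have p: "prime_elem p" using Cons.prems by simp
  have "\<not> p dvd prod_list qs" if "set qs \<subseteq> set ps" for qs
    using that p Cons.prems(1)
    by (induction qs) (auto simp: prime_elem_dvd_mult_iff prime_elem_not_unit)
  then have "p dvd k" using Cons.prems(3)[of p] k prime_elem_dvd_mult_iff[OF p] by auto
  then show ?case using k by (auto simp: dvd_def mult_ac)
qed simp

lemma arrangement_cube_dvd:
  assumes "A ^ 3 = B * prod_list arrangement ^ 2"
  shows "prod_list arrangement dvd A"
proof (rule prod_list_primes_dvd[OF sorted_arrangement prime_arrangement])
  fix P assume P: "P \<in> set arrangement"
  then have "P dvd prod_list arrangement" by (rule prod_list_dvd)
  then have "P dvd A ^ 3" unfolding assms by (simp add: power2_eq_square)
  then show "P dvd A" using prime_elem_dvd_power prime_arrangement[OF P] by blast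
qed

section \<open>The graded ring of scalar forms\<close>

lemma conv_homog:
  fixes m :: "'a::zero \<Rightarrow> 'b::zero \<Rightarrow> 'c::comm_monoid_add"
  assumes "\<And>y. m 0 y = 0" "\<And>x. m x 0 = 0"
  shows "conv m (homog i f) (homog j h) = homog (i + j) (\<lambda>b. m (f b) (h b))"
proof (intro ext)
  fix n b
  show "conv m (homog i f) (homog j h) n b = homog (i + j) (\<lambda>b. m (f b) (h b)) n b"
  proof (cases "f = (\<lambda>_. 0)")
    case True
    then show ?thesis using assms by (simp add: conv_def homog_def)
  next
    case False
    then have "{k. homog i f k \<noteq> (\<lambda>_. 0)} = {i}" by (auto simp: homog_def)
    then show ?thesis using assms by (auto simp: conv_def homog_def)
  qed
qed

lemma homog_direct_sum:
  assumes "f \<in> A k" "\<And>n. (\<lambda>_. 0) \<in> A n"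
  shows "homog k f \<in> direct_sum A"
proof -
  have "finite {n. homog k f n \<noteq> (\<lambda>_. 0)}"
    by (rule finite_subset[of _ "{k}"]) (auto simp: homog_def)
  then show ?thesis using assms by (simp add: direct_sum_def homog_def)
qed

locale picard_ring =
  fixes \<phi>0 \<phi>1 \<phi>2 :: "pt \<Rightarrow> complex"
  assumes phi_form: "\<phi>0 \<in> M0 0 3" "\<phi>1 \<in> M0 0 3" "\<phi>2 \<in> M0 0 3"
    and poly_ring: "is_polynomial_ring MRing const_form (homog 3 \<phi>0) (homog 3 \<phi>1) (homog 3 \<phi>2)"
begin

lemma cring_MRing: "cring MRing"
  using poly_ring by (simp add: is_polynomial_ring_def)

sublocale MR: cring MRing
  by (rule cring_MRing)

lemma homog_carrier: "f \<in> M0 0 k \<Longrightarrow> homog k f \<in> carrier MRing"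
  by (simp add: MRing_def homog_direct_sum M0_zero)

lemma const_form_carrier: "const_form c \<in> carrier MRing"
  unfolding const_form_def by (rule homog_carrier[OF M0_const])

lemma homog_mult: "homog i f \<otimes>\<^bsub>MRing\<^esub> homog j h = homog (i + j) (\<lambda>b. f b * h b)"
  by (simp add: MRing_def conv_homog)

text \<open>The guard matters for \<open>n = 0\<close>: the power is then the unit of the ring,
  which is 0 off the ball, whereas \<open>f b ^ 0\<close> is 1 everywhere.\<close>

lemma homog_pow:
  assumes "off_zero f"
  shows "homog i f [^]\<^bsub>MRing\<^esub> n = homog (i * int n) (\<lambda>b. if b \<in> Bal then f b ^ n else 0)"
proof (induction n)
  case 0
  then show ?case by (simp add: MRing_def const_form_def nat_pow_def cong: if_cong)
next
  case (Suc n)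
  have "(\<lambda>b. (if b \<in> Bal then f b ^ n else 0) * f b) = (\<lambda>b. if b \<in> Bal then f b ^ Suc n else 0)"
    using assms by (auto simp: off_zero_def fun_eq_iff)
  then show ?case using Suc by (simp add: homog_mult algebra_simps)
qed

definition term3 :: "complex \<Rightarrow> nat \<times> nat \<times> nat \<Rightarrow> pt \<Rightarrow> complex" where
  "term3 c a b = (case a of (p, q, r) \<Rightarrow>
     if b \<in> Bal then c * (\<phi>0 b ^ p * (\<phi>1 b ^ q * \<phi>2 b ^ r)) else 0)"

definition deg3 :: "nat \<times> nat \<times> nat \<Rightarrow> nat" where
  "deg3 a = (case a of (p, q, r) \<Rightarrow> p + q + r)"

lemma phi_off_zero: "off_zero \<phi>0" "off_zero \<phi>1" "off_zero \<phi>2"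
  and phi_holo: "holo \<phi>0" "holo \<phi>1" "holo \<phi>2"
  using phi_form by (auto simp: M0_iff)

definition monomial_form :: "complex \<Rightarrow> nat \<times> nat \<times> nat \<Rightarrow> int \<Rightarrow> pt \<Rightarrow> complex" where
  "monomial_form c a = const_form c \<otimes>\<^bsub>MRing\<^esub> (case a of (p, q, r) \<Rightarrow>
     (homog 3 \<phi>0 [^]\<^bsub>MRing\<^esub> p \<otimes>\<^bsub>MRing\<^esub> homog 3 \<phi>1 [^]\<^bsub>MRing\<^esub> q
       \<otimes>\<^bsub>MRing\<^esub> homog 3 \<phi>2 [^]\<^bsub>MRing\<^esub> r))"

lemma monomial_form_carrier: "monomial_form c a \<in> carrier MRing"
  by (cases a) (simp add: monomial_form_def const_form_carrier homog_carrier phi_form)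

lemma monomial_form_eq: "monomial_form c a = homog (3 * int (deg3 a)) (term3 c a)"
proof -
  obtain p q r where a: "a = (p, q, r)" by (cases a) auto
  have "(\<lambda>b. (if b \<in> Bal then c else 0) * ((if b \<in> Bal then \<phi>0 b ^ p else 0) *
      (if b \<in> Bal then \<phi>1 b ^ q else 0) * (if b \<in> Bal then \<phi>2 b ^ r else 0))) = term3 c a"
    by (auto simp: term3_def a fun_eq_iff mult_ac)
  then show ?thesis
    by (simp add: monomial_form_def a const_form_def homog_pow phi_off_zero homog_mult deg3_def
        algebra_simps)
qed

lemma finsum_MRing:
  assumes "\<And>a. a \<in> A \<Longrightarrow> f a \<in> carrier MRing" "finite A"
  shows "finsum MRing f A k b = (\<Sum>a\<in>A. f a k b)"
  using assms(2,1)
proof (induction A)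
  case empty
  then show ?case by (simp add: MR.finsum_empty) (simp add: MRing_def)
next
  case (insert a A)
  then have "finsum MRing f (insert a A) = f a \<oplus>\<^bsub>MRing\<^esub> finsum MRing f A"
    by (intro MR.finsum_insert) auto
  then have "finsum MRing f (insert a A) k b = f a k b + finsum MRing f A k b"
    by (simp only:) (simp add: MRing_def)
  then show ?case using insert by simp
qed

definition eval_form :: "(nat \<times> nat \<times> nat \<Rightarrow> complex) \<Rightarrow> int \<Rightarrow> pt \<Rightarrow> complex" where
  "eval_form c = finsum MRing (\<lambda>a. monomial_form (c a) a) {a. c a \<noteq> 0}"

lemma bij_eval_form: "bij_betw eval_form {c. finite {a. c a \<noteq> 0}} (carrier MRing)"
  using poly_ring unfolding is_polynomial_ring_def eval_form_def[abs_def] monomial_form_def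
  by (simp add: case_prod_unfold)

lemma eval_form_eq:
  assumes "finite {a. c a \<noteq> 0}"
  shows "eval_form c k b = (\<Sum>a\<in>{a. c a \<noteq> 0 \<and> 3 * int (deg3 a) = k}. term3 (c a) a b)"
proof -
  have "eval_form c k b = (\<Sum>a\<in>{a. c a \<noteq> 0}. homog (3 * int (deg3 a)) (term3 (c a) a) k b)"
    unfolding eval_form_def by (subst finsum_MRing[OF monomial_form_carrier assms])
      (simp add: monomial_form_eq)
  also have "\<dots> = (\<Sum>a\<in>{a \<in> {a. c a \<noteq> 0}. 3 * int (deg3 a) = k}. term3 (c a) a b)"
    unfolding sum.inter_filter[OF assms] by (intro sum.cong) (auto simp: homog_def)
  finally show ?thesis by simp
qed

lemma ev3_mono3_phi: "b \<in> Bal \<Longrightarrow> ev3 (mono3 c a) (\<phi>0 b) (\<phi>1 b) (\<phi>2 b) = term3 c a b"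
  by (cases a) (simp add: ev3_mono3 term3_def mult_ac)

lemma M0_eval_form:
  assumes "F \<in> M0 0 k"
  obtains c where "finite {a. c a \<noteq> 0}"
    "\<And>b. F b = (\<Sum>a\<in>{a. c a \<noteq> 0 \<and> 3 * int (deg3 a) = k}. term3 (c a) a b)"
proof -
  have "homog k F \<in> eval_form ` {c. finite {a. c a \<noteq> 0}}"
    using homog_carrier[OF assms] bij_betw_imp_surj_on[OF bij_eval_form] by simp
  then obtain c where c: "c \<in> {c. finite {a. c a \<noteq> 0}}" "homog k F = eval_form c"
    by (elim imageE)
  have fin: "finite {a. c a \<noteq> 0}" using c(1) by simp
  show thesis
  proof (rule that[OF fin])
    fix b
    have "F b = homog k F k b" by (simp add: homog_def)
    then show "F b = (\<Sum>a\<in>{a. c a \<noteq> 0 \<and> 3 * int (deg3 a) = k}. term3 (c a) a b)"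
      unfolding c(2) eval_form_eq[OF fin] .
  qed
qed

lemma M0_polynomial:
  assumes "F \<in> M0 0 k"
  obtains P where "\<And>b. b \<in> Bal \<Longrightarrow> F b = ev3 P (\<phi>0 b) (\<phi>1 b) (\<phi>2 b)"
proof -
  obtain c where c: "\<And>b. F b = (\<Sum>a\<in>{a. c a \<noteq> 0 \<and> 3 * int (deg3 a) = k}. term3 (c a) a b)"
    using M0_eval_form[OF assms] by blast
  show thesis
  proof (rule that)
    show "F b = ev3 (\<Sum>a\<in>{a. c a \<noteq> 0 \<and> 3 * int (deg3 a) = k}. mono3 (c a) a) (\<phi>0 b) (\<phi>1 b) (\<phi>2 b)"
      if "b \<in> Bal" for b
      unfolding c ev3_sum ev3_mono3_phi[OF that] ..
  qed
qed

text \<open>The empty monomial is the only one of weight 0, so the polynomial ring takes the place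
  of a maximum principle on the quotient of the ball.\<close>

lemma M0_weight_0:
  assumes "F \<in> M0 0 0"
  obtains c where "\<And>b. b \<in> Bal \<Longrightarrow> F b = c"
proof -
  obtain c where c: "\<And>b. F b = (\<Sum>a\<in>{a. c a \<noteq> 0 \<and> 3 * int (deg3 a) = 0}. term3 (c a) a b)"
    using M0_eval_form[OF assms] by blast
  have "3 * int (deg3 a) = 0 \<longleftrightarrow> a = (0, 0, 0)" for a
    by (cases a) (auto simp: deg3_def)
  then have "{a. c a \<noteq> 0 \<and> 3 * int (deg3 a) = 0} = (if c (0, 0, 0) = 0 then {} else {(0, 0, 0)})"
    by auto
  then have "F b = c (0, 0, 0)" if "b \<in> Bal" for b
    using that by (simp add: c term3_def)
  then show thesis by (rule that)
qed

lemma term3_act: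
  assumes g: "g \<in> Gam_cong" and b: "b \<in> Bal"
  shows "term3 c a (act g b) = j1 g b ^ (3 * deg3 a) * term3 c a b"
proof -
  obtain p q r where a: "a = (p, q, r)" by (cases a) auto
  have "\<phi>0 (act g b) = j1 g b ^ 3 * \<phi>0 b" "\<phi>1 (act g b) = j1 g b ^ 3 * \<phi>1 b"
    "\<phi>2 (act g b) = j1 g b ^ 3 * \<phi>2 b"
    using phi_form g b by (auto simp: M0_iff)
  then show ?thesis
    using b act_Bal[OF Gam_congD[OF g] b]
    by (simp add: term3_def a deg3_def power_mult_distrib power_add distrib_left
        power_mult[symmetric] mult_ac)
qed

text \<open>Forms of different weights are linearly independent because the automorphy factor takes
  infinitely many values at each point.\<close>

lemma graded_zero:
  assumes fin: "finite A" and zero: "\<And>b. b \<in> Bal \<Longrightarrow> (\<Sum>a\<in>A. term3 (c a) a b) = 0" and b: "b \<in> Bal"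
  shows "(\<Sum>a\<in>{a\<in>A. deg3 a = n}. term3 (c a) a b) = 0"
proof -
  obtain u v where uv: "b = (u, v)" by fastforce
  have "v \<noteq> 0" using b by (auto simp: uv Bal_def)
  \<comment> \<open>For fixed \<open>b\<close>, the relation at \<open>act g b\<close> is a
    polynomial in the single number \<open>j1 g b\<close>, and its coefficient of exponent
    \<open>3 * n\<close> is the part of degree \<open>n\<close>.\<close>
  define p where "p = (\<Sum>a\<in>A. monom (term3 (c a) a b) (3 * deg3 a))"
  have root: "poly p (j1 (lower_mat m) b) = 0" for m
  proof -
    have "(\<Sum>a\<in>A. term3 (c a) a (act (lower_mat m) b)) = 0"
      by (intro zero act_Bal b Gam_congD lower_mat_cong)
    then show ?thesis
      by (simp add: p_def poly_sum poly_monom term3_act[OF lower_mat_cong b] mult.commute)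
  qed
  have "inj (\<lambda>m. j1 (lower_mat m) b)"
    using \<open>v \<noteq> 0\<close> by (auto simp: inj_def uv j1_def lower_mat_def)
  then have "infinite (range (\<lambda>m. j1 (lower_mat m) b))" using range_inj_infinite by blast
  then have "infinite {x. poly p x = 0}"
    by (rule infinite_super[rotated]) (auto simp: root)
  then have "p = 0" using poly_roots_finite by blast
  then have "0 = coeff p (3 * n)" by simp
  also have "\<dots> = (\<Sum>a\<in>A. if deg3 a = n then term3 (c a) a b else 0)"
    unfolding p_def coeff_sum by (intro sum.cong) auto
  also have "\<dots> = (\<Sum>a\<in>{a\<in>A. deg3 a = n}. term3 (c a) a b)"
    by (simp add: sum.inter_filter[OF fin])
  finally show ?thesis by simp
qed

text \<open>Algebraic independence of the three functions on the ball. The ring hypothesis gives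
  injectivity for graded families, so a relation between values is first split into its homogeneous
  parts by \<open>graded_zero\<close>.\<close>

lemma ev3_phi_zero:
  assumes "\<And>b. b \<in> Bal \<Longrightarrow> ev3 P (\<phi>0 b) (\<phi>1 b) (\<phi>2 b) = 0"
  shows "P = 0"
proof -
  let ?A = "{a. coeff3 P a \<noteq> 0}"
  have "(\<Sum>a\<in>?A. term3 (coeff3 P a) a b) = 0" if b: "b \<in> Bal" for b
  proof -
    have "ev3 P (\<phi>0 b) (\<phi>1 b) (\<phi>2 b) = (\<Sum>a\<in>?A. term3 (coeff3 P a) a b)"
      by (subst coeff3_expand) (simp add: ev3_sum ev3_mono3_phi b)
    then show ?thesis using assms b by simp
  qed
  note gz = graded_zero[OF finite_coeff3 this]
  have "eval_form (coeff3 P) k b = 0" for k b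
  proof (cases "b \<in> Bal \<and> (\<exists>n. k = 3 * int n)")
    case True
    then obtain n where n: "k = 3 * int n" and b: "b \<in> Bal" by blast
    have "{a. coeff3 P a \<noteq> 0 \<and> 3 * int (deg3 a) = k} = {a\<in>?A. deg3 a = n}" by (auto simp: n)
    then show ?thesis using gz[OF _ b, of n] by (simp add: eval_form_eq finite_coeff3)
  next
    case False
    then show ?thesis
      by (auto simp: eval_form_eq finite_coeff3 term3_def intro!: sum.neutral)
  qed
  moreover have "eval_form (\<lambda>_. 0) k b = 0" for k b
    by (simp add: eval_form_eq)
  ultimately have "eval_form (coeff3 P) = eval_form (\<lambda>_. 0)" by (intro ext) simp
  then have "coeff3 P = (\<lambda>_. 0)"
    using bij_eval_form finite_coeff3[of P] by (auto simp: bij_betw_def dest: inj_onD)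
  then show "P = 0" by (intro coeff3_eq) (simp add: coeff3_def split: prod.split)
qed

lemma holo_ev3: "holo (\<lambda>b. ev3 P (\<phi>0 b) (\<phi>1 b) (\<phi>2 b))"
proof -
  have "holo (\<lambda>b. \<Sum>a\<in>{a. coeff3 P a \<noteq> 0}. ev3 (mono3 (coeff3 P a) a) (\<phi>0 b) (\<phi>1 b) (\<phi>2 b))"
  proof (rule holo_sum)
    fix a :: "nat \<times> nat \<times> nat"
    obtain p q r where a: "a = (p, q, r)" by (cases a) auto
    show "holo (\<lambda>b. ev3 (mono3 (coeff3 P a) a) (\<phi>0 b) (\<phi>1 b) (\<phi>2 b))"
      unfolding a ev3_mono3 by (intro holo_intros phi_holo)
  qed
  also have "(\<lambda>b. \<Sum>a\<in>{a. coeff3 P a \<noteq> 0}. ev3 (mono3 (coeff3 P a) a) (\<phi>0 b) (\<phi>1 b) (\<phi>2 b)) =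
     (\<lambda>b. ev3 P (\<phi>0 b) (\<phi>1 b) (\<phi>2 b))"
    by (subst (2) coeff3_expand) (simp add: ev3_sum)
  finally show ?thesis .
qed

end

locale picard = picard_ring +
  fixes \<zeta> :: "pt \<Rightarrow> complex"
  assumes zeta_form: "\<zeta> \<in> M0 1 6"
    and zeta_nonzero: "\<exists>b\<in>Bal. \<zeta> b \<noteq> 0"
    and zeta_cube: "\<And>b. b \<in> Bal \<Longrightarrow> \<zeta> b ^ 3 = - rho / (sqrtm3 * 3 ^ 7) *
        (\<phi>0 b * \<phi>1 b * \<phi>2 b * (\<phi>1 b - \<phi>0 b) * (\<phi>2 b - \<phi>0 b) * (\<phi>2 b - \<phi>1 b))"
begin

definition \<kappa> :: complex where
  "\<kappa> = - rho / (sqrtm3 * 3 ^ 7)"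

lemma kappa_nonzero: "\<kappa> \<noteq> 0"
  using rho_cube by (auto simp: \<kappa>_def)

lemma zeta_holo: "holo \<zeta>"
  using zeta_form by (simp add: M0_iff)

lemma zeta_cube_ev3:
  assumes "b \<in> Bal"
  shows "\<zeta> b ^ 3 = \<kappa> * ev3 (prod_list arrangement) (\<phi>0 b) (\<phi>1 b) (\<phi>2 b)"
proof -
  have *: "ev3 (prod_list Ps) x y z = prod_list (map (\<lambda>P. ev3 P x y z) Ps)" for Ps x y z
    by (induction Ps) (simp_all add: ev3_mult, simp add: ev3_def)
  show ?thesis
    unfolding * ev3_arrangement zeta_cube[OF assms] \<kappa>_def by (simp add: mult_ac)
qed

theorem M0_det_divisible:
  assumes h: "h \<in> M0 1 m"
  obtains a where "a \<in> M0 0 (m - 6)" "\<And>b. b \<in> Bal \<Longrightarrow> h b = \<zeta> b * a b"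
proof -
  let ?ev = "\<lambda>P b. ev3 P (\<phi>0 b) (\<phi>1 b) (\<phi>2 b)"
  let ?Q = "prod_list arrangement"
  \<comment> \<open>Three factors with character \<open>det\<close> give
    \<open>det ^ 3 = 1\<close>.\<close>
  have triple: "(\<lambda>b. f b * (g b * h b)) \<in> M0 0 (i + (j + k))"
    if "f \<in> M0 1 i" "g \<in> M0 1 j" "h \<in> M0 1 k" for f g h i j k
    using M0_mult[OF that(1) M0_mult[OF that(2,3)]] M0_det_cube[of _ 0] by (simp add: numeral_3_eq_3)
  obtain A where A: "\<And>b. b \<in> Bal \<Longrightarrow> h b * (\<zeta> b * \<zeta> b) = ?ev A b"
    using M0_polynomial[OF triple[OF h zeta_form zeta_form]] by blast
  obtain B where B: "\<And>b. b \<in> Bal \<Longrightarrow> h b * (h b * h b) = ?ev B b"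
    using M0_polynomial[OF triple[OF h h h]] by blast
  have "A ^ 3 - [:[:[:\<kappa>^2:]:]:] * B * ?Q ^ 2 = 0"
  proof (rule ev3_phi_zero)
    fix b assume b: "b \<in> Bal"
    have "?ev A b ^ 3 = (h b * (h b * h b)) * (\<zeta> b ^ 3) ^ 2"
      unfolding A[OF b, symmetric] by (simp add: eval_nat_numeral mult_ac)
    also have "\<dots> = ?ev B b * (\<kappa> * ?ev ?Q b) ^ 2"
      by (simp only: B[OF b] zeta_cube_ev3[OF b])
    finally show "?ev (A ^ 3 - [:[:[:\<kappa>^2:]:]:] * B * ?Q ^ 2) b = 0"
      by (simp add: ev3_diff ev3_mult ev3_power) (simp add: ev3_def power_mult_distrib)
  qed
  then have "?Q dvd A" by (intro arrangement_cube_dvd[of _ "[:[:[:\<kappa>^2:]:]:] * B"]) simp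
  then obtain A' where A': "A = ?Q * A'" by (auto simp: dvd_def)
  \<comment> \<open>From \<open>\<zeta>^2 * h = Q * A'\<close> and
    \<open>\<zeta>^3 = \<kappa> * Q\<close>, where \<open>Q\<close> is the product of the
    arrangement, the quotient \<open>h / \<zeta>\<close> must be \<open>A' / \<kappa>\<close>, which
    has values at the zeros of \<open>\<zeta>\<close> too.\<close>
  define a where "a = (\<lambda>b. if b \<in> Bal then ?ev A' b / \<kappa> else 0)"
  have holo_a: "holo a"
    unfolding a_def divide_inverse by (intro holo_restrict holo_mult holo_ev3 holo_const)
  have h_eq: "h b = \<zeta> b * a b" if "b \<in> Bal" for b
  proof (rule holo_mult_cancel[OF holo_power[OF zeta_holo, of 2] _ _ _ _ that])
    show "holo h" using h by (simp add: M0_iff)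
    show "holo (\<lambda>b. \<zeta> b * a b)" by (intro holo_mult zeta_holo holo_a)
    show "\<exists>b\<in>Bal. \<zeta> b ^ 2 \<noteq> 0" using zeta_nonzero by simp
    fix c assume c: "c \<in> Bal"
    have "\<zeta> c ^ 2 * h c = ?ev ?Q c * ?ev A' c"
      using A[OF c] by (simp add: A' ev3_mult power2_eq_square mult_ac)
    also have "\<dots> = \<zeta> c ^ 3 * a c"
      using c kappa_nonzero by (simp add: zeta_cube_ev3 a_def)
    finally show "\<zeta> c ^ 2 * h c = \<zeta> c ^ 2 * (\<zeta> c * a c)"
      by (simp add: eval_nat_numeral mult_ac)
  qed
  have "a \<in> M0 0 (m - 6)"
    unfolding M0_iff
  proof (intro conjI ballI)
    show "off_zero a" by (simp add: a_def off_zero_def)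
    show "holo a" by (rule holo_a)
    fix g b assume g: "g \<in> Gam_cong" and b: "b \<in> Bal"
    have G: "g \<in> Gam" by (rule Gam_congD[OF g])
    \<comment> \<open>The weight \<open>m - 6\<close> may be negative; the power is then holomorphic
      because \<open>j1\<close> has no zeros on the ball.\<close>
    have J: "holo (\<lambda>b. j1 g b powi (m - 6))"
    proof (cases "m - 6 \<ge> 0")
      case True
      then have "(\<lambda>b. j1 g b powi (m - 6)) = (\<lambda>b. j1 g b ^ nat (m - 6))"
        by (simp add: power_int_def)
      then show ?thesis by (simp add: holo_power holo_j1)
    next
      case False
      then have "(\<lambda>b. j1 g b powi (m - 6)) = (\<lambda>b. 1 / j1 g b ^ nat (6 - m))"
        by (simp add: power_int_def fun_eq_iff inverse_eq_divide power_one_over)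
      then show ?thesis
        by (simp only:) (intro holo_divide holo_const holo_power holo_j1, simp add: j1_nonzero G)
    qed
    show "a (act g b) = j1 g b powi (m - 6) * (det g ^ 0 * a b)"
    proof (rule holo_mult_cancel[OF zeta_holo _ _ _ zeta_nonzero b])
      show "holo (\<lambda>b. a (act g b))" by (rule holo_act[OF holo_a G])
      show "holo (\<lambda>b. j1 g b powi (m - 6) * (det g ^ 0 * a b))"
        by (intro holo_mult J holo_const holo_a)
      fix c assume c: "c \<in> Bal"
      have j: "j1 g c \<noteq> 0" by (rule j1_nonzero[OF G c])
      have "h (act g c) = j1 g c powi m * (det g * h c)"
        "\<zeta> (act g c) = j1 g c powi 6 * (det g * \<zeta> c)"
        using h zeta_form g c by (auto simp: M0_iff)
      then have "j1 g c powi m * (det g * (\<zeta> c * a c)) = j1 g c powi 6 * (det g * \<zeta> c) * a (act g c)"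
        by (metis h_eq[OF c] h_eq[OF act_Bal[OF G c]])
      moreover have "j1 g c powi m = j1 g c powi 6 * j1 g c powi (m - 6)"
        using j power_int_add[of "j1 g c" 6 "m - 6"] by simp
      ultimately have "(j1 g c powi 6 * det g) * (\<zeta> c * a (act g c)) =
          (j1 g c powi 6 * det g) * (\<zeta> c * (j1 g c powi (m - 6) * (det g ^ 0 * a c)))"
        by (auto simp: mult_ac)
      then show "\<zeta> c * a (act g c) = \<zeta> c * (j1 g c powi (m - 6) * (det g ^ 0 * a c))"
        using j Gam_det_nonzero[OF G] by (metis mult_cancel_left mult_eq_0_iff power_int_eq_0_iff)
    qed
  qed
  then show thesis using h_eq by (rule that)
qed

end

section \<open>The Jacobian determinant near the curve \<open>u = 0\<close>\<close>

text \<open>Taylor's formula with remainder, the derivative being bounded by Cauchy's inequality on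
  circles of radius \<open>d / 2\<close> inside \<open>ball 0 (2 * d)\<close>. The constant depends
  on \<open>d\<close>, \<open>r\<close> and \<open>M\<close> only, so it serves a whole family of
  slices at once.\<close>

lemma holomorphic_zero_order_bound:
  assumes G: "G holomorphic_on ball 0 (2 * d)" and d: "0 < d"
    and M: "\<And>u. u \<in> ball 0 (2 * d) \<Longrightarrow> cmod (G u) \<le> M"
    and z: "\<And>i. i < r \<Longrightarrow> (deriv ^^ i) G 0 = 0" and r: "0 < r" and u: "cmod u < d"
  shows "cmod (G u) \<le> fact r * M / (d / 2) ^ r * cmod u ^ r"
proof -
  obtain n where n: "r = Suc n" using r gr0_implies_Suc by blast
  let ?B = "fact r * M / (d / 2) ^ r"
  have M0: "0 \<le> M" using M[of 0] d norm_ge_zero[of "G 0"] by (simp del: norm_ge_zero)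
  have B: "cmod ((deriv ^^ r) G x) \<le> ?B" if x: "x \<in> ball 0 d" for x
  proof (rule Cauchy_inequality)
    have sub: "cball x (d / 2) \<subseteq> ball 0 (2 * d)"
    proof
      fix y assume "y \<in> cball x (d / 2)"
      then have "dist 0 y \<le> dist 0 x + d / 2" using dist_triangle[of 0 y x] by simp
      then show "y \<in> ball 0 (2 * d)" using x d by simp
    qed
    show "G holomorphic_on ball x (d / 2)"
      using G by (rule holomorphic_on_subset) (use sub in auto)
    show "continuous_on (cball x (d / 2)) G"
      using holomorphic_on_imp_continuous_on[OF G] sub continuous_on_subset by blast
    show "0 < d / 2" using d by simp
    show "cmod (G y) \<le> M" if "cmod (x - y) = d / 2" for y
      using that sub by (intro M) (auto simp: dist_norm)
  qed
  have "cmod ((deriv ^^ 0) G u - (\<Sum>i\<le>n. (deriv ^^ i) G 0 * (u - 0) ^ i / fact i))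
      \<le> ?B * cmod (u - 0) ^ Suc n / fact n"
  proof (rule complex_Taylor[where S = "ball 0 d"])
    fix i x assume x: "x \<in> ball (0::complex) d"
    have "(deriv ^^ i) G holomorphic_on ball 0 (2 * d)"
      by (rule holomorphic_higher_deriv[OF G]) simp
    then have "((deriv ^^ i) G has_field_derivative deriv ((deriv ^^ i) G) x) (at x)"
      using x d by (intro holomorphic_derivI[of _ "ball 0 (2 * d)"]) auto
    then show "((deriv ^^ i) G has_field_derivative (deriv ^^ Suc i) G x) (at x within ball 0 d)"
      by (simp add: has_field_derivative_at_within)
  qed (use d u B n in auto)
  moreover have "(\<Sum>i\<le>n. (deriv ^^ i) G 0 * (u - 0) ^ i / fact i) = 0"
    by (rule sum.neutral) (use z n in auto)
  ultimately have "cmod (G u) \<le> ?B * cmod u ^ r / fact n" by (simp add: n)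
  also have "\<dots> \<le> ?B * cmod u ^ r / 1"
    using M0 d by (intro divide_left_mono) (auto simp: fact_ge_1)
  finally show ?thesis by simp
qed

lemma deriv_bound:
  assumes f: "f holomorphic_on S" and S: "cball v d \<subseteq> S" and d: "0 < d"
    and B: "\<And>w. w \<in> cball v d \<Longrightarrow> cmod (f w) \<le> B"
  shows "cmod (deriv f v) \<le> B / d"
proof -
  have "cmod ((deriv ^^ 1) f v) \<le> fact 1 * B / d ^ 1"
  proof (rule Cauchy_inequality[OF _ _ d])
    show "f holomorphic_on ball v d"
      using f by (rule holomorphic_on_subset) (use S in auto)
    show "continuous_on (cball v d) f"
      using holomorphic_on_imp_continuous_on[OF f] S continuous_on_subset by blast
    show "cmod (f w) \<le> B" if "cmod (v - w) = d" for w
      using that by (intro B) (simp add: dist_norm)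
  qed
  then show ?thesis by simp
qed

lemma holo_slice_u: "holo f \<Longrightarrow> (\<lambda>u. f (u, v)) holomorphic_on {u. (u, v) \<in> Bal}"
  using holo_line[of f 0 1 v 0] by simp

lemma holo_slice_v: "holo f \<Longrightarrow> (\<lambda>v. f (u, v)) holomorphic_on {v. (u, v) \<in> Bal}"
  using holo_line[of f u 0 0 1] by simp

lemma grad_slice:
  "grad f (u, v) $ 1 = deriv (\<lambda>x. f (x, v)) u" "grad f (u, v) $ 2 = deriv (\<lambda>y. f (u, y)) v"
  by (simp_all add: grad_def)

lemma Bal_polydisc:
  assumes "(u, v) \<in> Bal"
  obtains d where "0 < d" "cball u d \<times> cball v d \<subseteq> Bal"
proof -
  obtain A B where AB: "open A" "open B" "(u, v) \<in> A \<times> B" "A \<times> B \<subseteq> Bal"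
    using open_prod_elim[OF open_Bal assms] by blast
  obtain a b where "0 < a" "cball u a \<subseteq> A" "0 < b" "cball v b \<subseteq> B"
    using AB open_contains_cball by (metis mem_Sigma_iff)
  then have "cball u (min a b) \<times> cball v (min a b) \<subseteq> A \<times> B" "0 < min a b" by auto
  with AB(4) have "cball u (min a b) \<times> cball v (min a b) \<subseteq> Bal" "0 < min a b" by auto
  then show thesis using that by blast
qed

text \<open>Continuity in \<open>u\<close> of the derivative in the other variable: uniform
  continuity on a polydisc makes neighbouring slices close, and Cauchy's estimate in
  \<open>v\<close> passes this on to their derivatives.\<close>

lemma grad_2_tendsto:
  assumes f: "holo f" and b: "(u0, v) \<in> Bal"
  shows "((\<lambda>u. grad f (u, v) $ 2) \<longlongrightarrow> grad f (u0, v) $ 2) (at u0)"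
proof (rule tendstoI)
  fix e :: real assume e: "0 < e"
  obtain d where d: "0 < d" "cball u0 d \<times> cball v d \<subseteq> Bal" using Bal_polydisc[OF b] .
  let ?K = "cball u0 d \<times> cball v d"
  have "uniformly_continuous_on ?K f"
    using holo_continuous[OF f] d(2) by (intro compact_uniformly_continuous)
      (auto intro: continuous_on_subset compact_Times)
  moreover have "0 < e * d / 2" using e d by simp
  ultimately obtain s where s: "0 < s"
    "\<And>x y. x \<in> ?K \<Longrightarrow> y \<in> ?K \<Longrightarrow> dist y x < s \<Longrightarrow> dist (f y) (f x) < e * d / 2"
    unfolding uniformly_continuous_on_def by metis
  have "dist (grad f (u, v) $ 2) (grad f (u0, v) $ 2) < e" if u: "dist u u0 < min s d" for u
  proof -
    have sub: "cball v d \<subseteq> {y. (u, y) \<in> Bal} \<inter> {y. (u0, y) \<in> Bal}"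
      using d u by (auto simp: dist_commute)
    have h: "(\<lambda>y. f (u, y)) holomorphic_on {y. (u, y) \<in> Bal} \<inter> {y. (u0, y) \<in> Bal}"
      "(\<lambda>y. f (u0, y)) holomorphic_on {y. (u, y) \<in> Bal} \<inter> {y. (u0, y) \<in> Bal}"
      using holo_slice_v[OF f] by (auto intro: holomorphic_on_subset)
    have op: "open ({y. (u, y) \<in> Bal} \<inter> {y. (u0, y) \<in> Bal})"
      using open_line[of u 0 0 1] open_line[of u0 0 0 1] by (simp add: open_Int)
    have v: "v \<in> {y. (u, y) \<in> Bal} \<inter> {y. (u0, y) \<in> Bal}"
      using subsetD[OF sub, of v] d(1) by simp
    have "cmod (deriv (\<lambda>y. f (u, y) - f (u0, y)) v) \<le> (e * d / 2) / d"
    proof (rule deriv_bound[OF _ sub d(1)])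
      show "(\<lambda>y. f (u, y) - f (u0, y)) holomorphic_on {y. (u, y) \<in> Bal} \<inter> {y. (u0, y) \<in> Bal}"
        using h by (intro holomorphic_intros)
      fix y assume y: "y \<in> cball v d"
      have "dist (f (u, y)) (f (u0, y)) < e * d / 2"
        using u y d by (intro s(2)) (auto simp: dist_Pair_Pair dist_commute)
      then show "cmod (f (u, y) - f (u0, y)) \<le> e * d / 2" by (simp add: dist_norm)
    qed
    also have "\<dots> < e" using e d by simp
    also have "deriv (\<lambda>y. f (u, y) - f (u0, y)) v = deriv (\<lambda>y. f (u, y)) v - deriv (\<lambda>y. f (u0, y)) v"
      by (rule deriv_diff; rule holomorphic_on_imp_differentiable_at[OF _ op v]) (rule h)+
    finally show ?thesis by (simp add: grad_slice dist_norm)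
  qed
  moreover have "0 < min s d" using s d by simp
  ultimately show "\<forall>\<^sub>F u in at u0. dist (grad f (u, v) $ 2) (grad f (u0, v) $ 2) < e"
    unfolding eventually_at by blast
qed

lemma grad_1_tendsto:
  assumes f: "holo f" and b: "(u0, v) \<in> Bal"
  shows "((\<lambda>u. grad f (u, v) $ 1) \<longlongrightarrow> grad f (u0, v) $ 1) (at u0)"
proof -
  have op: "open {u. (u, v) \<in> Bal}" using open_line[of 0 1 v 0] by simp
  have "deriv (\<lambda>u. f (u, v)) holomorphic_on {u. (u, v) \<in> Bal}"
    by (rule holomorphic_deriv[OF holo_slice_u[OF f] op])
  then have "isCont (deriv (\<lambda>u. f (u, v))) u0"
    using holomorphic_on_imp_continuous_on continuous_on_eq_continuous_at[OF op] b by blast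
  then show ?thesis by (simp add: grad_slice isCont_def)
qed

lemma slice_tendsto:
  assumes f: "holo f" and b: "(u0, v) \<in> Bal"
  shows "((\<lambda>u. f (u, v)) \<longlongrightarrow> f (u0, v)) (at u0)"
proof -
  have op: "open {u. (u, v) \<in> Bal}" using open_line[of 0 1 v 0] by simp
  have "isCont (\<lambda>u. f (u, v)) u0"
    using holomorphic_on_imp_continuous_on[OF holo_slice_u[OF f]] continuous_on_eq_continuous_at[OF op] b by blast
  then show ?thesis by (simp add: isCont_def)
qed

lemma holo_zero_polydisc:
  assumes f: "holo f" and d: "0 < d" "ball 0 d \<times> ball v d \<subseteq> Bal"
    and z: "\<And>x y. x \<in> ball 0 d \<Longrightarrow> y \<in> ball v d \<Longrightarrow> f (x, y) = 0" and b: "b \<in> Bal"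
  shows "f b = 0"
proof -
  let ?S = "{t. (0 + t * fst b, v + t * (snd b - v)) \<in> Bal}"
  let ?F = "\<lambda>t. (0 + t * fst b, v + t * (snd b - v))"
  have S0: "0 \<in> ?S" and S1: "1 \<in> ?S" using d b by auto
  have "open (?F -` (ball 0 d \<times> ball v d))"
    by (intro continuous_open_vimage open_Times open_ball continuous_intros)
  moreover have "0 \<in> ?F -` (ball 0 d \<times> ball v d)" using d by simp
  ultimately have lim: "0 islimpt (?F -` (ball 0 d \<times> ball v d))" by (rule open_imp_islimpt)
  have "f (?F 1) = 0"
  proof (rule analytic_continuation[OF holo_line[OF f] open_line convex_connected[OF convex_line] _ S0 lim _ S1])
    show "?F -` (ball 0 d \<times> ball v d) \<subseteq> ?S" using d(2) by auto
  qed (use z in auto)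
  then show ?thesis by simp
qed

text \<open>If \<open>g\<close> vanishes on the curve \<open>u = 0\<close> to the order \<open>r\<close>, then the second term of the wedge
  product vanishes to the order \<open>r - 1\<close> only, and the first one to the order \<open>r\<close>.\<close>

lemma wedge_nonzero_near_curve:
  assumes holo: "holo f0" "holo f1" "holo g" "holo k"
    and g0: "\<And>v. (0, v) \<in> Bal \<Longrightarrow> g (0, v) = 0" and gn: "\<exists>b\<in>Bal. g b \<noteq> 0"
    and k0: "(0, v1) \<in> Bal" "k (0, v1) \<noteq> 0"
    and f0: "(0, v2) \<in> Bal" "f0 (0, v2) \<noteq> 0"
    and W0: "(0, v3) \<in> Bal"
      "f0 (0, v3) * deriv (\<lambda>v. f1 (0, v)) v3 - f1 (0, v3) * deriv (\<lambda>v. f0 (0, v)) v3 \<noteq> 0"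
  obtains b where "b \<in> Bal" "k b \<noteq> 0" "g b \<noteq> 0"
    "wedge (f0 b *s grad f1 b - f1 b *s grad f0 b) (f0 b *s grad g b - g b *s grad f0 b) \<noteq> 0"
proof -
  let ?H = "{v. (0, v) \<in> Bal}"
  have opH: "open ?H" using open_line[of 0 0 0 1] by simp
  have conH: "connected ?H" using convex_connected[OF convex_line[of 0 0 0 1]] by simp
  let ?A2 = "\<lambda>v. f0 (0, v) * deriv (\<lambda>v. f1 (0, v)) v - f1 (0, v) * deriv (\<lambda>v. f0 (0, v)) v"
  have hol: "(\<lambda>v. k (0, v)) holomorphic_on ?H" "(\<lambda>v. f0 (0, v)) holomorphic_on ?H"
    "?A2 holomorphic_on ?H"
    using holo_slice_v[OF holo(1)] holo_slice_v[OF holo(2)] holo_slice_v[OF holo(4)] opH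
    by (auto intro!: holomorphic_intros holomorphic_deriv)
  \<comment> \<open>The three witnesses \<open>v1\<close>, \<open>v2\<close>, \<open>v3\<close> may
    differ. On a connected curve, functions that are not identically zero have a common point of
    non-vanishing, and by continuity a disc of such points.\<close>
  have "\<exists>v\<in>?H. k (0, v) * f0 (0, v) \<noteq> 0"
    using holomorphic_mult_eq_0[OF hol(1,2) opH conH, of v1 v2] k0 f0 by blast
  then obtain v' where "v' \<in> ?H" "k (0, v') * f0 (0, v') \<noteq> 0" by blast
  then have "\<exists>v\<in>?H. k (0, v) * f0 (0, v) * ?A2 v \<noteq> 0"
    using holomorphic_mult_eq_0[OF holomorphic_on_mult[OF hol(1,2)] hol(3) opH conH, of v' v3] W0 by blast
  then obtain v0 where v0: "v0 \<in> ?H" "k (0, v0) * f0 (0, v0) * ?A2 v0 \<noteq> 0" by blast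
  have "continuous_on ?H (\<lambda>v. k (0, v) * f0 (0, v) * ?A2 v)"
    using hol by (intro holomorphic_on_imp_continuous_on holomorphic_on_mult)
  then have opN: "open {v\<in>?H. k (0, v) * f0 (0, v) * ?A2 v \<noteq> 0}"
    by (rule open_nonzero[OF _ opH])
  obtain e0 where e0: "0 < e0" "ball v0 e0 \<subseteq> {v\<in>?H. k (0, v) * f0 (0, v) * ?A2 v \<noteq> 0}"
    using opN v0 open_contains_ball by (metis (mono_tags, lifting) mem_Collect_eq)
  obtain d0 where d0: "0 < d0" "cball 0 d0 \<times> cball v0 d0 \<subseteq> Bal"
    using Bal_polydisc[of 0 v0] v0 by blast
  define d where "d = min d0 e0 / 2"
  have d: "0 < d" "2 * d \<le> d0" "2 * d \<le> e0" using d0 e0 by (auto simp: d_def)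
  have polyd: "cball 0 (2 * d) \<times> cball v0 d \<subseteq> Bal"
    using d0(2) d by (auto simp: subset_iff)
  let ?G = "\<lambda>v u. g (u, v)"
  have holG: "?G v holomorphic_on ball 0 (2 * d)" if "v \<in> cball v0 d" for v
    using holo_slice_u[OF holo(3)] by (rule holomorphic_on_subset) (use polyd that in auto)
  have ex: "\<exists>n. \<exists>v\<in>ball v0 d. (deriv ^^ n) (?G v) 0 \<noteq> 0"
  proof (rule ccontr)
    assume "\<not> ?thesis"
    then have z: "g (u, v) = 0" if "v \<in> ball v0 d" "u \<in> ball 0 (2 * d)" for u v
      using holomorphic_fun_eq_0_on_ball[OF holG, of v u] that by auto
    have "g b = 0" if b: "b \<in> Bal" for b
    proof (rule holo_zero_polydisc[OF holo(3) d(1) _ _ b])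
      show "ball 0 d \<times> ball v0 d \<subseteq> Bal"
        by (rule subset_trans[OF Sigma_mono polyd]) (use d(1) in auto)
      show "g (x, y) = 0" if "x \<in> ball 0 d" "y \<in> ball v0 d" for x y
        using that d(1) by (intro z) auto
    qed
    then show False using gn by blast
  qed
  \<comment> \<open>The least order of vanishing in \<open>u\<close> over all slices near
    \<open>v0\<close>, attained at \<open>w\<close>. Since it bounds the order on every slice from
    below, the estimate \<open>gC\<close> is uniform in \<open>v\<close>, as Cauchy's inequality in
    \<open>v\<close> requires.\<close>
  define r where "r = (LEAST n. \<exists>v\<in>ball v0 d. (deriv ^^ n) (?G v) 0 \<noteq> 0)"
  obtain w where w: "w \<in> ball v0 d" "(deriv ^^ r) (?G w) 0 \<noteq> 0"
    using LeastI_ex[OF ex] unfolding r_def by blast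
  have low: "(deriv ^^ i) (?G v) 0 = 0" if "i < r" "v \<in> ball v0 d" for i v
    using that not_less_Least unfolding r_def by blast
  have wB: "(0, w) \<in> Bal" using w polyd d by auto
  have "r \<noteq> 0" using w(2) g0[OF wB] by (intro notI) simp
  then have r: "0 < r" by simp
  obtain h s where hs: "0 < s" "h holomorphic_on ball 0 s"
    "\<And>u. u \<in> ball 0 s \<Longrightarrow> ?G w u - ?G w 0 = (u - 0) ^ r * h u" "\<And>u. u \<in> ball 0 s \<Longrightarrow> h u \<noteq> 0"
  proof (rule holomorphic_factor_order_of_zero[OF holG[of w] open_ball _ r w(2)])
    show "w \<in> cball v0 d" "(0::complex) \<in> ball 0 (2 * d)" using w d by auto
    show "(deriv ^^ i) (?G w) 0 = 0" if "0 < i" "i < r" for i using low w that by blast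
  qed (use that in blast)
  have Gw: "g (u, w) = u ^ r * h u" if "u \<in> ball 0 s" for u
    using hs(3)[OF that] g0[OF wB] by simp
  obtain q where q: "0 < q" "cball w q \<subseteq> ball v0 d"
    using w(1) open_contains_cball[of "ball v0 d"] by blast
  have "compact (g ` (cball 0 (2 * d) \<times> cball v0 d))"
    using holo_continuous[OF holo(3)] polyd
    by (intro compact_continuous_image compact_Times) (auto intro: continuous_on_subset)
  then have "bounded (g ` (cball 0 (2 * d) \<times> cball v0 d))" by (rule compact_imp_bounded)
  then obtain M where "\<forall>x\<in>g ` (cball 0 (2 * d) \<times> cball v0 d). cmod x \<le> M"
    unfolding bounded_iff by (elim exE)
  then have M: "cmod (g (u, v)) \<le> M" if "u \<in> cball 0 (2 * d)" "v \<in> cball v0 d" for u v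
    using that by auto
  define C where "C = fact r * M / (d / 2) ^ r"
  have gC: "cmod (g (u, v)) \<le> C * cmod u ^ r" if "cmod u < d" "v \<in> ball v0 d" for u v
    unfolding C_def
    by (rule holomorphic_zero_order_bound[of "?G v"]) (use holG M low r d that in auto)
  have g2C: "cmod (grad g (u, w) $ 2) \<le> C * cmod u ^ r / q" if u: "cmod u < d" for u
    unfolding grad_slice
  proof (rule deriv_bound[OF holo_slice_v[OF holo(3)] _ q(1)])
    show "cball w q \<subseteq> {v. (u, v) \<in> Bal}"
    proof
      fix x assume "x \<in> cball w q"
      then have "x \<in> cball v0 d" using q(2) ball_subset_cball by blast
      then have "(u, x) \<in> cball 0 (2 * d) \<times> cball v0 d" using u d(1) by auto
      then show "x \<in> {v. (u, v) \<in> Bal}" using polyd by blast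
    qed
    show "cmod (g (u, v)) \<le> C * cmod u ^ r" if "v \<in> cball w q" for v
      using gC u that q by blast
  qed
  \<comment> \<open>After division by \<open>u ^ n\<close> with \<open>n = r - 1\<close>, both
    \<open>g\<close> and its derivative in \<open>v\<close> tend to 0, while its derivative in
    \<open>u\<close> tends to \<open>r * h 0\<close>; a single term of the wedge product
    survives.\<close>
  obtain n where n: "r = Suc n" using r gr0_implies_Suc by blast
  have evd: "\<forall>\<^sub>F u in at (0::complex). cmod u < d \<and> u \<in> ball 0 s \<and> u \<noteq> 0"
    unfolding eventually_at using d(1) hs(1)
    by (intro exI[of _ "min d s"]) (auto simp: dist_norm)
  have id0: "((\<lambda>u. cmod u) \<longlongrightarrow> 0) (at (0::complex))"
    by (simp add: tendsto_norm_zero_iff tendsto_ident_at)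
  have small: "((\<lambda>u. F u / u ^ n) \<longlongrightarrow> 0) (at 0)"
    if F: "\<And>u. cmod u < d \<Longrightarrow> cmod (F u) \<le> D * cmod u ^ r" for F :: "complex \<Rightarrow> complex" and D
  proof (rule Lim_null_comparison)
    show "\<forall>\<^sub>F u in at 0. cmod (F u / u ^ n) \<le> D * cmod u"
      using evd
    proof eventually_elim
      case (elim u)
      then have "cmod (F u) \<le> D * cmod u * cmod u ^ n" using F[of u] by (simp add: n mult_ac)
      then show ?case using elim by (simp add: norm_divide norm_power divide_le_eq)
    qed
    show "((\<lambda>u. D * cmod u) \<longlongrightarrow> 0) (at 0)"
      using tendsto_mult_left[OF id0, of D] by simp
  qed
  have lim_g: "((\<lambda>u. g (u, w) / u ^ n) \<longlongrightarrow> 0) (at 0)"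
    using gC w by (intro small[of _ C]) auto
  have lim_g2: "((\<lambda>u. grad g (u, w) $ 2 / u ^ n) \<longlongrightarrow> 0) (at 0)"
    using g2C by (intro small[of _ "C / q"]) auto
  have lim_g1: "((\<lambda>u. grad g (u, w) $ 1 / u ^ n) \<longlongrightarrow> of_nat r * h 0) (at 0)"
  proof -
    have hc: "isCont h 0" "isCont (deriv h) 0"
      using hs holomorphic_deriv[OF hs(2)] holomorphic_on_imp_continuous_on
        continuous_on_eq_continuous_at[OF open_ball[of 0 s]] by (metis centre_in_ball open_ball)+
    have "((\<lambda>u. of_nat r * h u + u * deriv h u) \<longlongrightarrow> of_nat r * h 0 + 0 * deriv h 0) (at 0)"
      using hc by (intro tendsto_intros) (auto simp: isCont_def)
    moreover have "\<forall>\<^sub>F u in at 0. of_nat r * h u + u * deriv h u = grad g (u, w) $ 1 / u ^ n"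
      using evd
    proof eventually_elim
      case (elim u)
      have dh: "(h has_field_derivative deriv h u) (at u)"
        using elim holomorphic_derivI[OF hs(2) open_ball] by blast
      have "((\<lambda>u. u ^ r) has_field_derivative of_nat r * u ^ n) (at u)"
        using DERIV_power[OF DERIV_ident, where n = r and x = u and s = UNIV] by (simp add: n)
      from DERIV_mult[OF this dh]
      have "((\<lambda>u. u ^ r * h u) has_field_derivative (of_nat r * u ^ n * h u + u ^ r * deriv h u)) (at u)"
        by (simp add: mult_ac)
      then have "((\<lambda>u. g (u, w)) has_field_derivative (of_nat r * u ^ n * h u + u ^ r * deriv h u)) (at u)"
        by (rule has_field_derivative_transform_within_open[OF _ open_ball[of 0 s]]) (use elim Gw in auto)
      then have "grad g (u, w) $ 1 = of_nat r * u ^ n * h u + u ^ r * deriv h u"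
        by (simp add: grad_slice DERIV_imp_deriv)
      then show ?case using elim by (simp add: n field_simps)
    qed
    ultimately show ?thesis by (simp add: tendsto_cong)
  qed
  let ?A = "\<lambda>b. f0 b *s grad f1 b - f1 b *s grad f0 b"
  let ?B = "\<lambda>b. f0 b *s grad g b - g b *s grad f0 b"
  have split: "wedge (?A b) (?B b) / x = ?A b $ 1 * (f0 b * (grad g b $ 2 / x) - (g b / x) * grad f0 b $ 2)
     - ?A b $ 2 * (f0 b * (grad g b $ 1 / x) - (g b / x) * grad f0 b $ 1)" for b x
    by (simp add: wedge_def diff_divide_distrib[symmetric] right_diff_distrib[symmetric]
        times_divide_eq_right[symmetric] del: times_divide_eq_right)
       (simp add: diff_divide_distrib right_diff_distrib)
  have lim: "((\<lambda>u. wedge (?A (u, w)) (?B (u, w)) / u ^ n) \<longlongrightarrow>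
     ?A (0, w) $ 1 * (f0 (0, w) * 0 - 0 * grad f0 (0, w) $ 2)
     - ?A (0, w) $ 2 * (f0 (0, w) * (of_nat r * h 0) - 0 * grad f0 (0, w) $ 1)) (at 0)"
    unfolding split vector_minus_component vector_smult_component
    by (intro tendsto_diff tendsto_mult lim_g lim_g1 lim_g2 slice_tendsto grad_1_tendsto
        grad_2_tendsto holo wB)
  have wN: "k (0, w) \<noteq> 0" "f0 (0, w) \<noteq> 0" "?A2 w \<noteq> 0"
    using w(1) e0(2) d by (auto simp: subset_iff)
  then have "?A (0, w) $ 2 \<noteq> 0" by (simp add: grad_slice)
  moreover have "h 0 \<noteq> 0" using hs by simp
  ultimately have "\<forall>\<^sub>F u in at 0. wedge (?A (u, w)) (?B (u, w)) / u ^ n \<noteq> 0"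
    using wN r by (intro tendsto_imp_eventually_ne[OF lim]) simp
  moreover have "\<forall>\<^sub>F u in at 0. k (u, w) \<noteq> 0"
    by (rule tendsto_imp_eventually_ne[OF slice_tendsto[OF holo(4) wB] wN(1)])
  ultimately have "\<forall>\<^sub>F u in at 0. k (u, w) \<noteq> 0 \<and> wedge (?A (u, w)) (?B (u, w)) / u ^ n \<noteq> 0 \<and>
      (cmod u < d \<and> u \<in> ball 0 s \<and> u \<noteq> 0)"
    using evd by eventually_elim blast
  then obtain u where u: "k (u, w) \<noteq> 0" "wedge (?A (u, w)) (?B (u, w)) / u ^ n \<noteq> 0"
    "cmod u < d" "u \<in> ball 0 s" "u \<noteq> 0"
    using eventually_happens trivial_limit_at by blast
  show thesis
  proof (rule that[of "(u, w)"])
    show "(u, w) \<in> Bal" using polyd u w d by auto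
    show "g (u, w) \<noteq> 0" using Gw[OF u(4)] hs(4)[OF u(4)] u(5) by simp
  qed (use u in auto)
qed

section \<open>The interchange of two cusps, and constant terms as limits\<close>

lemma mat_one_cong: "mat 1 \<in> Gam1_cong"
  using lower_mat_cong[of 0]
  by (auto simp: lower_mat_def mat3_one Gam1_cong_def Gam1_def det_3 dest: Gam_congD)

lemma swap_induces:
  assumes "e = 1 \<or> e = - 1"
  shows "induces e swap_mat (Transposition.transpose 1 2)"
proof -
  have r: "rho + (rho^2 - 1 + (1 - rho)) = rho^2" "rho * rho^2 = 1" "rho^2 - 1 + 1 = rho^2"
    using rho_cube by (simp_all add: eval_nat_numeral)
  have U: "swap_mat *v vector [rho, 1, e] = - rho *s (unip_mat e *v vector [rho, 1, e])"
    if "e = 1 \<or> e = - 1" for e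
  proof -
    have "unip_mat e *v vector [rho, 1, e] = vector [rho^2, 1, rho^2 * e]"
      using that by (auto simp: unip_mat_def mat3_vec vec_eq_iff forall_3 algebra_simps)
    then show ?thesis
      using r(2) by (simp add: swap_mat_def mat3_vec vec_eq_iff forall_3 mult.assoc[symmetric])
  qed
  have U': "unip_mat e \<in> Gam1_cong" "unip_mat (- e) \<in> Gam1_cong"
    using unip_mat_cong assms by auto
  have "- rho \<noteq> 0" using rho_cube by auto
  have "\<exists>h\<in>Gam1_cong. \<exists>t. t \<noteq> 0 \<and>
      swap_mat *v cusp e i = t *s (h *v cusp e (Transposition.transpose 1 2 i))" if i: "i \<in> {1..4}" for i
  proof -
    consider "i = 1" | "i = 2" | "i = 3" | "i = 4" using i unfolding atLeastAtMost_iff by linarith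
    then show ?thesis
    proof cases
      case 1
      then show ?thesis
        by (intro bexI[OF _ mat_one_cong] exI[of _ "- 1"])
           (simp add: cusp_def swap_mat_def mat3_vec vec_eq_iff forall_3)
    next
      case 2
      then show ?thesis
        by (intro bexI[OF _ mat_one_cong] exI[of _ "- 1"])
           (simp add: cusp_def swap_mat_def mat3_vec vec_eq_iff forall_3)
    next
      case 3
      then show ?thesis using \<open>- rho \<noteq> 0\<close> U[OF assms]
        by (intro bexI[OF _ U'(1)] exI[of _ "- rho"]) (simp add: cusp_def)
    next
      case 4
      then show ?thesis using \<open>- rho \<noteq> 0\<close> U[of "- e"] assms
        by (intro bexI[OF _ U'(2)] exI[of _ "- rho"]) (auto simp: cusp_def)
    qed
  qed
  then show ?thesis by (simp add: induces_def)
qed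

text \<open>The points with \<open>u = 0\<close> and \<open>v = - (n + 1)\<close> run to the cusp
  \<open>(1:0:0)\<close>. There the expansion variable tends to 0 through non-zero values, and a
  power series is continuous at 0. The successor keeps out \<open>v = 0\<close>, which is not in the
  ball.\<close>

lemma constant_term_tendsto:
  assumes "has_constant_term f t"
  shows "(\<lambda>n. f (0, - of_nat (Suc n))) \<longlonglongrightarrow> t"
proof -
  obtain c where c: "fourier_jacobi f c" "\<And>u. c 0 u = t"
    using assms by (auto simp: has_constant_term_def)
  define E where "E v = exp (2 * complex_of_real pi * v / complex_of_real (sqrt 3))" for v
  have S: "(\<lambda>n. c n 0 * E v ^ n) sums f (0, v)" if "Re v < 0" for v
    using c(1) that unfolding fourier_jacobi_def E_def by (auto simp: Bal_def)
  define F where "F x = (\<Sum>n. c n 0 * x ^ n)" for x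
  have "cmod (E (- 1)) > 0" by (simp add: E_def)
  moreover have "(\<lambda>n. c n 0 * x ^ n) sums F x" if "cmod x < cmod (E (- 1))" for x
    unfolding F_def using S[of "- 1"] that
    by (intro summable_sums powser_inside[OF sums_summable]) auto
  ultimately have "(F \<longlongrightarrow> c 0 0) (at 0)" by (rule powser_limit_0)
  moreover have "filterlim (\<lambda>n. E (- of_nat (Suc n))) (at 0) sequentially"
  proof -
    have "(\<lambda>n. norm (E (- of_nat (Suc n)))) \<longlonglongrightarrow> 0"
    proof -
      have "norm (E (- of_nat (Suc n))) = exp (- (2 * pi / sqrt 3)) ^ Suc n" for n
        unfolding E_def norm_exp_eq_Re exp_of_nat_mult[symmetric] by (simp add: field_simps)
      moreover have "(\<lambda>n. exp (- (2 * pi / sqrt 3)) ^ Suc n) \<longlonglongrightarrow> 0"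
        by (intro LIMSEQ_Suc LIMSEQ_realpow_zero) auto
      ultimately show ?thesis by simp
    qed
    then have "(\<lambda>n. E (- of_nat (Suc n))) \<longlonglongrightarrow> 0" by (rule tendsto_norm_zero_cancel)
    then show ?thesis by (simp add: filterlim_at E_def)
  qed
  ultimately have "(\<lambda>n. F (E (- of_nat (Suc n)))) \<longlonglongrightarrow> c 0 0" by (rule filterlim_compose)
  moreover have "F (E (- of_nat (Suc n))) = f (0, - of_nat (Suc n))" for n
    unfolding F_def using S[of "- of_nat (Suc n)"] by (intro sums_unique[symmetric]) simp
  ultimately show ?thesis using c(2) by simp
qed

section \<open>The mirror \<open>u = 0\<close> of the reflection\<close>

definition mirror_zero :: "(pt \<Rightarrow> complex) \<Rightarrow> bool" where
  "mirror_zero f \<longleftrightarrow> (\<forall>v. (0, v) \<in> Bal \<longrightarrow> f (0, v) = 0)"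

lemma mirror_Bal: "(0, v) \<in> Bal \<longleftrightarrow> Re v < 0"
  by (simp add: Bal_def)

lemma open_mirror: "open {v. (0, v) \<in> Bal}" and connected_mirror: "connected {v. (0, v) \<in> Bal}"
  using open_line[of 0 0 0 1] convex_connected[OF convex_line[of 0 0 0 1]] by simp_all

lemma mirror_zero_mult:
  assumes "holo f" "holo h" "mirror_zero (\<lambda>b. f b * h b)"
  shows "mirror_zero f \<or> mirror_zero h"
  using holomorphic_mult_eq_0[OF holo_slice_v[OF assms(1)] holo_slice_v[OF assms(2)] open_mirror connected_mirror]
    assms(3) unfolding mirror_zero_def by blast

lemma not_mirror_zero_mult:
  "holo f \<and> \<not> mirror_zero f \<Longrightarrow> holo h \<and> \<not> mirror_zero h \<Longrightarrow>
    holo (\<lambda>b. f b * h b) \<and> \<not> mirror_zero (\<lambda>b. f b * h b)"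
  using mirror_zero_mult holo_mult by blast

lemma not_mirror_zero:
  assumes "has_constant_term f 1"
  shows "\<not> mirror_zero f"
proof
  assume "mirror_zero f"
  then have "(\<lambda>n. f (0, - of_nat (Suc n))) = (\<lambda>_. 0)"
    by (auto simp: mirror_zero_def mirror_Bal)
  then show False
    using constant_term_tendsto[OF assms] LIMSEQ_unique[of "\<lambda>_. 0 :: complex" 1 0] by simp
qed

text \<open>A vanishing Wronskian makes \<open>h / f\<close> constant on a disc without zeros of
  \<open>f\<close>, hence \<open>h = c * f\<close> on the whole mirror. Towards the cusp both
  functions tend to 1, so \<open>c = 1\<close>.\<close>

lemma mirror_wronskian:
  assumes f: "holo f" "has_constant_term f 1" and h: "holo h" "has_constant_term h 1"
    and W: "\<And>v. (0, v) \<in> Bal \<Longrightarrow> f (0, v) * deriv (\<lambda>v. h (0, v)) v - h (0, v) * deriv (\<lambda>v. f (0, v)) v = 0"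
  shows "mirror_zero (\<lambda>b. h b - f b)"
proof -
  let ?H = "{v. (0, v) \<in> Bal}" and ?f = "\<lambda>v. f (0, v)" and ?h = "\<lambda>v. h (0, v)"
  have hol: "?f holomorphic_on ?H" "?h holomorphic_on ?H" using holo_slice_v f h by auto
  obtain v0 where v0: "v0 \<in> ?H" "?f v0 \<noteq> 0"
    using not_mirror_zero[OF f(2)] by (auto simp: mirror_zero_def)
  have "open {v\<in>?H. ?f v \<noteq> 0}"
    by (rule open_nonzero[OF holomorphic_on_imp_continuous_on[OF hol(1)] open_mirror])
  then obtain s where s: "0 < s" "ball v0 s \<subseteq> {v\<in>?H. ?f v \<noteq> 0}"
    using v0 open_contains_ball by (metis (mono_tags, lifting) mem_Collect_eq)
  have D: "((\<lambda>v. ?h v / ?f v) has_field_derivative 0) (at v)" if v: "v \<in> ball v0 s" for v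
  proof -
    have vH: "v \<in> ?H" "?f v \<noteq> 0" using v s by auto
    have "((\<lambda>v. ?h v / ?f v) has_field_derivative
       (deriv ?h v * ?f v - ?h v * deriv ?f v) / (?f v * ?f v)) (at v)"
      by (rule DERIV_divide[OF holomorphic_derivI[OF hol(2) open_mirror vH(1)]
            holomorphic_derivI[OF hol(1) open_mirror vH(1)] vH(2)])
    then show ?thesis using W[of v] vH by (simp add: mult.commute)
  qed
  have "\<exists>c. \<forall>v\<in>ball v0 s. ?h v / ?f v = c"
    by (rule has_field_derivative_zero_constant[OF convex_ball])
       (rule has_field_derivative_at_within[OF D])
  then obtain c where c: "\<And>v. v \<in> ball v0 s \<Longrightarrow> ?h v / ?f v = c" by blast
  have lim: "v0 islimpt ball v0 s" using s by (intro open_imp_islimpt) auto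
  have eq: "?h v - c * ?f v = 0" if "v \<in> ?H" for v
  proof (rule analytic_continuation[OF _ open_mirror connected_mirror _ v0(1) lim _ that])
    show "(\<lambda>v. ?h v - c * ?f v) holomorphic_on ?H" using hol by (intro holomorphic_intros)
    show "?h z - c * ?f z = 0" if "z \<in> ball v0 s" for z
      using c[OF that] s that by (auto simp: field_simps)
  qed (use s in auto)
  then have "(\<lambda>n. h (0, - of_nat (Suc n))) = (\<lambda>n. c * f (0, - of_nat (Suc n)))"
    by (auto simp: mirror_Bal)
  moreover have "(\<lambda>n. c * f (0, - of_nat (Suc n))) \<longlonglongrightarrow> c * 1"
    by (intro tendsto_intros constant_term_tendsto f)
  ultimately have "c = 1"
    using constant_term_tendsto[OF h(2)] LIMSEQ_unique by fastforce
  then show ?thesis using eq by (simp add: mirror_zero_def)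
qed

section \<open>The numerators \<open>\<zeta>^2 * E\<close> of the two Eisenstein series\<close>

definition form1 :: "(pt \<Rightarrow> complex) \<Rightarrow> (pt \<Rightarrow> complex) \<Rightarrow> (pt \<Rightarrow> complex) \<Rightarrow> pt \<Rightarrow> complex^2" where
  "form1 f0 f1 f2 b = (f0 b * (f1 b - f0 b)) *s Phi f1 f2 b - (f2 b * (f2 b - f1 b)) *s Phi f0 f1 b"

definition form2 :: "(pt \<Rightarrow> complex) \<Rightarrow> (pt \<Rightarrow> complex) \<Rightarrow> (pt \<Rightarrow> complex) \<Rightarrow> pt \<Rightarrow> complex^2" where
  "form2 f0 f1 f2 b = (f0 b * (f0 b - f1 b) * (f0 b + f1 b - 3 * f2 b)) *s Phi f1 f2 b
     - (f2 b * (f1 b - f2 b) * (f1 b + f2 b - 3 * f0 b)) *s Phi f0 f1 b"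

lemma wedge_lincomb: "wedge (a *s X - b *s Y) (c *s X - d *s Y) = (b * c - a * d) * wedge X Y"
  by (simp add: wedge_def algebra_simps)

text \<open>With \<open>A = f0 * grad f1 - f1 * grad f0\<close> and \<open>B\<close> the same for
  \<open>f2\<close>, the bracket of \<open>f1\<close> and \<open>f2\<close> times \<open>f0\<close>
  is \<open>(f1 * B - f2 * A) / 3\<close>, and that of \<open>f0\<close> and \<open>f1\<close> is
  \<open>A / 3\<close>. Replacing \<open>B\<close> by \<open>B - A\<close> keeps the wedge product
  with \<open>A\<close> and brings in \<open>f2 - f1\<close>, which will be the function vanishing
  on the mirror.\<close>

lemma Phi_wedge:
  "f0 b * wedge (Phi f1 f2 b) (Phi f0 f1 b) = - (f1 b / (9 * (6 * complex_of_real pi * \<i>)^2)) *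
     wedge (f0 b *s grad f1 b - f1 b *s grad f0 b)
       (f0 b *s (grad f2 b - grad f1 b) - (f2 b - f1 b) *s grad f0 b)"
proof -
  define K where "K = - (1 / (6 * complex_of_real pi * \<i>))"
  have K: "1 / (9 * (6 * complex_of_real pi * \<i>)^2) = K * K / 9"
    by (simp add: K_def power2_eq_square)
  have "f0 b * wedge (Phi f1 f2 b) (Phi f0 f1 b) = - f1 b * (K * K / 9) *
     wedge (f0 b *s grad f1 b - f1 b *s grad f0 b)
       (f0 b *s (grad f2 b - grad f1 b) - (f2 b - f1 b) *s grad f0 b)"
    unfolding Phi_def bracket_def K_def[symmetric]
    by (simp add: wedge_def field_simps)
  then show ?thesis unfolding K[symmetric] by simp
qed

text \<open>The determinant of the coefficients of the two brackets is
  \<open>4 * f0 * f2 * (f1 - f0) * (f2 - f0) * (f2 - f1)\<close>; the part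
  \<open>4 * (f2 - f0)\<close> is \<open>(f1 + f2 - 3 * f0) - (f0 + f1 - 3 * f2)\<close>. The factor
  \<open>f1\<close> comes from \<open>Phi_wedge\<close>.\<close>

lemma wedge_forms:
  "f0 b * wedge (form1 f0 f1 f2 b) (form2 f0 f1 f2 b) =
     - (4 / (9 * (6 * complex_of_real pi * \<i>)^2)) *
     (f0 b * f1 b * f2 b * (f1 b - f0 b) * (f2 b - f0 b) * (f2 b - f1 b)) *
     wedge (f0 b *s grad f1 b - f1 b *s grad f0 b)
       (f0 b *s (grad f2 b - grad f1 b) - (f2 b - f1 b) *s grad f0 b)"
proof -
  have "wedge (form1 f0 f1 f2 b) (form2 f0 f1 f2 b) =
      4 * (f0 b * f2 b * (f1 b - f0 b) * (f2 b - f0 b) * (f2 b - f1 b)) * wedge (Phi f1 f2 b) (Phi f0 f1 b)"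
    unfolding form1_def form2_def wedge_lincomb
    by (rule arg_cong[where f = "\<lambda>x. x * _"]) (simp add: algebra_simps)
  then have "f0 b * wedge (form1 f0 f1 f2 b) (form2 f0 f1 f2 b) =
      4 * (f0 b * f2 b * (f1 b - f0 b) * (f2 b - f0 b) * (f2 b - f1 b)) *
        (f0 b * wedge (Phi f1 f2 b) (Phi f0 f1 b))"
    by (simp only: mult_ac)
  then show ?thesis unfolding Phi_wedge by (simp add: mult_ac)
qed

locale picard_S4 = picard +
  fixes e :: complex and x :: "nat \<Rightarrow> pt \<Rightarrow> complex"
  assumes cusp_order: "e = 1 \<or> e = - 1"
    and phi_const: "has_constant_term \<phi>0 1" "has_constant_term \<phi>1 1" "has_constant_term \<phi>2 1"
    and x1: "x 1 = (\<lambda>b. \<phi>0 b + \<phi>1 b + \<phi>2 b)"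
    and x2: "x 2 = (\<lambda>b. - 3 * \<phi>0 b + \<phi>1 b + \<phi>2 b)"
    and x3: "x 3 = (\<lambda>b. \<phi>0 b - 3 * \<phi>1 b + \<phi>2 b)"
    and x4: "x 4 = (\<lambda>b. \<phi>0 b + \<phi>1 b - 3 * \<phi>2 b)"
    and S4_x: "\<And>\<sigma> g i b. \<sigma> permutes {1..4} \<Longrightarrow> g \<in> Gam1 \<Longrightarrow> induces e g \<sigma> \<Longrightarrow> i \<in> {1..4} \<Longrightarrow>
        b \<in> Bal \<Longrightarrow> slash0 3 (x i) (matrix_inv g) b = of_int (sign \<sigma>) * x (\<sigma> i) b"
begin

lemma x_act:
  assumes "\<sigma> permutes {1..4}" "g \<in> Gam1" "induces e g \<sigma>" "i \<in> {1..4}" "b \<in> Bal"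
  shows "x i (act (matrix_inv g) b) = j1 (matrix_inv g) b ^ 3 * (of_int (sign \<sigma>) * x (\<sigma> i) b)"
proof -
  have "matrix_inv g \<in> Gam" using assms(2) Gam_inverse by (simp add: Gam1_def)
  then show ?thesis using S4_x[OF assms] slash0_eq_iff[of "matrix_inv g" b 3] assms(5) by simp
qed

lemma phi_x:
  "\<phi>0 b = (x 1 b - x 2 b) / 4" "\<phi>1 b = (x 1 b - x 3 b) / 4" "\<phi>2 b = (x 1 b - x 4 b) / 4"
  by (simp_all add: x1 x2 x3 x4 del: One_nat_def)

text \<open>\<open>swap_mat\<close> acts on the mirror with automorphy factor \<open>- v\<close>,
  and the sign of \<open>(- v) ^ 3\<close> cancels that of the transposition. As \<open>x 1\<close>
  and \<open>x 2\<close> are interchanged, \<open>\<phi>1 = (x 1 - x 3) / 4\<close> turns into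
  \<open>(x 2 - x 3) / 4 = \<phi>1 - \<phi>0\<close>, and likewise for
  \<open>\<phi>2\<close>.\<close>

lemma mirror_inversion:
  assumes "(0, v) \<in> Bal"
  shows "(0, 1 / v) \<in> Bal" "\<phi>1 (0, 1 / v) = v ^ 3 * (\<phi>1 (0, v) - \<phi>0 (0, v))"
    "\<phi>2 (0, 1 / v) = v ^ 3 * (\<phi>2 (0, v) - \<phi>0 (0, v))"
proof -
  let ?\<tau> = "Transposition.transpose 1 2 :: nat \<Rightarrow> nat"
  have perm: "?\<tau> permutes {1..4}" by (rule permutes_swap_id) auto
  have sgn: "sign ?\<tau> = - 1" by (simp add: sign_swap_id)
  have act: "act swap_mat (0, v) = (0, 1 / v)" "j1 swap_mat (0, v) = - v"
    by (simp_all add: act_def j1_def swap_mat_def)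
  show "(0, 1 / v) \<in> Bal"
    using act_Bal[of swap_mat "(0, v)"] swap_mat_Gam1 assms act by (simp add: Gam1_def)
  have "x i (0, 1 / v) = v ^ 3 * x (?\<tau> i) (0, v)" if "i \<in> {1..4}" for i
    using x_act[OF perm swap_mat_Gam1 swap_induces[OF cusp_order] that assms]
    by (simp add: swap_mat_inverse act sgn del: One_nat_def)
  from this[of 1] this[of 2] this[of 3] this[of 4]
  have "x 1 (0, 1 / v) = v ^ 3 * x 2 (0, v)" "x 3 (0, 1 / v) = v ^ 3 * x 3 (0, v)"
    "x 4 (0, 1 / v) = v ^ 3 * x 4 (0, v)" by simp_all
  then show "\<phi>1 (0, 1 / v) = v ^ 3 * (\<phi>1 (0, v) - \<phi>0 (0, v))"
    "\<phi>2 (0, 1 / v) = v ^ 3 * (\<phi>2 (0, v) - \<phi>0 (0, v))"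
    by (simp_all add: phi_x field_simps)
qed

text \<open>If the difference vanished on the mirror, then \<open>f\<close> would vanish at every
  \<open>1 / v\<close> by \<open>mirror_inversion\<close>, hence on the whole mirror, against its
  constant term 1.\<close>

lemma mirror_phi_ne: "\<not> mirror_zero (\<lambda>b. \<phi>1 b - \<phi>0 b)" "\<not> mirror_zero (\<lambda>b. \<phi>2 b - \<phi>0 b)"
proof -
  have "\<not> mirror_zero (\<lambda>b. f b - \<phi>0 b)"
    if f: "has_constant_term f 1"
      "\<And>v. (0, v) \<in> Bal \<Longrightarrow> f (0, 1 / v) = v ^ 3 * (f (0, v) - \<phi>0 (0, v))" for f
  proof
    assume z: "mirror_zero (\<lambda>b. f b - \<phi>0 b)"
    have "f (0, v) = 0" if v: "(0, v) \<in> Bal" for v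
      using f(2)[OF mirror_inversion(1)[OF v]] z mirror_inversion(1)[OF v] v
      by (auto simp: mirror_zero_def mirror_Bal)
    then show False using not_mirror_zero[OF f(1)] by (simp add: mirror_zero_def)
  qed
  then show "\<not> mirror_zero (\<lambda>b. \<phi>1 b - \<phi>0 b)" "\<not> mirror_zero (\<lambda>b. \<phi>2 b - \<phi>0 b)"
    using phi_const(2,3) mirror_inversion(2,3) by blast+
qed

lemma mirror_factor:
  "holo (\<lambda>b. \<phi>0 b * \<phi>1 b * \<phi>2 b * (\<phi>1 b - \<phi>0 b) * (\<phi>2 b - \<phi>0 b)) \<and>
    \<not> mirror_zero (\<lambda>b. \<phi>0 b * \<phi>1 b * \<phi>2 b * (\<phi>1 b - \<phi>0 b) * (\<phi>2 b - \<phi>0 b))"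
  by (intro not_mirror_zero_mult conjI phi_holo holo_diff mirror_phi_ne not_mirror_zero phi_const)

lemma rho_ne_1: "rho \<noteq> 1"
  by (simp add: rho_def complex_eq_iff)

text \<open>The reflection fixes the mirror pointwise with automorphy factor 1 and has determinant
  \<open>rho\<close>, so \<open>\<zeta> = rho * \<zeta>\<close> there.\<close>

lemma mirror_zeta: "mirror_zero \<zeta>"
  unfolding mirror_zero_def
proof (intro allI impI)
  fix v assume b: "(0, v) \<in> Bal"
  have "act refl_mat (0, v) = (0, v)" "j1 refl_mat (0, v) = 1"
    by (simp_all add: act_def j1_def refl_mat_def)
  then have "\<zeta> (0, v) = rho * \<zeta> (0, v)"
    using zeta_form refl_mat_cong b det_refl_mat by (force simp: M0_iff)
  then show "\<zeta> (0, v) = 0" using rho_ne_1 by (metis mult_cancel_right1 mult.commute)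
qed

lemma mirror_phi_eq: "mirror_zero (\<lambda>b. \<phi>2 b - \<phi>1 b)"
proof -
  have "mirror_zero (\<lambda>b. \<phi>0 b * \<phi>1 b * \<phi>2 b * (\<phi>1 b - \<phi>0 b) * (\<phi>2 b - \<phi>0 b) * (\<phi>2 b - \<phi>1 b))"
    using zeta_cube mirror_zeta kappa_nonzero unfolding mirror_zero_def \<kappa>_def by fastforce
  then show ?thesis
    using mirror_zero_mult[of "\<lambda>b. \<phi>0 b * \<phi>1 b * \<phi>2 b * (\<phi>1 b - \<phi>0 b) * (\<phi>2 b - \<phi>0 b)"
        "\<lambda>b. \<phi>2 b - \<phi>1 b"] mirror_factor holo_diff[OF phi_holo(3,2)] by blast
qed

text \<open>\<open>wedge_nonzero_near_curve\<close> is applied with \<open>\<phi>2 - \<phi>1\<close>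
  as the function vanishing on the mirror and the other five factors of \<open>\<zeta>^3\<close> as
  \<open>k\<close>. At the resulting point every factor in \<open>wedge_forms\<close> is
  non-zero.\<close>

lemma phi_jacobian:
  obtains b where "b \<in> Bal" "\<phi>0 b \<noteq> 0" "wedge (form1 \<phi>0 \<phi>1 \<phi>2 b) (form2 \<phi>0 \<phi>1 \<phi>2 b) \<noteq> 0"
proof -
  let ?k = "\<lambda>b. \<phi>0 b * \<phi>1 b * \<phi>2 b * (\<phi>1 b - \<phi>0 b) * (\<phi>2 b - \<phi>0 b)"
  let ?g = "\<lambda>b. \<phi>2 b - \<phi>1 b"
  have g0: "?g (0, v) = 0" if "(0, v) \<in> Bal" for v
    using mirror_phi_eq that unfolding mirror_zero_def by blast
  have gn: "\<exists>b\<in>Bal. ?g b \<noteq> 0"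
  proof (rule ccontr)
    assume "\<not> ?thesis"
    then have "([:- [:0, 1:], 1:] :: complex poly poly poly) = 0"
      by (intro ev3_phi_zero) (simp add: ev3_def)
    then show False by simp
  qed
  obtain v1 where v1: "(0, v1) \<in> Bal" "?k (0, v1) \<noteq> 0"
    using mirror_factor unfolding mirror_zero_def by blast
  obtain v2 where v2: "(0, v2) \<in> Bal" "\<phi>0 (0, v2) \<noteq> 0"
    using not_mirror_zero[OF phi_const(1)] unfolding mirror_zero_def by blast
  obtain v3 where v3: "(0, v3) \<in> Bal"
    "\<phi>0 (0, v3) * deriv (\<lambda>v. \<phi>1 (0, v)) v3 - \<phi>1 (0, v3) * deriv (\<lambda>v. \<phi>0 (0, v)) v3 \<noteq> 0"
    using mirror_wronskian[OF phi_holo(1) phi_const(1) phi_holo(2) phi_const(2)] mirror_phi_ne(1) by blast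
  have hol: "holo ?k" "holo ?g" by (intro holo_intros phi_holo)+
  obtain b where b: "b \<in> Bal" "?k b \<noteq> 0" "?g b \<noteq> 0"
    "wedge (\<phi>0 b *s grad \<phi>1 b - \<phi>1 b *s grad \<phi>0 b) (\<phi>0 b *s grad ?g b - ?g b *s grad \<phi>0 b) \<noteq> 0"
    by (rule wedge_nonzero_near_curve[of \<phi>0 \<phi>1 ?g ?k v1 v2 v3])
       (rule phi_holo hol gn v1 v2 v3 g0; assumption?)+
  have "has_grad ?g (grad \<phi>2 b $ 1 + - 1 * grad \<phi>1 b $ 1) (grad \<phi>2 b $ 2 + - 1 * grad \<phi>1 b $ 2) b"
    using has_grad_add[OF holo_has_grad[OF phi_holo(3) b(1)]
        has_grad_cmult[OF holo_has_grad[OF phi_holo(2) b(1)], of "- 1"]] by simp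
  then have "grad ?g b = grad \<phi>2 b - grad \<phi>1 b"
    by (simp add: grad_eq vec_eq_iff forall_2)
  then have "\<phi>0 b * wedge (form1 \<phi>0 \<phi>1 \<phi>2 b) (form2 \<phi>0 \<phi>1 \<phi>2 b) \<noteq> 0"
    unfolding wedge_forms using b by simp
  then show thesis using b by (intro that) auto
qed

end

section \<open>Transformation of the quotients\<close>

text \<open>The functions \<open>h0\<close>, \<open>h1\<close>, \<open>h2\<close> are the forms
  themselves for elements of the congruence subgroup and permuted forms for elements of
  \<open>Gam1\<close>. The weights are 7 for a bracket plus 6 or 9 for its coefficient.\<close>

lemma form_act:
  assumes g: "g \<in> Gam" and b: "b \<in> Bal"
    and h: "holo f0" "holo f1" "holo f2" "holo h0" "holo h1" "holo h2"
    and t: "\<And>b. b \<in> Bal \<Longrightarrow> f0 (act g b) = j1 g b ^ 3 * h0 b"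
      "\<And>b. b \<in> Bal \<Longrightarrow> f1 (act g b) = j1 g b ^ 3 * h1 b"
      "\<And>b. b \<in> Bal \<Longrightarrow> f2 (act g b) = j1 g b ^ 3 * h2 b"
  shows "form1 f0 f1 f2 (act g b) = j1 g b ^ 13 *s (j2 g b *v form1 h0 h1 h2 b)" (is ?thesis1)
    and "form2 f0 f1 f2 (act g b) = j1 g b ^ 16 *s (j2 g b *v form2 h0 h1 h2 b)" (is ?thesis2)
proof -
  define j where "j = j1 g b"
  have K: "c *s (j1 g b ^ 7 *s (j2 g b *v X)) = j ^ 7 *s (j2 g b *v (c *s X))" for c X
    by (simp add: j_def vector_scalar_commute vector_smult_assoc mult.commute)
  have B: "bracket 3 3 f1 f2 (act g b) = j1 g b ^ 7 *s (j2 g b *v bracket 3 3 h1 h2 b)"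
    "bracket 3 3 f0 f1 (act g b) = j1 g b ^ 7 *s (j2 g b *v bracket 3 3 h0 h1 b)"
    by (rule bracket_act; (rule g b h t; assumption?))+
  have P: "Phi f1 f2 (act g b) = j ^ 7 *s (j2 g b *v Phi h1 h2 b)"
    "Phi f0 f1 (act g b) = j ^ 7 *s (j2 g b *v Phi h0 h1 b)"
    unfolding Phi_def B by (rule K)+
  note T = t[OF b, folded j_def]
  have lin: "(j ^ m * x) *s (j ^ 7 *s (j2 g b *v X)) - (j ^ m * y) *s (j ^ 7 *s (j2 g b *v Y)) =
      j ^ (m + 7) *s (j2 g b *v (x *s X - y *s Y))" for m x y X Y
    by (simp add: matrix_vector_mult_diff_distrib vector_scalar_commute vector_smult_assoc
        vector_ssub_ldistrib power_add mult_ac)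
  have 1: "j ^ 3 * h0 b * (j ^ 3 * h1 b - j ^ 3 * h0 b) = j ^ 6 * (h0 b * (h1 b - h0 b))"
    "j ^ 3 * h2 b * (j ^ 3 * h2 b - j ^ 3 * h1 b) = j ^ 6 * (h2 b * (h2 b - h1 b))"
    by (simp_all add: algebra_simps flip: power_add)
  show ?thesis1
    unfolding form1_def P T 1 lin j_def[symmetric] by simp
  have nine: "j ^ 9 = j ^ 3 * j ^ 3 * j ^ 3" by (simp flip: power_add)
  have 2: "j ^ 3 * h0 b * (j ^ 3 * h0 b - j ^ 3 * h1 b) * (j ^ 3 * h0 b + j ^ 3 * h1 b - 3 * (j ^ 3 * h2 b))
      = j ^ 9 * (h0 b * (h0 b - h1 b) * (h0 b + h1 b - 3 * h2 b))"
    "j ^ 3 * h2 b * (j ^ 3 * h1 b - j ^ 3 * h2 b) * (j ^ 3 * h1 b + j ^ 3 * h2 b - 3 * (j ^ 3 * h0 b))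
      = j ^ 9 * (h2 b * (h1 b - h2 b) * (h1 b + h2 b - 3 * h0 b))"
    unfolding nine by (simp_all add: algebra_simps)
  show ?thesis2
    unfolding form2_def P T 2 lin j_def[symmetric] by simp
qed

lemma holo_j2: "holo (\<lambda>b. j2 g b $ i $ k)"
  using exhaust_2[of i] exhaust_2[of k]
  by (auto simp: j2_def case_prod_unfold intro!: holo_intros)

context picard
begin

definition zmult :: "complex^3^3 \<Rightarrow> complex \<Rightarrow> bool" where
  "zmult g s \<longleftrightarrow> (\<forall>b\<in>Bal. \<zeta> (act g b) = s * (j1 g b ^ 6 * \<zeta> b))"

lemma zmult_mult:
  assumes "g \<in> Gam" "h \<in> Gam" "zmult g s" "zmult h t"
  shows "zmult (g ** h) (s * t)"
  using assms act_Bal[OF assms(2)]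
  by (simp add: zmult_def act_mult[OF assms(1,2)] j1_cocycle[OF assms(1,2)] power_mult_distrib mult_ac)

lemma zmult_unique:
  assumes "g \<in> Gam" "zmult g s" "zmult g t"
  shows "s = t"
proof -
  obtain b where b: "b \<in> Bal" "\<zeta> b \<noteq> 0" using zeta_nonzero by blast
  have "s * (j1 g b ^ 6 * \<zeta> b) = t * (j1 g b ^ 6 * \<zeta> b)"
    using bspec[OF assms(2)[unfolded zmult_def] b(1)] bspec[OF assms(3)[unfolded zmult_def] b(1)]
    by (rule trans[OF sym])
  then show ?thesis using b j1_nonzero[OF assms(1) b(1)] by simp
qed

lemma zmult_cong: "g \<in> Gam_cong \<Longrightarrow> zmult g (det g)"
  using zeta_form by (simp add: zmult_def M0_iff mult_ac)

text \<open>The symmetric group acts through \<open>matrix_inv g\<close>, while permutations are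
  composed for \<open>g\<close> itself; this passes from one to the other.\<close>

lemma zmult_inverse:
  assumes g: "g \<in> Gam" and z: "zmult (matrix_inv g) s" and s: "s \<noteq> 0"
  shows "zmult g (1 / s)"
  unfolding zmult_def
proof
  fix b assume b: "b \<in> Bal"
  have "\<zeta> b = s * (j1 (matrix_inv g) (act g b) ^ 6 * \<zeta> (act g b))"
    using bspec[OF z[unfolded zmult_def] act_Bal[OF g b]] unfolding j1_inverse(1)[OF g b] .
  then have "j1 g b ^ 6 * \<zeta> b = s * ((j1 (matrix_inv g) (act g b) * j1 g b) ^ 6 * \<zeta> (act g b))"
    by (simp add: power_mult_distrib)
  then show "\<zeta> (act g b) = 1 / s * (j1 g b ^ 6 * \<zeta> b)"
    using s by (simp add: j1_inverse(2)[OF g b])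
qed

text \<open>Division of \<open>N\<close> by \<open>\<zeta>^2\<close>, which has weight 12 and
  multiplier \<open>s ^ 2\<close>; the factor \<open>\<zeta>^2\<close> is cancelled in each
  component.\<close>

lemma quotient_act:
  assumes g: "g \<in> Gam" and E: "vholo E" "\<And>b. b \<in> Bal \<Longrightarrow> \<zeta> b ^ 2 *s E b = N b"
    and z: "zmult g s" "s \<noteq> 0"
    and N: "\<And>b. b \<in> Bal \<Longrightarrow> N (act g b) = (t * j1 g b ^ (12 + m)) *s (j2 g b *v N b)"
    and b: "b \<in> Bal"
  shows "E (act g b) = (t / s ^ 2 * j1 g b ^ m) *s (j2 g b *v E b)"
proof -
  have "E (act g b) $ i = ((t / s ^ 2 * j1 g b ^ m) *s (j2 g b *v E b)) $ i" for i
  proof (rule holo_mult_cancel[OF holo_power[OF zeta_holo, of 2] _ _ _ _ b])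
    show "holo (\<lambda>b. E (act g b) $ i)" using holo_act[OF _ g, of "\<lambda>b. E b $ i"] E(1) by (simp add: vholo_def)
    show "holo (\<lambda>b. ((t / s ^ 2 * j1 g b ^ m) *s (j2 g b *v E b)) $ i)"
      unfolding vector_smult_component matrix_vector_mult_def vec_lambda_beta using E(1)
      by (intro holo_mult holo_const holo_power holo_j1 holo_sum holo_j2) (simp_all add: vholo_def)
    show "\<exists>b\<in>Bal. \<zeta> b ^ 2 \<noteq> 0" using zeta_nonzero by simp
    fix c assume c: "c \<in> Bal"
    have j: "j1 g c \<noteq> 0" by (rule j1_nonzero[OF g c])
    have "\<zeta> (act g c) ^ 2 *s E (act g c) = (t * j1 g c ^ (12 + m)) *s (j2 g c *v (\<zeta> c ^ 2 *s E c))"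
      using E(2)[OF act_Bal[OF g c]] E(2)[OF c] N[OF c] by simp
    moreover have "\<zeta> (act g c) ^ 2 = (s ^ 2 * j1 g c ^ 12) * \<zeta> c ^ 2"
      using z(1) c by (simp add: zmult_def power_mult_distrib flip: power_mult)
    ultimately have "((s ^ 2 * j1 g c ^ 12) * \<zeta> c ^ 2) *s E (act g c) =
        (t * j1 g c ^ (12 + m)) *s (j2 g c *v (\<zeta> c ^ 2 *s E c))" by simp
    then have "(s ^ 2 * j1 g c ^ 12) * (\<zeta> c ^ 2 * E (act g c) $ i) =
        (s ^ 2 * j1 g c ^ 12) * (\<zeta> c ^ 2 * ((t / s ^ 2 * j1 g c ^ m) *s (j2 g c *v E c)) $ i)"
      using z(2) by (auto simp: vec_eq_iff vector_scalar_commute vector_smult_assoc power_add field_simps)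
    then show "\<zeta> c ^ 2 * E (act g c) $ i = \<zeta> c ^ 2 * ((t / s ^ 2 * j1 g c ^ m) *s (j2 g c *v E c)) $ i"
      using z(2) j by (metis mult_cancel_left mult_eq_0_iff power_eq_0_iff)
  qed
  then show ?thesis by (simp add: vec_eq_iff)
qed

lemma phi_act:
  assumes "g \<in> Gam_cong" "b \<in> Bal"
  shows "\<phi>0 (act g b) = j1 g b ^ 3 * \<phi>0 b" "\<phi>1 (act g b) = j1 g b ^ 3 * \<phi>1 b"
    "\<phi>2 (act g b) = j1 g b ^ 3 * \<phi>2 b"
  using phi_form assms by (auto simp: M0_iff)

text \<open>The numerator has trivial character and \<open>\<zeta>\<close> has multiplier
  \<open>det g\<close>, so \<open>E\<close> has \<open>1 / det g ^ 2 = det g\<close>.\<close>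

lemma quotient_M1:
  assumes E: "off_zero E" "vholo E" "\<And>b. b \<in> Bal \<Longrightarrow> \<zeta> b ^ 2 *s E b = N b"
    and N: "\<And>g b. g \<in> Gam_cong \<Longrightarrow> b \<in> Bal \<Longrightarrow> N (act g b) = j1 g b ^ (12 + m) *s (j2 g b *v N b)"
  shows "E \<in> M1 1 (int m)"
  unfolding M1_iff
proof (intro conjI ballI E(1,2))
  fix g b assume g: "g \<in> Gam_cong" and b: "b \<in> Bal"
  have G: "g \<in> Gam" by (rule Gam_congD[OF g])
  have "1 / det g ^ 2 = det g"
    using Gam_cong_det_cube[OF g] Gam_det_nonzero[OF G] by (simp add: field_simps eval_nat_numeral)
  then show "E (act g b) = (j1 g b powi int m * det g ^ 1) *s (j2 g b *v E b)"
    using quotient_act[OF G E(2,3) zmult_cong[OF g] Gam_det_nonzero[OF G], of 1 m b] N[OF g] b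
    by (simp add: mult.commute)
qed

lemma form_M1:
  shows "off_zero E \<Longrightarrow> vholo E \<Longrightarrow> (\<And>b. b \<in> Bal \<Longrightarrow> \<zeta> b ^ 2 *s E b = form1 \<phi>0 \<phi>1 \<phi>2 b) \<Longrightarrow> E \<in> M1 1 1"
    and "off_zero E \<Longrightarrow> vholo E \<Longrightarrow> (\<And>b. b \<in> Bal \<Longrightarrow> \<zeta> b ^ 2 *s E b = form2 \<phi>0 \<phi>1 \<phi>2 b) \<Longrightarrow> E \<in> M1 1 4"
  using quotient_M1[of E "form1 \<phi>0 \<phi>1 \<phi>2" 1] quotient_M1[of E "form2 \<phi>0 \<phi>1 \<phi>2" 4]
    form_act[OF Gam_congD _ phi_holo phi_holo phi_act]
  by simp_all

end

text \<open>Values and gradients of the three forms at a point, as free variables.\<close>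

definition alg1 :: "complex \<Rightarrow> complex \<Rightarrow> complex \<Rightarrow> complex^2 \<Rightarrow> complex^2 \<Rightarrow> complex^2 \<Rightarrow> complex^2" where
  "alg1 a0 a1 a2 g0 g1 g2 =
     (a1 * a2 * (a2 - a1)) *s g0 + (a2 * a0 * (a0 - a2)) *s g1 + (a0 * a1 * (a1 - a0)) *s g2"

definition alg2 :: "complex \<Rightarrow> complex \<Rightarrow> complex \<Rightarrow> complex^2 \<Rightarrow> complex^2 \<Rightarrow> complex^2 \<Rightarrow> complex^2" where
  "alg2 a0 a1 a2 g0 g1 g2 = (a1 * a2 * (a1 - a2) * (a1 + a2 - 3 * a0)) *s g0
     + (a2 * a0 * (a2 - a0) * (a2 + a0 - 3 * a1)) *s g1 + (a0 * a1 * (a0 - a1) * (a0 + a1 - 3 * a2)) *s g2"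

definition alg0 :: "complex \<Rightarrow> complex \<Rightarrow> complex \<Rightarrow> complex" where
  "alg0 a0 a1 a2 = a0 * a1 * a2 * (a1 - a0) * (a2 - a0) * (a2 - a1)"

text \<open>The definitions use two of the three brackets and hide the symmetry; expanded in
  gradients, both forms are visibly alternating. The 18 is 6 times the weight 3 in the denominators
  of the bracket.\<close>

lemma form1_alg: "form1 f0 f1 f2 b = - (1 / (18 * complex_of_real pi * \<i>)) *s
    alg1 (f0 b) (f1 b) (f2 b) (grad f0 b) (grad f1 b) (grad f2 b)" (is ?A)
  and form2_alg: "form2 f0 f1 f2 b = - (1 / (18 * complex_of_real pi * \<i>)) *s
    alg2 (f0 b) (f1 b) (f2 b) (grad f0 b) (grad f1 b) (grad f2 b)" (is ?B)
proof -
  define K where "K = - (1 / (6 * complex_of_real pi * \<i>))"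
  have K: "- (1 / (18 * complex_of_real pi * \<i>)) = K / 3" by (simp add: K_def)
  note defs = Phi_def bracket_def alg1_def alg2_def form1_def form2_def K_def[symmetric]
  show ?A ?B
    unfolding K defs by (simp_all add: vec_eq_iff algebra_simps)
qed

text \<open>The symmetric group on four letters acts on the differences \<open>x\<^sub>1 - x\<^sub>j\<close>: the transpositions
  of two letters other than \<open>1\<close> permute them, and the transposition of \<open>1\<close> and \<open>j\<close> subtracts the
  \<open>j\<close>-th one from the others.\<close>

definition dif :: "(nat \<Rightarrow> 'a::minus) \<Rightarrow> nat \<Rightarrow> 'a" where
  "dif y j = y 1 - y j"

text \<open>Four identities generate everything: the transpositions among 2, 3, 4 permute the
  differences, the last identity is the transposition of 1 and 2, and those of 1 with 3 and with 4
  are its conjugates (\<open>A5\<close>, \<open>A6\<close>). Induction over transpositions does the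
  rest.\<close>

lemma alg_alternating:
  fixes A :: "complex \<Rightarrow> complex \<Rightarrow> complex \<Rightarrow> complex^2 \<Rightarrow> complex^2 \<Rightarrow> complex^2 \<Rightarrow> complex^2"
  assumes A: "\<And>a b c g h k. A b a c h g k = - A a b c g h k" "\<And>a b c g h k. A c b a k h g = - A a b c g h k"
    "\<And>a b c g h k. A a c b g k h = - A a b c g h k"
    "\<And>a b c g h k. A (- a) (b - a) (c - a) (- g) (h - g) (k - g) = - A a b c g h k"
  assumes "\<sigma> permutes {1..4}"
  shows "A (dif (y \<circ> \<sigma>) 2) (dif (y \<circ> \<sigma>) 3) (dif (y \<circ> \<sigma>) 4) (dif (z \<circ> \<sigma>) 2) (dif (z \<circ> \<sigma>) 3) (dif (z \<circ> \<sigma>) 4)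
    = of_int (sign \<sigma>) *s A (dif y 2) (dif y 3) (dif y 4) (dif z 2) (dif z 3) (dif z 4)"
proof -
  have A5: "A (a - b) (- b) (c - b) (g - h) (- h) (k - h) = - A a b c g h k" for a b c g h k
    using A(1)[of "a - b" "- b" "c - b" "g - h" "- h" "k - h"] A(4)[of b a c h g k] A(1)[of b a c h g k] by simp
  have A6: "A (a - c) (b - c) (- c) (g - k) (h - k) (- k) = - A a b c g h k" for a b c g h k
    using A(2)[of "a - c" "b - c" "- c" "g - k" "h - k" "- k"] A(4)[of c b a k h g] A(2)[of c b a k h g] by simp
  let ?A = "\<lambda>y z. A (dif y 2) (dif y 3) (dif y 4) (dif z 2) (dif z 3) (dif z 4)"
  let ?t = "Transposition.transpose :: nat \<Rightarrow> nat \<Rightarrow> nat \<Rightarrow> nat"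
  have tr: "?A (y \<circ> ?t a b) (z \<circ> ?t a b) = - ?A y z"
    if ab: "a \<in> {1..4}" "b \<in> {1..4}" "a < b" for a b and y :: "nat \<Rightarrow> complex" and z :: "nat \<Rightarrow> complex^2"
  proof -
    have "(a, b) \<in> {(1,2), (1,3), (1,4), (2,3), (2,4), (3,4)}" using ab by (auto simp: numeral_eq_Suc le_Suc_eq less_Suc_eq)
    moreover have d: "y p - y q = (y 1 - y q) - (y 1 - y p)" "z p - z q = (z 1 - z q) - (z 1 - z p)" for p q
      by simp_all
    have "?A (y \<circ> ?t 1 2) (z \<circ> ?t 1 2) = - ?A y z"
      using A(4)[of "y 1 - y 2" "y 1 - y 3" "y 1 - y 4" "z 1 - z 2" "z 1 - z 3" "z 1 - z 4"]
      by (simp add: dif_def Transposition.transpose_def)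
    moreover have "?A (y \<circ> ?t 1 3) (z \<circ> ?t 1 3) = - ?A y z"
      using A5[of "y 1 - y 2" "y 1 - y 3" "y 1 - y 4" "z 1 - z 2" "z 1 - z 3" "z 1 - z 4"]
      by (simp add: dif_def Transposition.transpose_def)
    moreover have "?A (y \<circ> ?t 1 4) (z \<circ> ?t 1 4) = - ?A y z"
      using A6[of "y 1 - y 2" "y 1 - y 4" "y 1 - y 3" "z 1 - z 2" "z 1 - z 4" "z 1 - z 3"]
      by (simp add: dif_def Transposition.transpose_def)
    moreover have "?A (y \<circ> ?t 2 3) (z \<circ> ?t 2 3) = - ?A y z"
      "?A (y \<circ> ?t 2 4) (z \<circ> ?t 2 4) = - ?A y z"
      "?A (y \<circ> ?t 3 4) (z \<circ> ?t 3 4) = - ?A y z"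
      using A(1-3)[of "y 1 - y 2" "y 1 - y 3" "y 1 - y 4" "z 1 - z 2" "z 1 - z 3" "z 1 - z 4"]
        A(1)[of "y 1 - y 3" "y 1 - y 2" "y 1 - y 4" "z 1 - z 3" "z 1 - z 2" "z 1 - z 4"]
      by (simp_all add: dif_def Transposition.transpose_def)
    ultimately show ?thesis by auto
  qed
  have tr': "?A (y \<circ> ?t a b) (z \<circ> ?t a b) = - ?A y z"
    if "a \<in> {1..4}" "b \<in> {1..4}" "a \<noteq> b" for a b and y :: "nat \<Rightarrow> complex" and z :: "nat \<Rightarrow> complex^2"
    using that tr[of a b y z] tr[of b a y z] by (cases "a < b") (auto simp: transpose_commute)
  have "finite {1..4::nat}" by simp
  from this assms(5) have "\<forall>y z. ?A (y \<circ> \<sigma>) (z \<circ> \<sigma>) = of_int (sign \<sigma>) *s ?A y z"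
  proof (induction rule: permutes_rev_induct)
    case id
    then show ?case by simp
  next
    case (swap a b p)
    show ?case
    proof (cases "a = b")
      case True
      then show ?thesis using swap by (simp add: comp_def)
    next
      case False
      have sgn: "sign (p \<circ> ?t a b) = - sign p"
        using False permutation_permutes[of p] swap by (subst sign_compose) (auto simp: sign_swap_id permutation_swap_id)
      have "?A (y \<circ> (p \<circ> ?t a b)) (z \<circ> (p \<circ> ?t a b)) =
          - ?A (y \<circ> p) (z \<circ> p)" for y :: "nat \<Rightarrow> complex" and z :: "nat \<Rightarrow> complex^2"
        using tr'[OF swap(1,2) False, of "y \<circ> p" "z \<circ> p"] by (simp only: o_assoc)
      then show ?thesis using swap.IH unfolding sgn by (simp del: o_apply add: vec_eq_iff)
    qed
  qed
  then show ?thesis by blast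
qed

lemma alg1_swaps:
  "alg1 b a c h g k = - alg1 a b c g h k" "alg1 c b a k h g = - alg1 a b c g h k"
  "alg1 a c b g k h = - alg1 a b c g h k"
  "alg1 (- a) (b - a) (c - a) (- g) (h - g) (k - g) = - alg1 a b c g h k"
  "alg1 (s * a) (s * b) (s * c) (s *s g) (s *s h) (s *s k) = s ^ 4 *s alg1 a b c g h k"
  by (simp_all add: alg1_def vec_eq_iff algebra_simps eval_nat_numeral)

lemma alg2_swaps:
  "alg2 b a c h g k = - alg2 a b c g h k" "alg2 c b a k h g = - alg2 a b c g h k"
  "alg2 a c b g k h = - alg2 a b c g h k"
  "alg2 (- a) (b - a) (c - a) (- g) (h - g) (k - g) = - alg2 a b c g h k"
  "alg2 (s * a) (s * b) (s * c) (s *s g) (s *s h) (s *s k) = s ^ 5 *s alg2 a b c g h k"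
  by (simp_all add: alg2_def vec_eq_iff algebra_simps eval_nat_numeral)

lemma alg0_swaps:
  "alg0 b a c = - alg0 a b c" "alg0 c b a = - alg0 a b c" "alg0 a c b = - alg0 a b c"
  "alg0 (- a) (b - a) (c - a) = - alg0 a b c" "alg0 (s * a) (s * b) (s * c) = s ^ 6 * alg0 a b c"
  by (simp_all add: alg0_def algebra_simps eval_nat_numeral)

lemma alg0_alternating:
  assumes "\<sigma> permutes {1..4}"
  shows "alg0 (dif (y \<circ> \<sigma>) 2) (dif (y \<circ> \<sigma>) 3) (dif (y \<circ> \<sigma>) 4) =
    of_int (sign \<sigma>) * alg0 (dif y 2) (dif y 3) (dif y 4)"
proof -
  \<comment> \<open>The scalar is packed into a constant vector so that the statement about
    vector-valued expressions applies.\<close>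
  have "(vec (alg0 (dif (y \<circ> \<sigma>) 2) (dif (y \<circ> \<sigma>) 3) (dif (y \<circ> \<sigma>) 4)) :: complex^2) =
      of_int (sign \<sigma>) *s vec (alg0 (dif y 2) (dif y 3) (dif y 4))"
  proof (rule alg_alternating[of "\<lambda>a b c _ _ _. vec (alg0 a b c)", OF _ _ _ _ assms])
    show "(vec (alg0 b a c) :: complex^2) = - vec (alg0 a b c)"
      "(vec (alg0 c b a) :: complex^2) = - vec (alg0 a b c)"
      "(vec (alg0 a c b) :: complex^2) = - vec (alg0 a b c)"
      "(vec (alg0 (- a) (b - a) (c - a)) :: complex^2) = - vec (alg0 a b c)" for a b c
      using alg0_swaps(1)[of b a c] alg0_swaps(2)[of c b a] alg0_swaps(3)[of a c b] alg0_swaps(4)[of a b c]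
      by (simp_all only: vec_eq_iff vec_component vector_uminus_component simp_thms)
  qed
  then show ?thesis by (simp add: vec_eq_iff)
qed

section \<open>The action of the symmetric group\<close>

lemma holo_mult3_zero:
  assumes "holo f" "holo h" "holo k" "\<And>b. b \<in> Bal \<Longrightarrow> f b * (h b * k b) = 0"
  shows "(\<forall>b\<in>Bal. f b = 0) \<or> (\<forall>b\<in>Bal. h b = 0) \<or> (\<forall>b\<in>Bal. k b = 0)"
proof -
  have two: "(\<forall>b\<in>Bal. f b = 0) \<or> (\<forall>b\<in>Bal. h b = 0)"
    if "holo f" "holo h" "\<And>b. b \<in> Bal \<Longrightarrow> f b * h b = 0" for f h
    using holo_mult_eq_0[OF that] by blast
  from two[OF assms(1) holo_mult[OF assms(2,3)] assms(4)] show ?thesis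
    using two[OF assms(2,3)] by blast
qed

section \<open>Permutations of the cusps modulo \<open>sqrtm3\<close>\<close>

definition cong3 :: "complex \<Rightarrow> complex \<Rightarrow> bool" where
  "cong3 a b \<longleftrightarrow> sq3_dvd (a - b)"

lemma cong3_refl [simp]: "cong3 a a"
  by (simp add: cong3_def)

lemma cong3_sym: "cong3 a b \<Longrightarrow> cong3 b a"
  unfolding cong3_def using sq3_dvd_uminus by fastforce

lemma cong3_trans: "cong3 a b \<Longrightarrow> cong3 b c \<Longrightarrow> cong3 a c"
  unfolding cong3_def using sq3_dvd_add[of "a - b" "b - c"] by simp

lemma cong3_add: "cong3 a b \<Longrightarrow> cong3 c d \<Longrightarrow> cong3 (a + c) (b + d)"
  unfolding cong3_def using sq3_dvd_add[of "a - b" "c - d"] by (simp add: algebra_simps)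

lemma cong3_diff: "cong3 a b \<Longrightarrow> cong3 c d \<Longrightarrow> cong3 (a - c) (b - d)"
  unfolding cong3_def using sq3_dvd_diff[of "a - b" "c - d"] by (simp add: algebra_simps)

lemma cong3_mult: "cong3 a b \<Longrightarrow> c \<in> O_F \<Longrightarrow> cong3 (c * a) (c * b)"
  unfolding cong3_def using sq3_dvd_mult[of "a - b" c] by (simp add: algebra_simps)

lemma cong3_matrix_vector:
  fixes g :: "complex^3^3"
  assumes "\<And>i k. g$i$k \<in> O_F" "\<And>k. cong3 (v$k) (w$k)"
  shows "cong3 ((g *v v)$k) ((g *v w)$k)"
  using assms by (simp add: matrix_vector_mult_def sum_3 cong3_add cong3_mult)

lemma cong3_signs:
  assumes "s = 1 \<or> s = - 1" "t = 1 \<or> t = - 1" "cong3 s t"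
  shows "s = t"
  using assms not_sq3_dvd_2 sq3_dvd_uminus[of "- 2"] by (auto simp: cong3_def)

lemma cusp_integral:
  assumes "e = 1 \<or> e = - 1"
  shows "cusp e i $ k \<in> O_F"
  using assms exhaust_3[of k] by (auto simp: cusp_def)

lemma cusp_one: "\<exists>k. cusp e i $ k = 1"
  by (auto simp: cusp_def intro: exI[of _ 1] exI[of _ 2])

text \<open>The action on the four isotropic points of the projective plane over the field with
  three elements, whose non-zero scalars are the signs \<open>s\<close>. In this form it is
  compatible with products by direct computation.\<close>

definition induces_mod :: "complex \<Rightarrow> complex^3^3 \<Rightarrow> (nat \<Rightarrow> nat) \<Rightarrow> bool" where
  "induces_mod e g \<sigma> \<longleftrightarrow> (\<forall>i\<in>{1..4}. \<exists>s. (s = 1 \<or> s = - 1) \<and>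
     (\<forall>k. cong3 ((g *v cusp e i)$k) (s * cusp e (\<sigma> i) $ k)))"

text \<open>The factor of proportionality of two primitive vectors is a unit, hence \<open>\<plusminus>1\<close> modulo \<open>\<surd>-3\<close>.\<close>

lemma induces_imp_induces_mod:
  assumes e: "e = 1 \<or> e = - 1" and g: "g \<in> Gam1" and ind: "induces e g \<sigma>"
  shows "induces_mod e g \<sigma>"
  unfolding induces_mod_def
proof
  fix i :: nat assume i: "i \<in> {1..4}"
  obtain h t where h: "h \<in> Gam1_cong" and t: "t \<noteq> 0" "g *v cusp e i = t *s (h *v cusp e (\<sigma> i))"
    using ind i unfolding induces_def by blast
  have G: "g \<in> Gam" and H: "h \<in> Gam" and HC: "h \<in> Gam_cong"
    using g h by (auto simp: Gam1_def Gam1_cong_def)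
  have int: "(p *v w)$k \<in> O_F" if "p \<in> Gam" "\<And>k. w$k \<in> O_F" for p w k
    using that by (simp add: matrix_vector_mult_def sum_3 Gam_integral)
  have "matrix_inv h *v (g *v cusp e i) = t *s cusp e (\<sigma> i)"
    using Gam_inverse(3)[OF H] by (simp add: t(2) vector_scalar_commute matrix_vector_mul_assoc)
  moreover obtain k where "cusp e (\<sigma> i) $ k = 1" using cusp_one by blast
  \<comment> \<open>A coordinate 1 of a cusp exhibits \<open>t\<close> as an element of
    \<open>O_F\<close>; the same argument for the inverse of \<open>t\<close> follows.\<close>
  ultimately have "t = (matrix_inv h *v (g *v cusp e i)) $ k" by simp
  then have t1: "t \<in> O_F" using int Gam_inverse(1)[OF H] G cusp_integral[OF e] by simp
  have "cusp e i = t *s (matrix_inv g *v (h *v cusp e (\<sigma> i)))"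
    using Gam_inverse(3)[OF G] t(2)
    by (metis matrix_vector_mul_assoc matrix_vector_mul_lid vector_scalar_commute)
  moreover obtain k where "cusp e i $ k = 1" using cusp_one by blast
  ultimately have "t * (matrix_inv g *v (h *v cusp e (\<sigma> i))) $ k = 1"
    by (metis vector_smult_component)
  moreover have "(matrix_inv g *v (h *v cusp e (\<sigma> i))) $ k \<in> O_F"
    using int Gam_inverse(1)[OF G] H cusp_integral[OF e] by simp
  ultimately obtain s where s: "s = 1 \<or> s = - 1" "sq3_dvd (t - s)"
    using O_F_unit_residue[OF t1] by blast
  have "cong3 ((g *v cusp e i)$k) (s * cusp e (\<sigma> i) $ k)" for k
  proof -
    have hI: "cong3 (h$a$b) (if a = b then 1 else 0)" for a b
      using HC by (simp add: Gam_cong_iff cong3_def)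
    have "cong3 ((h *v cusp e (\<sigma> i)) $ k) (cusp e (\<sigma> i) $ k)"
    proof -
      have "cong3 (\<Sum>l\<in>UNIV. cusp e (\<sigma> i) $ l * h$k$l) (\<Sum>l\<in>UNIV. cusp e (\<sigma> i) $ l * (if k = l then 1 else 0))"
        unfolding sum_3 by (intro cong3_add cong3_mult hI cusp_integral e)
      then show ?thesis by (simp add: matrix_vector_mult_def mult.commute if_distrib sum.delta' cong: if_cong)
    qed
    then have "cong3 (t * (h *v cusp e (\<sigma> i)) $ k) (t * cusp e (\<sigma> i) $ k)"
      using t1 by (rule cong3_mult)
    moreover have "cong3 (cusp e (\<sigma> i) $ k * t) (cusp e (\<sigma> i) $ k * s)"
      using s(2) cusp_integral[OF e] by (intro cong3_mult) (simp add: cong3_def)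
    ultimately show ?thesis using t(2) cong3_trans by (simp add: mult.commute)
  qed
  then show "\<exists>s. (s = 1 \<or> s = - 1) \<and> (\<forall>k. cong3 ((g *v cusp e i)$k) (s * cusp e (\<sigma> i) $ k))"
    using s(1) by blast
qed

lemma induces_mod_mult:
  assumes g: "g \<in> Gam" and G: "induces_mod e g \<sigma>" and H: "induces_mod e h \<tau>"
    and \<tau>: "\<And>i. i \<in> {1..4} \<Longrightarrow> \<tau> i \<in> {1..4}"
  shows "induces_mod e (g ** h) (\<sigma> \<circ> \<tau>)"
  unfolding induces_mod_def
proof
  fix i :: nat assume i: "i \<in> {1..4}"
  obtain s where s: "s = 1 \<or> s = - 1" "\<And>k. cong3 ((h *v cusp e i)$k) (s * cusp e (\<tau> i) $ k)"
    using H i unfolding induces_mod_def by blast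
  obtain t where t: "t = 1 \<or> t = - 1" "\<And>k. cong3 ((g *v cusp e (\<tau> i))$k) (t * cusp e (\<sigma> (\<tau> i)) $ k)"
    using G \<tau>[OF i] unfolding induces_mod_def by blast
  have "cong3 ((g ** h *v cusp e i)$k) (s * t * cusp e (\<sigma> (\<tau> i)) $ k)" for k
  proof (rule cong3_trans)
    show "cong3 ((g ** h *v cusp e i)$k) ((g *v (s *s cusp e (\<tau> i))) $ k)"
      unfolding matrix_vector_mul_assoc[symmetric]
      by (rule cong3_matrix_vector[OF Gam_integral[OF g]]) (simp add: s(2))
    have "cong3 (s * (g *v cusp e (\<tau> i)) $ k) (s * (t * cusp e (\<sigma> (\<tau> i)) $ k))"
      using s(1) by (intro cong3_mult t(2)) auto
    then show "cong3 ((g *v (s *s cusp e (\<tau> i))) $ k) (s * t * cusp e (\<sigma> (\<tau> i)) $ k)"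
      by (simp add: vector_scalar_commute mult.assoc)
  qed
  then show "\<exists>s. (s = 1 \<or> s = - 1) \<and> (\<forall>k. cong3 ((g ** h *v cusp e i)$k) (s * cusp e ((\<sigma> \<circ> \<tau>) i) $ k))"
    using s(1) t(1) by (intro exI[of _ "s * t"]) auto
qed

text \<open>A matrix fixing four points of a projective plane in general position is scalar, here
  modulo \<open>sqrtm3\<close>. The scalar is a sign, and determinant 1 in odd dimension makes it
  1.\<close>

lemma induces_mod_id:
  assumes e: "e = 1 \<or> e = - 1" and g: "g \<in> Gam1" and ind: "induces_mod e g \<sigma>"
    and \<sigma>: "\<And>i. i \<in> {1..4} \<Longrightarrow> \<sigma> i = i"
  shows "g \<in> Gam_cong"
proof -
  have G: "g \<in> Gam" "det g = 1" using g by (auto simp: Gam1_def)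
  note I = Gam_integral[OF G(1)]
  have ex: "\<exists>s. (s = 1 \<or> s = - 1) \<and> (\<forall>k. cong3 ((g *v cusp e i)$k) (s * cusp e i $ k))" if "i \<in> {1..4}" for i
    using bspec[OF ind[unfolded induces_mod_def] that] unfolding \<sigma>[OF that] .
  obtain s1 where s1: "s1 = 1 \<or> s1 = - 1" "\<And>k. cong3 ((g *v cusp e 1)$k) (s1 * cusp e 1 $ k)"
    using ex[of 1] by auto
  obtain s2 where s2: "s2 = 1 \<or> s2 = - 1" "\<And>k. cong3 ((g *v cusp e 2)$k) (s2 * cusp e 2 $ k)"
    using ex[of 2] by auto
  obtain s3 where s3: "s3 = 1 \<or> s3 = - 1" "\<And>k. cong3 ((g *v cusp e 3)$k) (s3 * cusp e 3 $ k)"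
    using ex[of 3] by auto
  obtain s4 where s4: "s4 = 1 \<or> s4 = - 1" "\<And>k. cong3 ((g *v cusp e 4)$k) (s4 * cusp e 4 $ k)"
    using ex[of 4] by auto
  have c1: "cong3 (g$1$1) s1" "cong3 (g$2$1) 0" "cong3 (g$3$1) 0"
    using s1(2)[of 1] s1(2)[of 2] s1(2)[of 3] by (simp_all add: cusp_def matrix_vector_mult_def sum_3)
  have c2: "cong3 (g$1$2) 0" "cong3 (g$2$2) s2" "cong3 (g$3$2) 0"
    using s2(2)[of 1] s2(2)[of 2] s2(2)[of 3] by (simp_all add: cusp_def matrix_vector_mult_def sum_3)
  have c3: "cong3 (g$1$1 * rho + g$1$2 + g$1$3 * e) (s3 * rho)"
    "cong3 (g$2$1 * rho + g$2$2 + g$2$3 * e) s3" "cong3 (g$3$1 * rho + g$3$2 + g$3$3 * e) (s3 * e)"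
    using s3(2)[of 1] s3(2)[of 2] s3(2)[of 3] by (simp_all add: cusp_def matrix_vector_mult_def sum_3)
  have c4: "cong3 (g$1$1 * rho + g$1$2 - g$1$3 * e) (s4 * rho)"
    "cong3 (g$2$1 * rho + g$2$2 - g$2$3 * e) s4" "cong3 (g$3$1 * rho + g$3$2 - g$3$3 * e) (- (s4 * e))"
    using s4(2)[of 1] s4(2)[of 2] s4(2)[of 3] by (simp_all add: cusp_def matrix_vector_mult_def sum_3)
  have ee: "e * e = 1" "e \<in> O_F" using e by auto
  have O: "s1 \<in> O_F" "s2 \<in> O_F" "s3 \<in> O_F" "s4 \<in> O_F" using s1(1) s2(1) s3(1) s4(1) by auto
  have r1: "cong3 rho 1" using sq3_dvd_iff[of "-1" 1] by (simp add: cong3_def)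
  have r: "cong3 (s * rho) s" if "s \<in> O_F" for s
    using cong3_mult[OF r1 that] by simp
  have red: "cong3 (y * e) (b - a)" if "cong3 x a" "cong3 (x + y * e) b" for x y a b
    using cong3_diff[OF that(2,1)] by simp
  have red': "cong3 (y * e) (a - b)" if "cong3 x a" "cong3 (x - y * e) b" for x y a b
    using cong3_diff[OF that(1,2)] by simp
  have z: "cong3 (g$3$1 * rho + g$3$2) 0"
    using cong3_add[OF cong3_mult[OF c1(3) O_F_rho] c2(3)] by (simp add: mult.commute)
  have g33: "cong3 (g$3$3 * e) (s3 * e)" "cong3 (g$3$3 * e) (s4 * e)"
    using red[OF z c3(3)] red'[OF z c4(3)] by simp_all
  then have "cong3 (e * (g$3$3 * e)) (e * (s3 * e))" "cong3 (e * (g$3$3 * e)) (e * (s4 * e))"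
    using ee(2) by (auto intro: cong3_mult)
  moreover have ey: "e * (y * e) = y" for y using ee(1) by (simp add: mult.left_commute)
  ultimately have g33: "cong3 (g$3$3) s3" "cong3 (g$3$3) s4" by simp_all
  then have s34: "s3 = s4" using cong3_signs[OF s3(1) s4(1)] cong3_trans cong3_sym by blast
  have y: "cong3 (g$2$1 * rho + g$2$2) s2"
    using cong3_add[OF cong3_mult[OF c1(2) O_F_rho] c2(2)] by (simp add: mult.commute)
  have g23: "cong3 (g$2$3 * e) (s3 - s2)" "cong3 (g$2$3 * e) (s2 - s3)"
    using red[OF y c3(2)] red'[OF y c4(2)] s34 by simp_all
  have x: "cong3 (g$1$1 * rho + g$1$2) s1"
    using cong3_add[OF cong3_trans[OF cong3_mult[OF c1(1) O_F_rho]] c2(1), of s1] r[OF O(1)]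
    by (simp add: mult.commute)
  have g13: "cong3 (g$1$3 * e) (s3 - s1)" "cong3 (g$1$3 * e) (s1 - s3)"
    using red[OF x cong3_trans[OF c3(1) r[OF O(3)]]] red'[OF x cong3_trans[OF c4(1) r[OF O(4)]]] s34
    by simp_all
  \<comment> \<open>Different signs have \<open>s - t = 2\<close> or \<open>s - t = - 2\<close>, so
    the two sides would differ by 4 up to sign, which is not divisible by
    \<open>sqrtm3\<close>.\<close>
  have tw: "s = t" if "s = 1 \<or> s = - 1" "t = 1 \<or> t = - 1" "cong3 (s - t) (t - s)" for s t
  proof (rule ccontr)
    assume "s \<noteq> t"
    then have "sq3_dvd 4 \<or> sq3_dvd (- 4)" using that by (auto simp: cong3_def)
    then show False using sq3_dvd_iff[of 4 0] sq3_dvd_iff[of "-4" 0] by auto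
  qed
  have s23: "s3 = s2" by (rule tw[OF s3(1) s2(1) cong3_trans[OF cong3_sym[OF g23(1)] g23(2)]])
  have s13: "s3 = s1" by (rule tw[OF s3(1) s1(1) cong3_trans[OF cong3_sym[OF g13(1)] g13(2)]])
  have "cong3 (e * (g$2$3 * e)) (e * 0)" "cong3 (e * (g$1$3 * e)) (e * 0)"
    using g23(1) g13(1) ee(2) s23 s13 by (intro cong3_mult; simp)+
  then have z3: "cong3 (g$2$3) 0" "cong3 (g$1$3) 0" by (simp_all add: ey)
  have ss: "s3 * s3 = 1" using s3(1) by auto
  have d: "sq3_dvd (s3 * g$i$k - (if i = k then 1 else 0))" for i k
  proof -
    have "cong3 (g$i$k) (if i = k then s3 else 0)"
      using exhaust_3[of i] exhaust_3[of k] c1 c2 z3 g33(1) s23 s13 by auto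
    from cong3_mult[OF this O(3)] show ?thesis by (simp add: cong3_def ss split: if_splits)
  qed
  have "sq3_dvd (det (\<chi> i k. s3 * g$i$k) - 1)"
    using d I O by (intro det_cong_1) simp_all
  also have "det (\<chi> i k. s3 * g$i$k) = s3 * s3 * s3 * det g" by (simp add: det_3 algebra_simps)
  finally have "cong3 s3 1" using G ss by (simp add: cong3_def)
  then have "s3 = 1" using cong3_signs[OF s3(1), of 1] by simp
  then show ?thesis using d G by (simp add: Gam_cong_iff)
qed

text \<open>Only a 3-cycle has an order not dividing 4. Its product with a transposition is odd, and
  an odd permutation of four letters is a transposition or a 4-cycle. The proof runs through the 24
  permutations.\<close>

lemma S4_exponent:
  fixes \<sigma> :: "nat \<Rightarrow> nat"
  defines "\<tau> \<equiv> Transposition.transpose 1 2"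
  assumes "\<sigma> permutes {1..4}"
  shows "(\<forall>i\<in>{1..4}. ((\<sigma> \<circ> \<sigma>) \<circ> (\<sigma> \<circ> \<sigma>)) i = i) \<or>
    (\<forall>i\<in>{1..4}. (((\<tau> \<circ> \<sigma>) \<circ> (\<tau> \<circ> \<sigma>)) \<circ> ((\<tau> \<circ> \<sigma>) \<circ> (\<tau> \<circ> \<sigma>))) i = i)"
proof -
  have S: "{1..4} = {1, 2, 3, 4::nat}" by auto
  have \<tau>: "\<tau> 1 = 2" "\<tau> 2 = 1" "\<tau> 3 = 3" "\<tau> 4 = 4"
    by (simp_all add: \<tau>_def Transposition.transpose_def)
  have r: "\<sigma> i = 1 \<or> \<sigma> i = 2 \<or> \<sigma> i = 3 \<or> \<sigma> i = 4" if "i \<in> {1, 2, 3, 4}" for i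
    using permutes_in_image[OF assms(2), of i] that unfolding S by blast
  have ne: "\<sigma> i \<noteq> \<sigma> k" if "i \<noteq> k" for i k
    using permutes_inj[OF assms(2)] that by (auto dest: injD)
  define P where "P a b c d \<longleftrightarrow> \<sigma> 1 = a \<and> \<sigma> 2 = b \<and> \<sigma> 3 = c \<and> \<sigma> 4 = d" for a b c d
  have "P 1 2 3 4 \<or> P 1 2 4 3 \<or> P 1 3 2 4 \<or> P 1 3 4 2 \<or> P 1 4 2 3 \<or> P 1 4 3 2 \<or>
    P 2 1 3 4 \<or> P 2 1 4 3 \<or> P 2 3 1 4 \<or> P 2 3 4 1 \<or> P 2 4 1 3 \<or> P 2 4 3 1 \<or>
    P 3 1 2 4 \<or> P 3 1 4 2 \<or> P 3 2 1 4 \<or> P 3 2 4 1 \<or> P 3 4 1 2 \<or> P 3 4 2 1 \<or>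
    P 4 1 2 3 \<or> P 4 1 3 2 \<or> P 4 2 1 3 \<or> P 4 2 3 1 \<or> P 4 3 1 2 \<or> P 4 3 2 1"
    using r[of 1] r[of 2] r[of 3] r[of 4] ne[of 1 2] ne[of 1 3] ne[of 1 4] ne[of 2 3] ne[of 2 4] ne[of 3 4]
    unfolding P_def by (simp del: One_nat_def) (metis (no_types))
  then show ?thesis
    by (elim disjE) (simp_all add: P_def S \<tau> del: One_nat_def)
qed

section \<open>The multiplier of \<open>\<zeta>\<close> and the symmetry of the Eisenstein
  series\<close>

context picard_S4
begin

lemma x_holo: "i \<in> {1..4} \<Longrightarrow> holo (x i)"
proof -
  assume "i \<in> {1..4}"
  then consider "i = 1" | "i = 2" | "i = 3" | "i = 4" unfolding atLeastAtMost_iff by linarith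
  then show ?thesis by cases (simp_all only: x1 x2 x3 x4, (intro holo_intros phi_holo)+)
qed

text \<open>For \<open>j = 2, 3, 4\<close> these are the images of \<open>\<phi>0\<close>,
  \<open>\<phi>1\<close>, \<open>\<phi>2\<close> under the permutation: each of these is
  \<open>(x 1 - x j) / 4\<close>, and \<open>x i\<close> goes to the sign times
  \<open>x (\<sigma> i)\<close>.\<close>

definition perm_form :: "(nat \<Rightarrow> nat) \<Rightarrow> nat \<Rightarrow> pt \<Rightarrow> complex" where
  "perm_form \<sigma> j b = of_int (sign \<sigma>) / 4 * (x (\<sigma> 1) b - x (\<sigma> j) b)"

lemma grad_scaled_diff:
  assumes "holo f" "holo h" "b \<in> Bal"
  shows "grad (\<lambda>b. c * (f b - h b)) b = c *s (grad f b - grad h b)"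
proof -
  have "has_grad (\<lambda>b. c * (f b + - 1 * h b)) (c * (grad f b $ 1 + - 1 * grad h b $ 1))
     (c * (grad f b $ 2 + - 1 * grad h b $ 2)) b"
    by (intro has_grad_cmult has_grad_add holo_has_grad assms)
  then show ?thesis by (simp add: grad_eq vec_eq_iff forall_2 right_diff_distrib)
qed

lemma perm_form_id: "perm_form id 2 = \<phi>0" "perm_form id 3 = \<phi>1" "perm_form id 4 = \<phi>2"
  by (simp_all add: perm_form_def fun_eq_iff phi_x del: One_nat_def)

lemma perm_form_holo:
  "\<sigma> permutes {1..4} \<Longrightarrow> j \<in> {1..4} \<Longrightarrow> holo (perm_form \<sigma> j)"
  unfolding perm_form_def by (intro holo_intros x_holo; simp only: permutes_in_image; simp)

lemma perm_form_alg:
  assumes \<sigma>: "\<sigma> permutes {1..4}" and b: "b \<in> Bal" and j: "j \<in> {1..4}"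
  shows "perm_form \<sigma> j b = of_int (sign \<sigma>) / 4 * dif ((\<lambda>i. x i b) \<circ> \<sigma>) j"
    "grad (perm_form \<sigma> j) b = (of_int (sign \<sigma>) / 4) *s dif ((\<lambda>i. grad (x i) b) \<circ> \<sigma>) j"
proof -
  have "holo (x (\<sigma> 1))" "holo (x (\<sigma> j))"
    using j by (intro x_holo; simp only: permutes_in_image[OF \<sigma>]; simp)+
  moreover have "perm_form \<sigma> j = (\<lambda>b. of_int (sign \<sigma>) / 4 * (x (\<sigma> 1) b - x (\<sigma> j) b))"
    by (simp add: perm_form_def fun_eq_iff)
  ultimately show "grad (perm_form \<sigma> j) b = (of_int (sign \<sigma>) / 4) *s dif ((\<lambda>i. grad (x i) b) \<circ> \<sigma>) j"
    using grad_scaled_diff[of "x (\<sigma> 1)" "x (\<sigma> j)" b] b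
    by (simp only: dif_def o_apply)
qed (simp add: perm_form_def dif_def)

text \<open>The parity of the degree decides between invariance and anti-invariance. Each argument
  carries the sign of the permutation, which is raised to the degree 4, 5 or 6 of
  \<open>alg1\<close>, \<open>alg2\<close>, \<open>alg0\<close>, and alternation adds one more sign.
  So a sign remains for \<open>form1\<close> and \<open>alg0\<close>, and none for
  \<open>form2\<close>.\<close>

lemma form_perm:
  assumes \<sigma>: "\<sigma> permutes {1..4}" and b: "b \<in> Bal"
  shows "form1 (perm_form \<sigma> 2) (perm_form \<sigma> 3) (perm_form \<sigma> 4) b = of_int (sign \<sigma>) *s form1 \<phi>0 \<phi>1 \<phi>2 b" (is ?A)
    and "form2 (perm_form \<sigma> 2) (perm_form \<sigma> 3) (perm_form \<sigma> 4) b = form2 \<phi>0 \<phi>1 \<phi>2 b" (is ?B)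
    and "alg0 (perm_form \<sigma> 2 b) (perm_form \<sigma> 3 b) (perm_form \<sigma> 4 b) =
       of_int (sign \<sigma>) * alg0 (\<phi>0 b) (\<phi>1 b) (\<phi>2 b)" (is ?C)
proof -
  let ?y = "\<lambda>i. x i b" and ?z = "\<lambda>i. grad (x i) b"
  have id: "id permutes {1..4::nat}" by (rule permutes_id)
  have s: "of_int (sign \<sigma>) = (1::complex) \<or> of_int (sign \<sigma>) = (- 1::complex)"
    by (cases \<sigma> rule: sign_cases) auto
  note P = perm_form_alg[OF \<sigma> b]
  have Q': "\<phi>0 b = 1 / 4 * dif ?y 2" "\<phi>1 b = 1 / 4 * dif ?y 3" "\<phi>2 b = 1 / 4 * dif ?y 4"
    "grad \<phi>0 b = (1 / 4) *s dif ?z 2" "grad \<phi>1 b = (1 / 4) *s dif ?z 3" "grad \<phi>2 b = (1 / 4) *s dif ?z 4"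
    using perm_form_alg[OF id b, of 2] perm_form_alg[OF id b, of 3] perm_form_alg[OF id b, of 4]
    by (simp_all add: perm_form_id)
  have "2 \<in> {1..4::nat}" "3 \<in> {1..4::nat}" "4 \<in> {1..4::nat}" by auto
  note P' = this[THEN P(1)] this[THEN P(2)]
  have 4: "(of_int (sign \<sigma>) / 4) ^ 4 = (1 / 4 :: complex) ^ 4"
    "(of_int (sign \<sigma>) / 4) ^ 5 * of_int (sign \<sigma>) = (1 / 4 :: complex) ^ 5"
    "(of_int (sign \<sigma>) / 4) ^ 6 = (1 / 4 :: complex) ^ 6"
    using s by (auto simp: power_divide)
  have A1: "alg1 (dif (?y \<circ> \<sigma>) 2) (dif (?y \<circ> \<sigma>) 3) (dif (?y \<circ> \<sigma>) 4) (dif (?z \<circ> \<sigma>) 2) (dif (?z \<circ> \<sigma>) 3) (dif (?z \<circ> \<sigma>) 4)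
    = of_int (sign \<sigma>) *s alg1 (dif ?y 2) (dif ?y 3) (dif ?y 4) (dif ?z 2) (dif ?z 3) (dif ?z 4)"
    by (rule alg_alternating[of alg1 \<sigma> ?y ?z, OF alg1_swaps(1-4) \<sigma>])
  have A2: "alg2 (dif (?y \<circ> \<sigma>) 2) (dif (?y \<circ> \<sigma>) 3) (dif (?y \<circ> \<sigma>) 4) (dif (?z \<circ> \<sigma>) 2) (dif (?z \<circ> \<sigma>) 3) (dif (?z \<circ> \<sigma>) 4)
    = of_int (sign \<sigma>) *s alg2 (dif ?y 2) (dif ?y 3) (dif ?y 4) (dif ?z 2) (dif ?z 3) (dif ?z 4)"
    by (rule alg_alternating[of alg2 \<sigma> ?y ?z, OF alg2_swaps(1-4) \<sigma>])
  show ?A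
    unfolding form1_alg Q' P' alg1_swaps(5) A1 4(1) vector_smult_assoc by (simp only: mult_ac)
  show ?B
    unfolding form2_alg Q' P' alg2_swaps(5) A2 vector_smult_assoc mult.assoc 4(2) ..
  show ?C
    unfolding Q' P' alg0_swaps(5) alg0_alternating[OF \<sigma>] 4(3) by (simp only: mult_ac)
qed

lemma phi_perm_act:
  assumes \<sigma>: "\<sigma> permutes {1..4}" and g: "g \<in> Gam1" "induces e g \<sigma>" and b: "b \<in> Bal"
  shows "\<phi>0 (act (matrix_inv g) b) = j1 (matrix_inv g) b ^ 3 * perm_form \<sigma> 2 b" (is ?A)
    "\<phi>1 (act (matrix_inv g) b) = j1 (matrix_inv g) b ^ 3 * perm_form \<sigma> 3 b" (is ?B)
    "\<phi>2 (act (matrix_inv g) b) = j1 (matrix_inv g) b ^ 3 * perm_form \<sigma> 4 b" (is ?C)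
proof -
  have "(x 1 (act (matrix_inv g) b) - x k (act (matrix_inv g) b)) / 4 =
      j1 (matrix_inv g) b ^ 3 * perm_form \<sigma> k b" if "k \<in> {1..4}" for k
  proof -
    have "1 \<in> {1..4::nat}" by simp
    from x_act[OF \<sigma> g this b] show ?thesis
      unfolding x_act[OF \<sigma> g that b] perm_form_def
      by (simp only:) (simp add: right_diff_distrib diff_divide_distrib)
  qed
  from this[of 2] this[of 3] this[of 4] show ?A ?B ?C unfolding phi_x by simp_all
qed

lemma zeta_perm_act:
  assumes \<sigma>: "\<sigma> permutes {1..4}" and g: "g \<in> Gam1" "induces e g \<sigma>"
  obtains s where "zmult (matrix_inv g) s" "s ^ 6 = 1"
proof -
  let ?h = "matrix_inv g" and ?c = "of_int (sign \<sigma>) :: complex"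
  have H: "?h \<in> Gam" using g Gam_inverse by (simp add: Gam1_def)
  have c: "?c = 1 \<or> ?c = - 1" by (cases \<sigma> rule: sign_cases) auto
  have zc: "\<zeta> b ^ 3 = \<kappa> * alg0 (\<phi>0 b) (\<phi>1 b) (\<phi>2 b)" if "b \<in> Bal" for b
    using zeta_cube[OF that] by (simp add: \<kappa>_def alg0_def)
  let ?\<theta> = "\<lambda>b. \<zeta> (act ?h b)" and ?\<eta> = "\<lambda>b. j1 ?h b ^ 6 * \<zeta> b"
  have cube: "?\<theta> b ^ 3 = ?c * ?\<eta> b ^ 3" if b: "b \<in> Bal" for b
  proof -
    have "?\<theta> b ^ 3 = \<kappa> * ((j1 ?h b ^ 3) ^ 6 * (?c * alg0 (\<phi>0 b) (\<phi>1 b) (\<phi>2 b)))"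
      unfolding zc[OF act_Bal[OF H b]] phi_perm_act[OF \<sigma> g b] alg0_swaps(5) form_perm(3)[OF \<sigma> b] ..
    also have "\<dots> = ?c * ?\<eta> b ^ 3"
      unfolding power_mult_distrib zc[OF b] by (simp add: power_mult[symmetric] mult_ac)
    finally show ?thesis .
  qed
  have hol: "holo ?\<theta>" "holo ?\<eta>" by (intro holo_act holo_intros holo_j1 zeta_holo H)+
  \<comment> \<open>The equality of cubes splits into three linear factors, one of which must vanish
    identically; hence one cube root of unity works at all points of the ball.\<close>
  have fact: "(?\<theta> b - ?c * ?\<eta> b) * ((?\<theta> b - ?c * rho * ?\<eta> b) * (?\<theta> b - ?c * rho^2 * ?\<eta> b)) = 0"
    if "b \<in> Bal" for b
  proof -
    have "(t - u) * ((t - rho * u) * (t - rho^2 * u)) = t ^ 3 - u ^ 3" for t u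
    proof -
      have "(t - u) * ((t - rho * u) * (t - rho^2 * u)) =
          t ^ 3 - (1 + rho + rho^2) * t^2 * u + (rho + rho^2 + rho ^ 3) * t * u^2 - rho ^ 3 * u ^ 3"
        by (simp add: algebra_simps eval_nat_numeral)
      then show ?thesis by (simp add: rho_sq rho_cube)
    qed
    moreover have "?\<theta> b ^ 3 - (?c * ?\<eta> b) ^ 3 = 0"
    proof -
      have "?c ^ 3 = ?c" by (cases \<sigma> rule: sign_cases) auto
      then show ?thesis unfolding power_mult_distrib[of ?c] cube[OF that] by simp
    qed
    moreover have "?c * rho * ?\<eta> b = rho * (?c * ?\<eta> b)" "?c * rho^2 * ?\<eta> b = rho^2 * (?c * ?\<eta> b)"
      by simp_all
    ultimately show ?thesis by (simp only:)
  qed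
  have "holo (\<lambda>b. ?\<theta> b - ?c * ?\<eta> b)" "holo (\<lambda>b. ?\<theta> b - ?c * rho * ?\<eta> b)"
    "holo (\<lambda>b. ?\<theta> b - ?c * rho^2 * ?\<eta> b)"
    by (intro holo_diff holo_mult[OF holo_const] hol)+
  then have "(\<forall>b\<in>Bal. ?\<theta> b - ?c * ?\<eta> b = 0) \<or> (\<forall>b\<in>Bal. ?\<theta> b - ?c * rho * ?\<eta> b = 0)
      \<or> (\<forall>b\<in>Bal. ?\<theta> b - ?c * rho^2 * ?\<eta> b = 0)"
    using fact by (rule holo_mult3_zero)
  then have z: "zmult ?h (?c * 1) \<or> zmult ?h (?c * rho) \<or> zmult ?h (?c * rho^2)"
    by (simp add: zmult_def mult.assoc)
  have six: "(?c * r) ^ 6 = 1" if "r ^ 3 = 1" for r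
  proof -
    have "r ^ 6 = (r ^ 3) ^ 2" by (simp flip: power_mult)
    then show ?thesis using that c by (auto simp: power_mult_distrib)
  qed
  have "(rho^2) ^ 3 = 1"
    unfolding power_mult[symmetric] using power_mult[of rho 3 2] rho_cube by simp
  then show thesis
    using z six[of 1] six[OF rho_cube] six[of "rho^2"] by (elim disjE) (rule that; simp)+
qed

lemma sixth_fourth:
  assumes "s ^ 6 = 1" "s ^ 4 = 1"
  shows "s^2 = (1::complex)"
proof -
  have "s ^ 6 = s ^ 4 * s^2" by (simp flip: power_add)
  then show ?thesis using assms by simp
qed

text \<open>The fourth power of \<open>g\<close> fixes the cusps, so by
  \<open>induces_mod_id\<close> it lies in the congruence subgroup, where the multiplier of
  \<open>\<zeta>\<close> is the determinant, here 1.\<close>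

lemma zmult_fourth:
  assumes g: "g \<in> Gam1" and ind: "induces_mod e g \<sigma>" and \<sigma>: "\<And>i. i \<in> {1..4} \<Longrightarrow> \<sigma> i \<in> {1..4}"
    and 4: "\<forall>i\<in>{1..4}. ((\<sigma> \<circ> \<sigma>) \<circ> (\<sigma> \<circ> \<sigma>)) i = i" and z: "zmult g s"
  shows "s ^ 4 = 1"
proof -
  have G: "g \<in> Gam" "det g = 1" using g by (auto simp: Gam1_def)
  have G2: "g ** g \<in> Gam" by (rule Gam_mult[OF G(1) G(1)])
  have G4: "(g ** g) ** (g ** g) \<in> Gam" by (rule Gam_mult[OF G2 G2])
  have d: "det ((g ** g) ** (g ** g)) = 1" by (simp add: det_mul G)
  have "induces_mod e (g ** g) (\<sigma> \<circ> \<sigma>)" by (rule induces_mod_mult[OF G(1) ind ind \<sigma>])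
  then have "induces_mod e ((g ** g) ** (g ** g)) ((\<sigma> \<circ> \<sigma>) \<circ> (\<sigma> \<circ> \<sigma>))"
    using \<sigma> by (intro induces_mod_mult[OF G2]) auto
  then have "(g ** g) ** (g ** g) \<in> Gam_cong"
    by (rule induces_mod_id[OF cusp_order, rotated]) (use 4 G4 d in \<open>auto simp: Gam1_def\<close>)
  from zmult_cong[OF this] have "zmult ((g ** g) ** (g ** g)) 1" by (simp add: d)
  moreover have "zmult ((g ** g) ** (g ** g)) ((s * s) * (s * s))"
    by (intro zmult_mult G G2 z)
  ultimately have "(s * s) * (s * s) = 1" using zmult_unique[OF G4] by blast
  then show ?thesis by (simp add: eval_nat_numeral mult_ac)
qed

text \<open>The sixth power of a multiplier is 1, so a fourth power 1 makes its square 1. If the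
  fourth power of the permutation is not the identity, this is applied to \<open>swap_mat\<close>,
  with multiplier \<open>u\<close>, and to \<open>swap_mat ** g\<close>, with multiplier
  \<open>u / s\<close>.\<close>

lemma zeta_perm_act_square:
  assumes \<sigma>: "\<sigma> permutes {1..4}" and g: "g \<in> Gam1" "induces e g \<sigma>" and z: "zmult (matrix_inv g) s"
  shows "s^2 = 1"
proof -
  let ?\<tau> = "Transposition.transpose 1 2 :: nat \<Rightarrow> nat"
  have G: "g \<in> Gam" "det g = 1" using g by (auto simp: Gam1_def)
  have S: "swap_mat \<in> Gam" "det swap_mat = 1" using swap_mat_Gam1 by (auto simp: Gam1_def)
  obtain s' where "zmult (matrix_inv g) s'" "s' ^ 6 = 1" using zeta_perm_act[OF \<sigma> g] by blast
  then have s6: "s ^ 6 = 1" using zmult_unique[OF Gam_inverse(1)[OF G(1)] z] by simp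
  then have s0: "s \<noteq> 0" by auto
  have zg: "zmult g (1 / s)" by (rule zmult_inverse[OF G(1) z s0])
  have t6: "(1 / s) ^ 6 = 1" using s6 by (simp add: power_divide)
  have \<tau>: "?\<tau> permutes {1..4}" by (rule permutes_swap_id) auto
  obtain u where u: "zmult swap_mat u" "u ^ 6 = 1"
    using zeta_perm_act[OF \<tau> swap_mat_Gam1 swap_induces[OF cusp_order]] by (metis swap_mat_inverse)
  have in1: "induces_mod e g \<sigma>" "induces_mod e swap_mat ?\<tau>"
    using induces_imp_induces_mod[OF cusp_order] g swap_mat_Gam1 swap_induces[OF cusp_order] by blast+
  have r: "\<And>i. i \<in> {1..4} \<Longrightarrow> \<sigma> i \<in> {1..4}" "\<And>i. i \<in> {1..4} \<Longrightarrow> ?\<tau> i \<in> {1..4}"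
    using permutes_in_image[OF \<sigma>] permutes_in_image[OF \<tau>] by blast+
  have "u ^ 4 = 1"
    by (rule zmult_fourth[OF swap_mat_Gam1 in1(2) r(2) _ u(1)]) auto
  then have u2: "u^2 = 1" using sixth_fourth u(2) by blast
  have "(1 / s)^2 = 1"
    using S4_exponent[OF \<sigma>]
  proof
    assume "\<forall>i\<in>{1..4}. ((\<sigma> \<circ> \<sigma>) \<circ> (\<sigma> \<circ> \<sigma>)) i = i"
    then show ?thesis using zmult_fourth[OF g(1) in1(1) r(1) _ zg] sixth_fourth[OF t6] by blast
  next
    assume o: "\<forall>i\<in>{1..4}. (((?\<tau> \<circ> \<sigma>) \<circ> (?\<tau> \<circ> \<sigma>)) \<circ> ((?\<tau> \<circ> \<sigma>) \<circ> (?\<tau> \<circ> \<sigma>))) i = i"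
    have "swap_mat ** g \<in> Gam1" using Gam_mult[OF S(1) G(1)] G S by (simp add: Gam1_def det_mul)
    moreover have "induces_mod e (swap_mat ** g) (?\<tau> \<circ> \<sigma>)" by (rule induces_mod_mult[OF S(1) in1(2,1) r(1)])
    ultimately have "(u * (1 / s)) ^ 4 = 1"
      using zmult_fourth[of "swap_mat ** g" "?\<tau> \<circ> \<sigma>" "u * (1 / s)"] r o zmult_mult[OF S(1) G(1) u(1) zg]
      by simp
    moreover have "(u * (1 / s)) ^ 6 = 1" unfolding power_mult_distrib u(2) t6 by simp
    ultimately have "(u * (1 / s))^2 = 1" using sixth_fourth by blast
    then show ?thesis unfolding power_mult_distrib u2 by simp
  qed
  then show ?thesis using s0 by (simp add: power_divide)
qed

lemma form_perm_act:
  assumes \<sigma>: "\<sigma> permutes {1..4}" and g: "g \<in> Gam1" "induces e g \<sigma>" and b: "b \<in> Bal"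
  shows "form1 \<phi>0 \<phi>1 \<phi>2 (act (matrix_inv g) b) =
      (of_int (sign \<sigma>) * j1 (matrix_inv g) b ^ (12 + 1)) *s (j2 (matrix_inv g) b *v form1 \<phi>0 \<phi>1 \<phi>2 b)" (is ?A)
    and "form2 \<phi>0 \<phi>1 \<phi>2 (act (matrix_inv g) b) =
      (1 * j1 (matrix_inv g) b ^ (12 + 4)) *s (j2 (matrix_inv g) b *v form2 \<phi>0 \<phi>1 \<phi>2 b)" (is ?B)
proof -
  have H: "matrix_inv g \<in> Gam" using g Gam_inverse by (simp add: Gam1_def)
  have hol: "holo (perm_form \<sigma> 2)" "holo (perm_form \<sigma> 3)" "holo (perm_form \<sigma> 4)"
    by (intro perm_form_holo \<sigma>; simp)+
  show ?A
    using form_act(1)[OF H b phi_holo hol phi_perm_act[OF \<sigma> g]]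
    by (simp add: form_perm(1)[OF \<sigma> b] vector_scalar_commute vector_smult_assoc mult.commute)
  show ?B
    using form_act(2)[OF H b phi_holo hol phi_perm_act[OF \<sigma> g]]
    by (simp add: form_perm(2)[OF \<sigma> b])
qed

lemma quotient_perm_act:
  assumes E: "vholo E" "\<And>b. b \<in> Bal \<Longrightarrow> \<zeta> b ^ 2 *s E b = N b"
    and \<sigma>: "\<sigma> permutes {1..4}" and g: "g \<in> Gam1" "induces e g \<sigma>" and b: "b \<in> Bal"
    and N: "\<And>b. b \<in> Bal \<Longrightarrow> N (act (matrix_inv g) b) =
      (t * j1 (matrix_inv g) b ^ (12 + m)) *s (j2 (matrix_inv g) b *v N b)"
  shows "slash1 (int m) E (matrix_inv g) b = t *s E b"
proof -
  have H: "matrix_inv g \<in> Gam" using g Gam_inverse by (simp add: Gam1_def)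
  obtain s where s: "zmult (matrix_inv g) s" "s ^ 6 = 1" using zeta_perm_act[OF \<sigma> g] by blast
  then have s0: "s \<noteq> 0" by auto
  have "s^2 = 1" by (rule zeta_perm_act_square[OF \<sigma> g s(1)])
  then show ?thesis
    unfolding slash1_eq_iff[OF H b] using quotient_act[OF H E s(1) s0 N b] by (simp add: mult.commute)
qed

lemma form1_anti_invariant:
  assumes "vholo E" "\<And>b. b \<in> Bal \<Longrightarrow> \<zeta> b ^ 2 *s E b = form1 \<phi>0 \<phi>1 \<phi>2 b"
  shows "S4_anti_invariant e 1 E"
  unfolding S4_anti_invariant_def
  using quotient_perm_act[OF assms, where m = 1, OF _ _ _ _ _ form_perm_act(1)] by auto

lemma form2_invariant:
  assumes "vholo E" "\<And>b. b \<in> Bal \<Longrightarrow> \<zeta> b ^ 2 *s E b = form2 \<phi>0 \<phi>1 \<phi>2 b"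
  shows "S4_invariant e 4 E"
  unfolding S4_invariant_def
  using quotient_perm_act[OF assms, where m = 4 and t = 1, OF _ _ _ _ _ form_perm_act(2)] by auto

end

section \<open>The module\<close>

lemma conv_eq:
  assumes "finite A" "{k. F k \<noteq> (\<lambda>_. 0)} \<subseteq> A" "\<And>y. m 0 y = 0"
  shows "conv m F G n b = (\<Sum>k\<in>A. m (F k b) (G (n - k) b))"
  unfolding conv_def using assms
  by (intro sum.mono_neutral_left) auto

lemma M1_sum: "(\<And>i. i \<in> A \<Longrightarrow> f i \<in> M1 l k) \<Longrightarrow> (\<lambda>b. \<Sum>i\<in>A. f i b) \<in> M1 l k"
  by (induction A rule: infinite_finite_induct) (auto simp: M1_zero M1_add)

lemma M1Mod_sel:
  "carrier (M1Mod l) = direct_sum (M1 l)" "zero (M1Mod l) = (\<lambda>_ _. 0)"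
  "add (M1Mod l) F G = (\<lambda>k b. F k b + G k b)" "smult (M1Mod l) = conv (*s)"
  by (simp_all add: M1Mod_def)

lemma MRing_sel:
  "carrier MRing = direct_sum (M0 0)" "mult MRing = conv (*)" "one MRing = const_form 1"
  "add MRing F G = (\<lambda>k b. F k b + G k b)"
  by (simp_all add: MRing_def)

lemma M1_direct_sum_add:
  assumes "F \<in> direct_sum (M1 l)" "G \<in> direct_sum (M1 l)"
  shows "(\<lambda>k b. F k b + G k b) \<in> direct_sum (M1 l)"
proof -
  have "{k. (\<lambda>b. F k b + G k b) \<noteq> (\<lambda>_. 0)} \<subseteq> {k. F k \<noteq> (\<lambda>_. 0)} \<union> {k. G k \<noteq> (\<lambda>_. 0)}"
    by auto
  then show ?thesis using assms unfolding direct_sum_def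
    by (auto intro: M1_add finite_subset)
qed

lemma conv_support:
  assumes "\<And>y. m 0 y = 0" "\<And>x. m x 0 = 0"
  shows "{n. conv m F G n \<noteq> (\<lambda>_. 0)} \<subseteq>
    (\<lambda>(i, k). i + k) ` ({k. F k \<noteq> (\<lambda>_. 0)} \<times> {k. G k \<noteq> (\<lambda>_. 0)})"
proof
  fix n assume "n \<in> {n. conv m F G n \<noteq> (\<lambda>_. 0)}"
  then obtain b where "(\<Sum>k | F k \<noteq> (\<lambda>_. 0). m (F k b) (G (n - k) b)) \<noteq> 0"
    by (auto simp: conv_def fun_eq_iff)
  then obtain k where "F k \<noteq> (\<lambda>_. 0)" "m (F k b) (G (n - k) b) \<noteq> 0"
    by (metis (mono_tags, lifting) mem_Collect_eq sum.not_neutral_contains_not_neutral)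
  then have "F k \<noteq> (\<lambda>_. 0)" "G (n - k) \<noteq> (\<lambda>_. 0)" using assms by auto
  then show "n \<in> (\<lambda>(i, k). i + k) ` ({k. F k \<noteq> (\<lambda>_. 0)} \<times> {k. G k \<noteq> (\<lambda>_. 0)})"
    by (intro image_eqI[of _ _ "(k, n - k)"]) auto
qed

lemma conv_direct_sum:
  assumes F: "F \<in> direct_sum (M0 0)" and G: "G \<in> direct_sum (M1 l)"
  shows "conv (*s) F G \<in> direct_sum (M1 l)"
proof -
  let ?A = "{k. F k \<noteq> (\<lambda>_. 0)}" and ?B = "{k. G k \<noteq> (\<lambda>_. 0)}"
  have fin: "finite ?A" "finite ?B" using F G by (auto simp: direct_sum_def)
  have "conv (*s) F G n \<in> M1 l n" for n
  proof -
    have "(\<lambda>b. \<Sum>k\<in>?A. F k b *s G (n - k) b) \<in> M1 l n"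
    proof (rule M1_sum)
      fix k
      have "(\<lambda>b. F k b *s G (n - k) b) \<in> M1 (0 + l) (k + (n - k))"
        using F G by (intro M1_smult) (auto simp: direct_sum_def)
      then show "(\<lambda>b. F k b *s G (n - k) b) \<in> M1 l n" by simp
    qed
    then show ?thesis by (simp add: conv_def[abs_def])
  qed
  moreover have "{n. conv (*s) F G n \<noteq> (\<lambda>_. 0)} \<subseteq> (\<lambda>(i, k). i + k) ` (?A \<times> ?B)"
    by (rule conv_support) simp_all
  ultimately show ?thesis using fin unfolding direct_sum_def
    by (auto intro: finite_subset)
qed

text \<open>To exchange the sums, the inner one, over the support of \<open>G\<close> shifted by
  \<open>i\<close>, is extended to the sumset of both supports, which does not depend on
  \<open>i\<close>; the added terms are 0.\<close>

lemma conv_assoc: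
  fixes F G :: "int \<Rightarrow> pt \<Rightarrow> complex" and X :: "int \<Rightarrow> pt \<Rightarrow> complex^2"
  assumes A: "finite {k. F k \<noteq> (\<lambda>_. 0)}" and B: "finite {k. G k \<noteq> (\<lambda>_. 0)}"
  shows "conv (*s) (conv (*) F G) X = conv (*s) F (conv (*s) G X)"
proof (intro ext)
  fix n b
  let ?A = "{k. F k \<noteq> (\<lambda>_. 0)}" and ?B = "{k. G k \<noteq> (\<lambda>_. 0)}"
  let ?S = "(\<lambda>(i, k). i + k) ` (?A \<times> ?B)"
  have fS: "finite ?S" using A B by auto
  have sub: "{k. conv (*) F G k \<noteq> (\<lambda>_. 0)} \<subseteq> ?S"
    by (rule conv_support) simp_all
  have inner: "(\<Sum>k\<in>?S. G (k - i) b *s X (n - k) b) = conv (*s) G X (n - i) b" if i: "i \<in> ?A" for i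
  proof -
    have "conv (*s) G X (n - i) b = (\<Sum>k\<in>(+) i ` ?B. G (k - i) b *s X (n - k) b)"
      by (simp add: conv_def sum.reindex algebra_simps)
    also have "\<dots> = (\<Sum>k\<in>?S. G (k - i) b *s X (n - k) b)"
    proof (rule sum.mono_neutral_left[OF fS])
      show "(+) i ` ?B \<subseteq> ?S" using i by force
      show "\<forall>k\<in>?S - (+) i ` ?B. G (k - i) b *s X (n - k) b = 0"
      proof
        fix k assume k: "k \<in> ?S - (+) i ` ?B"
        have "k - i \<notin> ?B"
        proof
          assume "k - i \<in> ?B"
          then have "i + (k - i) \<in> (+) i ` ?B" by (rule imageI)
          then show False using k by simp
        qed
        then show "G (k - i) b *s X (n - k) b = 0" by simp
      qed
    qed
    finally show ?thesis by simp
  qed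
  have "conv (*s) (conv (*) F G) X n b = (\<Sum>k\<in>?S. (\<Sum>i\<in>?A. F i b * G (k - i) b) *s X (n - k) b)"
    by (subst conv_eq[OF fS sub]) (simp_all add: conv_def)
  also have "\<dots> = (\<Sum>k\<in>?S. \<Sum>i\<in>?A. F i b *s (G (k - i) b *s X (n - k) b))"
    by (intro sum.cong refl) (simp add: vec_eq_iff sum_distrib_right mult.assoc)
  also have "\<dots> = (\<Sum>i\<in>?A. \<Sum>k\<in>?S. F i b *s (G (k - i) b *s X (n - k) b))"
    by (rule sum.swap)
  also have "\<dots> = (\<Sum>i\<in>?A. F i b *s (\<Sum>k\<in>?S. G (k - i) b *s X (n - k) b))"
    by (intro sum.cong refl) (simp add: vec_eq_iff sum_distrib_left mult.assoc)
  also have "\<dots> = conv (*s) F (conv (*s) G X) n b"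
    by (simp add: conv_def[of _ F] inner)
  finally show "conv (*s) (conv (*) F G) X n b = conv (*s) F (conv (*s) G X) n b" .
qed

lemma module_M1Mod:
  assumes "cring MRing"
  shows "module MRing (M1Mod l)"
proof (rule moduleI[OF assms])
  show "abelian_group (M1Mod l)"
  proof (rule abelian_groupI)
    show "\<zero>\<^bsub>M1Mod l\<^esub> \<in> carrier (M1Mod l)" by (simp add: M1Mod_sel direct_sum_def M1_zero)
    show "\<exists>y\<in>carrier (M1Mod l). y \<oplus>\<^bsub>M1Mod l\<^esub> F = \<zero>\<^bsub>M1Mod l\<^esub>" if F: "F \<in> carrier (M1Mod l)" for F
    proof
      have "(\<lambda>b. - F k b) \<in> M1 l k" for k
        using M1_cmult[of "F k" l k "- 1"] F by (simp add: M1Mod_sel direct_sum_def)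
      then show "(\<lambda>k b. - F k b) \<in> carrier (M1Mod l)"
        using F unfolding M1Mod_sel direct_sum_def by (simp add: fun_eq_iff)
      show "(\<lambda>k b. - F k b) \<oplus>\<^bsub>M1Mod l\<^esub> F = \<zero>\<^bsub>M1Mod l\<^esub>" by (simp add: M1Mod_sel)
    qed
  qed (auto simp: M1Mod_sel M1_direct_sum_add add_ac)
next
  fix F G X Y
  assume F: "F \<in> carrier MRing" and G: "G \<in> carrier MRing"
    and X: "X \<in> carrier (M1Mod l)" and Y: "Y \<in> carrier (M1Mod l)"
  let ?A = "{k. F k \<noteq> (\<lambda>_. 0)}" and ?B = "{k. G k \<noteq> (\<lambda>_. 0)}"
  have fin: "finite ?A" "finite ?B" "finite (?A \<union> ?B)" using F G by (auto simp: MRing_sel direct_sum_def)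
  show "F \<odot>\<^bsub>M1Mod l\<^esub> X \<in> carrier (M1Mod l)"
    using F X by (simp add: M1Mod_sel MRing_sel conv_direct_sum)
  show "(F \<oplus>\<^bsub>MRing\<^esub> G) \<odot>\<^bsub>M1Mod l\<^esub> X = F \<odot>\<^bsub>M1Mod l\<^esub> X \<oplus>\<^bsub>M1Mod l\<^esub> G \<odot>\<^bsub>M1Mod l\<^esub> X"
  proof (intro ext)
    fix n b
    have s: "{k. (\<lambda>b. F k b + G k b) \<noteq> (\<lambda>_. 0)} \<subseteq> ?A \<union> ?B" by auto
    show "((F \<oplus>\<^bsub>MRing\<^esub> G) \<odot>\<^bsub>M1Mod l\<^esub> X) n b = (F \<odot>\<^bsub>M1Mod l\<^esub> X \<oplus>\<^bsub>M1Mod l\<^esub> G \<odot>\<^bsub>M1Mod l\<^esub> X) n b"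
      unfolding M1Mod_sel MRing_sel
      by (simp add: conv_eq[OF fin(3) s] conv_eq[OF fin(3), of F] conv_eq[OF fin(3), of G]
          vector_sadd_rdistrib sum.distrib)
  qed
  show "F \<odot>\<^bsub>M1Mod l\<^esub> (X \<oplus>\<^bsub>M1Mod l\<^esub> Y) = F \<odot>\<^bsub>M1Mod l\<^esub> X \<oplus>\<^bsub>M1Mod l\<^esub> F \<odot>\<^bsub>M1Mod l\<^esub> Y"
    by (intro ext) (simp add: M1Mod_sel conv_def vector_add_ldistrib sum.distrib)
  show "(F \<otimes>\<^bsub>MRing\<^esub> G) \<odot>\<^bsub>M1Mod l\<^esub> X = F \<odot>\<^bsub>M1Mod l\<^esub> (G \<odot>\<^bsub>M1Mod l\<^esub> X)"
    using conv_assoc[OF fin(1,2)] by (simp add: M1Mod_sel MRing_sel)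
next
  fix X assume X: "X \<in> carrier (M1Mod l)"
  show "\<one>\<^bsub>MRing\<^esub> \<odot>\<^bsub>M1Mod l\<^esub> X = X"
  proof (intro ext)
    fix n b
    have "conv (*s) (const_form 1) X n b = (\<Sum>k\<in>{0}. const_form 1 k b *s X (n - k) b)"
      by (rule conv_eq) (auto simp: const_form_def homog_def)
    also have "\<dots> = X n b"
    proof -
      have "off_zero (X n)" using X by (simp add: M1Mod_sel direct_sum_def M1_iff)
      then show ?thesis unfolding off_zero_def by (simp add: const_form_def homog_def del: split_paired_All)
    qed
    finally show "(\<one>\<^bsub>MRing\<^esub> \<odot>\<^bsub>M1Mod l\<^esub> X) n b = X n b" by (simp add: M1Mod_sel MRing_sel)
  qed
qed

text \<open>A graded family with finite support is a finite sum of homogeneous ones; the induction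
  is over the set of weights that are kept.\<close>

lemma direct_sum_submodule:
  assumes H: "submodule H MRing (M1Mod l)" and F: "F \<in> carrier (M1Mod l)"
    and hom: "\<And>k f. f \<in> M1 l k \<Longrightarrow> homog k f \<in> H"
  shows "F \<in> H"
proof -
  interpret submodule H MRing "M1Mod l" by (rule H)
  have F': "\<And>k. F k \<in> M1 l k" "finite {k. F k \<noteq> (\<lambda>_. 0)}"
    using F by (auto simp: M1Mod_sel direct_sum_def)
  have "(\<lambda>n. if n \<in> K then F n else (\<lambda>_. 0)) \<in> H" if "finite K" for K
    using that
  proof (induction K)
    case empty
    \<comment> \<open>A submodule is a subgroup of the additive monoid, so \<open>one_closed\<close>
      is about the zero of the module and \<open>m_closed\<close>, below, about sums.\<close>
    show ?case using one_closed by (simp add: M1Mod_sel)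
  next
    case (insert k K)
    have "homog k (F k) \<oplus>\<^bsub>M1Mod l\<^esub> (\<lambda>n. if n \<in> K then F n else (\<lambda>_. 0)) \<in> H"
      using m_closed[OF hom[OF F'(1)] insert.IH] by simp
    also have "homog k (F k) \<oplus>\<^bsub>M1Mod l\<^esub> (\<lambda>n. if n \<in> K then F n else (\<lambda>_. 0)) =
        (\<lambda>n. if n \<in> insert k K then F n else (\<lambda>_. 0))"
      using insert.hyps by (auto simp: M1Mod_sel homog_def fun_eq_iff)
    finally show ?case .
  qed
  from this[OF F'(2)] show ?thesis
    by (rule back_subst[of "\<lambda>X. X \<in> H"]) (auto simp: fun_eq_iff)
qed

section \<open>Generation by the two Eisenstein series\<close>

context picard_S4
begin

context
  fixes E E' :: "pt \<Rightarrow> complex^2"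
  assumes E: "E \<in> M1 1 1" "\<And>b. b \<in> Bal \<Longrightarrow> \<zeta> b ^ 2 *s E b = form1 \<phi>0 \<phi>1 \<phi>2 b"
    and E': "E' \<in> M1 1 4" "\<And>b. b \<in> Bal \<Longrightarrow> \<zeta> b ^ 2 *s E' b = form2 \<phi>0 \<phi>1 \<phi>2 b"
begin

text \<open>The weight \<open>1 + 4 + 1 = 6\<close> is that of \<open>\<zeta>\<close>, so the
  quotient by \<open>\<zeta>\<close> has weight 0 and is constant; \<open>phi_jacobian\<close>
  excludes the constant 0.\<close>

lemma wedge_eq_zeta:
  obtains c where "c \<noteq> 0" "\<And>b. b \<in> Bal \<Longrightarrow> wedge (E b) (E' b) = c * \<zeta> b"
proof -
  have "(\<lambda>b. wedge (E b) (E' b)) \<in> M0 1 6"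
    using M0_wedge[OF E(1) E'(1)] M0_det_cube[of _ 1] by (simp add: numeral_eq_Suc)
  then obtain a where a: "a \<in> M0 0 (6 - 6)" "\<And>b. b \<in> Bal \<Longrightarrow> wedge (E b) (E' b) = \<zeta> b * a b"
    using M0_det_divisible by blast
  obtain c where c: "\<And>b. b \<in> Bal \<Longrightarrow> a b = c" using M0_weight_0 a(1) by auto
  obtain b where b: "b \<in> Bal" "wedge (form1 \<phi>0 \<phi>1 \<phi>2 b) (form2 \<phi>0 \<phi>1 \<phi>2 b) \<noteq> 0"
    using phi_jacobian by blast
  then have "wedge (E b) (E' b) \<noteq> 0"
    by (auto simp: E(2)[symmetric] E'(2)[symmetric] wedge_scale)
  then have "c \<noteq> 0" using a(2)[OF b(1)] c[OF b(1)] by auto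
  then show thesis using that a(2) c by (simp add: mult.commute)
qed

text \<open>The determinant in Cramer's rule is \<open>c * \<zeta>\<close>, and both numerators are
  divisible by \<open>\<zeta>\<close>, so the coefficients stay holomorphic forms. Their weights are
  \<open>k + 5 - 6\<close> and \<open>k + 2 - 6\<close>.\<close>

lemma M1_decompose:
  assumes F: "F \<in> M1 1 k"
  obtains a d where "a \<in> M0 0 (k - 1)" "d \<in> M0 0 (k - 4)" "F = (\<lambda>b. a b *s E b + d b *s E' b)"
proof -
  obtain c where c: "c \<noteq> 0" "\<And>b. b \<in> Bal \<Longrightarrow> wedge (E b) (E' b) = c * \<zeta> b"
    using wedge_eq_zeta by blast
  have "(\<lambda>b. wedge (F b) (E' b)) \<in> M0 1 (k + 5)" "(\<lambda>b. wedge (E b) (F b)) \<in> M0 1 (k + 2)"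
    using M0_wedge[OF F E'(1)] M0_wedge[OF E(1) F] M0_det_cube[of _ 1] by (simp_all add: numeral_eq_Suc add_ac)
  note w = this
  obtain a where a: "a \<in> M0 0 (k + 5 - 6)" "\<And>b. b \<in> Bal \<Longrightarrow> wedge (F b) (E' b) = \<zeta> b * a b"
    using M0_det_divisible[OF w(1)] by blast
  obtain d where d: "d \<in> M0 0 (k + 2 - 6)" "\<And>b. b \<in> Bal \<Longrightarrow> wedge (E b) (F b) = \<zeta> b * d b"
    using M0_det_divisible[OF w(2)] by blast
  let ?a = "\<lambda>b. 1 / c * a b" and ?d = "\<lambda>b. 1 / c * d b"
  have ad: "?a \<in> M0 0 (k - 1)" "?d \<in> M0 0 (k - 4)"
    using M0_cmult[OF a(1), of "1 / c"] M0_cmult[OF d(1), of "1 / c"] by simp_all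
  have eq: "F b $ i = (?a b *s E b + ?d b *s E' b) $ i" if b: "b \<in> Bal" for b i
  proof (rule holo_mult_cancel[OF zeta_holo _ _ _ zeta_nonzero b])
    show "holo (\<lambda>b. F b $ i)" using F by (simp add: M1_iff vholo_def)
    show "holo (\<lambda>b. (?a b *s E b + ?d b *s E' b) $ i)"
    proof -
      have h: "holo ?a" "holo ?d" "holo (\<lambda>b. E b $ i)" "holo (\<lambda>b. E' b $ i)"
        using ad E(1) E'(1) unfolding M1_iff M0_iff vholo_def by blast+
      show ?thesis
        unfolding vector_add_component vector_smult_component
        by (rule holo_add[OF holo_mult[OF h(1,3)] holo_mult[OF h(2,4)]])
    qed
    fix b assume b: "b \<in> Bal"
    have "(c * \<zeta> b) *s F b = (\<zeta> b * a b) *s E b + (\<zeta> b * d b) *s E' b"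
      using cramer[of "E b" "E' b" "F b"] by (simp add: c(2) a(2) d(2) b)
    then have "c * (\<zeta> b * F b $ i) = c * (\<zeta> b * (?a b *s E b + ?d b *s E' b) $ i)"
      using c(1) by (simp add: vec_eq_iff algebra_simps)
    then show "\<zeta> b * F b $ i = \<zeta> b * (?a b *s E b + ?d b *s E' b) $ i" using c(1) by simp
  qed
  have "F b = ?a b *s E b + ?d b *s E' b" for b
  proof (cases "b \<in> Bal")
    case True
    then show ?thesis using eq by (simp add: vec_eq_iff)
  next
    case False
    then have "F b = 0" "?a b = 0" "?d b = 0"
      using F ad unfolding M1_iff M0_iff off_zero_def by blast+
    then show ?thesis by (simp only: vector_smult_lzero add_0)
  qed
  then show thesis using that[OF ad] by blast
qed

lemma M1_generated:
  shows "generated_by MRing (M1Mod 1) {homog 1 E, homog 4 E'}"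
  unfolding generated_by_def
proof (intro conjI allI impI)
  show "module MRing (M1Mod 1)" by (rule module_M1Mod[OF cring_MRing])
  show "{homog 1 E, homog 4 E'} \<subseteq> carrier (M1Mod 1)"
    using E(1) E'(1) by (simp add: M1Mod_sel homog_direct_sum M1_zero)
  fix H assume H: "submodule H MRing (M1Mod 1) \<and> {homog 1 E, homog 4 E'} \<subseteq> H"
  then interpret submodule H MRing "M1Mod 1" by blast
  show "H = carrier (M1Mod 1)"
  proof
    show "H \<subseteq> carrier (M1Mod 1)" using subset by simp
    show "carrier (M1Mod 1) \<subseteq> H"
    proof
      fix F assume F: "F \<in> carrier (M1Mod 1)"
      show "F \<in> H"
      proof (rule direct_sum_submodule[OF conjunct1[OF H] F])
        fix k f assume f: "f \<in> M1 1 k"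
        obtain a d where ad: "a \<in> M0 0 (k - 1)" "d \<in> M0 0 (k - 4)" "f = (\<lambda>b. a b *s E b + d b *s E' b)"
          using M1_decompose[OF f] by blast
        have "homog (k - 1) a \<odot>\<^bsub>M1Mod 1\<^esub> homog 1 E \<in> H" "homog (k - 4) d \<odot>\<^bsub>M1Mod 1\<^esub> homog 4 E' \<in> H"
          using H smult_closed[OF homog_carrier[OF ad(1)]] smult_closed[OF homog_carrier[OF ad(2)]]
          by blast+
        then have "homog (k - 1) a \<odot>\<^bsub>M1Mod 1\<^esub> homog 1 E \<oplus>\<^bsub>M1Mod 1\<^esub>
            homog (k - 4) d \<odot>\<^bsub>M1Mod 1\<^esub> homog 4 E' \<in> H"
          using m_closed by simp
        also have "homog (k - 1) a \<odot>\<^bsub>M1Mod 1\<^esub> homog 1 E \<oplus>\<^bsub>M1Mod 1\<^esub>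
            homog (k - 4) d \<odot>\<^bsub>M1Mod 1\<^esub> homog 4 E' = homog k f"
          by (auto simp: M1Mod_sel conv_homog ad(3) homog_def fun_eq_iff)
        finally show "homog k f \<in> H" .
      qed
    qed
  qed
qed

end

end

theorem theorem13p2:
  fixes e :: complex
    and \<phi>0 \<phi>1 \<phi>2 \<zeta> :: "pt \<Rightarrow> complex"
    and x :: "nat \<Rightarrow> pt \<Rightarrow> complex"
    and \<Phi>0 \<Phi>2 \<Psi>1 \<Psi>2 E11 E14 :: "pt \<Rightarrow> complex^2"
  assumes cusp_order: "e = 1 \<or> e = - 1"
    and phi_form: "\<phi>0 \<in> M0 0 3" "\<phi>1 \<in> M0 0 3" "\<phi>2 \<in> M0 0 3"
    and phi_const: "has_constant_term \<phi>0 1" "has_constant_term \<phi>1 1" "has_constant_term \<phi>2 1"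
    and poly_ring: "is_polynomial_ring MRing const_form (homog 3 \<phi>0) (homog 3 \<phi>1) (homog 3 \<phi>2)"
    and x1: "x 1 = (\<lambda>b. \<phi>0 b + \<phi>1 b + \<phi>2 b)"
    and x2: "x 2 = (\<lambda>b. - 3 * \<phi>0 b + \<phi>1 b + \<phi>2 b)"
    and x3: "x 3 = (\<lambda>b. \<phi>0 b - 3 * \<phi>1 b + \<phi>2 b)"
    and x4: "x 4 = (\<lambda>b. \<phi>0 b + \<phi>1 b - 3 * \<phi>2 b)"
    and S4_x: "\<And>\<sigma> g i b. \<sigma> permutes {1..4} \<Longrightarrow> g \<in> Gam1 \<Longrightarrow> induces e g \<sigma> \<Longrightarrow> i \<in> {1..4} \<Longrightarrow>
        b \<in> Bal \<Longrightarrow> slash0 3 (x i) (matrix_inv g) b = of_int (sign \<sigma>) * x (\<sigma> i) b"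
    and zeta_gen: "S0 1 6 = {\<lambda>b. c * \<zeta> b | c. True}" "\<zeta> \<noteq> (\<lambda>b. 0)"
    and zeta_cube: "\<And>b. b \<in> Bal \<Longrightarrow> \<zeta> b ^ 3 = - rho / (sqrtm3 * 3 ^ 7) *
        (\<phi>0 b * \<phi>1 b * \<phi>2 b * (\<phi>1 b - \<phi>0 b) * (\<phi>2 b - \<phi>0 b) * (\<phi>2 b - \<phi>1 b))"
    and Phi0: "\<Phi>0 = Phi \<phi>1 \<phi>2"
    and Phi2: "\<Phi>2 = Phi \<phi>0 \<phi>1"
    and Psi1: "is_quotient \<Psi>1 (\<lambda>b. (\<phi>0 b * (\<phi>1 b - \<phi>0 b)) *s \<Phi>0 b
                                  - (\<phi>2 b * (\<phi>2 b - \<phi>1 b)) *s \<Phi>2 b) \<zeta>"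
    and Psi2: "is_quotient \<Psi>2
        (\<lambda>b. (\<phi>0 b * (\<phi>0 b - \<phi>1 b) * (\<phi>0 b + \<phi>1 b - 3 * \<phi>2 b)) *s \<Phi>0 b
           - (\<phi>2 b * (\<phi>1 b - \<phi>2 b) * (\<phi>1 b + \<phi>2 b - 3 * \<phi>0 b)) *s \<Phi>2 b) \<zeta>"
    and E11: "is_quotient E11 \<Psi>1 \<zeta>"
    and E14: "is_quotient E14 \<Psi>2 \<zeta>"
  shows "E11 \<in> M1 1 1 \<and> S4_anti_invariant e 1 E11 \<and>
         E14 \<in> M1 1 4 \<and> S4_invariant e 4 E14 \<and>
         generated_by MRing (M1Mod 1) {homog 1 E11, homog 4 E14}"
proof -
  have zeta_form: "\<zeta> \<in> M0 1 6"
  proof -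
    have "\<zeta> \<in> {\<lambda>b. c * \<zeta> b | c. True}" by (auto intro: exI[of _ 1])
    then show ?thesis unfolding zeta_gen(1)[symmetric] by (simp add: S0_def)
  qed
  have zeta_nonzero: "\<exists>b\<in>Bal. \<zeta> b \<noteq> 0"
  proof (rule ccontr)
    assume "\<not> ?thesis"
    then have "\<zeta> b = 0" for b
      using zeta_form unfolding M0_iff off_zero_def by (cases "b \<in> Bal") blast+
    then show False using zeta_gen(2) by blast
  qed
  interpret picard_S4 \<phi>0 \<phi>1 \<phi>2 \<zeta> e x
    by unfold_locales (fact phi_form poly_ring zeta_form zeta_nonzero zeta_cube cusp_order phi_const x1 x2 x3 x4 S4_x)+
  \<comment> \<open>The two successive quotients by \<open>\<zeta>\<close> are merged into one
    equation with \<open>\<zeta>^2\<close>, from which the denominators never have to be taken apart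
    again.\<close>
  have quot: "off_zero E" "vholo E" "\<And>b. b \<in> Bal \<Longrightarrow> \<zeta> b ^ 2 *s E b = N b"
    if "is_quotient \<Psi> N \<zeta>" "is_quotient E \<Psi> \<zeta>" for E N \<Psi>
    using that by (simp_all add: is_quotient_def power2_eq_square vector_smult_assoc[symmetric]
        del: vector_smult_assoc)
  note E1 = quot[OF Psi1 E11, unfolded Phi0 Phi2, folded form1_def]
    and E2 = quot[OF Psi2 E14, unfolded Phi0 Phi2, folded form2_def]
  show ?thesis
    using form_M1(1)[OF E1] form_M1(2)[OF E2] form1_anti_invariant[OF E1(2,3)] form2_invariant[OF E2(2,3)]
      M1_generated[OF _ E1(3) _ E2(3)] by blast
qed

end
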